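(* Let $n\ge 5$, let $T^n$, $B^n$, $C^n$ be the $n$-simplex, the $n$-cube and the $n$-cross-polytope. Write $g$ for the number of flags and $f_k$ for the number of $k$-faces of a mix. Then: (1) For $T^n\diamond B^n$: $g=2^{n-1}\,n!\,(n+1)!$, $f_0=2^{n-1}(n+1)!$, $f_{n-1}=2n(n+1)$, and $f_k=2^{n-k}(n-k)!\binom{n+1}{k+1}\binom{n}{k}$ for $1\le k\le n-1$. (2) For $T^n\diamond C^n$: $g=2^{n-1}\,n!\,(n+1)!$, $f_0=2n(n+1)$, $f_{n-1}=2^{n-1}(n+1)!$, and $f_k=2^{k+1}(k+1)!\binom{n+1}{k+1}\binom{n}{k+1}$ for $0\le k\le n-2$. (3) For $B^n\diamond C^n$: $g=2^{2n-1}(n!)^2$, $f_0=f_{n-1}=2^{n+1}n$, and $f_k=2^{n+2}\binom{n}{k}\binom{n}{k+1}$ for $1\le k\le n-2$. (4) For $T^n\diamond B^n\diamond C^n$: $g=2^{2n-2}(n!)^2(n+1)!$, $f_0=f_{n-1}=2^n n\,(n+1)!$, and $f_k=2^{n+1}(n+1)!\binom{n}{k}\binom{n}{k+1}$ for $1\le k\le n-2$.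
   Context: $T^n,B^n,C^n$ are the face lattices of the regular convex $n$-polytopes of Schläfli types $\{3,\dots,3\}$, $\{4,3,\dots,3\}$, $\{3,\dots,3,4\}$ ($n-1$ entries each). For such a polytope $\mathcal P$ with a fixed base flag (maximal chain) $\Phi$, its automorphism group is $\langle\rho_0,\dots,\rho_{n-1}\rangle$, where $\rho_i$ maps $\Phi$ to the unique flag differing from $\Phi$ exactly in its $i$-face. Put $\sigma_i=\rho_{i-1}\rho_i$ for $1\le i\le n-1$; the rotation group is $\Gamma^+(\mathcal P)=\langle\sigma_1,\dots,\sigma_{n-1}\rangle$. Mix. For such polytopes $\mathcal P_1,\dots,\mathcal P_m$ of rank $n$ with rotation-group generators $\sigma_i^{(r)}$, let $\beta_i=(\sigma_i^{(1)},\dots,\sigma_i^{(m)})$ for $1\le i\le n-1$ and let $\Gamma^+=\langle\beta_1,\dots,\beta_{n-1}\rangle\le\Gamma^+(\mathcal P_1)\times\cdots\times\Gamma^+(\mathcal P_m)$. For $I\subseteq\{0,\dots,n-1\}$ put $\Gamma^+_I=\langle\beta_i\beta_{i+1}\cdots\beta_j\mid 1\le i\le j\le n-1,\ i-1\in I,\ j\in I\rangle$. The mix $\mathcal P_1\diamond\cdots\diamond\mathcal P_m$ is the poset whose $j$-faces ($0\le j\le n-1$) are the right cosets of $\Gamma^+_{\{0,\dots,n-1\}\setminus\{j\}}$ in $\Gamma^+$, together with a least face of rank $-1$ and a greatest face of rank $n$, where a $j$-face is below a $k$-face ($j<k$) if and only if the two cosets intersect. It is always a flag-connected pre-polytope (it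 satisfies all axioms of an abstract polytope except possibly strong flag-connectivity). A flag is a maximal chain, and a $k$-face is a face of rank $k$. *)

theory Defs
  imports
    "HOL-Analysis.Analysis"
    "HOL-Algebra.Bij"
    "HOL-Algebra.Coset"
    "HOL-Algebra.Generated_Groups"
    "HOL-Algebra.Product_Groups"
begin

section \<open>Ranked posets, flags and rotation groups\<close>

record 'f ranked_poset =
  faces :: "'f set"
  below :: "'f \<Rightarrow> 'f \<Rightarrow> bool"  \<comment> \<open>the strict order\<close>
  face_rank :: "'f \<Rightarrow> int"

definition k_faces :: "'f ranked_poset \<Rightarrow> int \<Rightarrow> 'f set" where
  "k_faces P k = {F \<in> faces P. face_rank P F = k}"

definition flags :: "'f ranked_poset \<Rightarrow> 'f set set" where
  "flags P = {\<Phi>. pred_on.maxchain (faces P) (below P) \<Phi>}"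

text \<open>Products in \<open>BijGroup\<close> are compositions from right to left. Letting automorphisms act
  from the right instead yields the opposite group; inversion is an isomorphism onto it and
  fixes every \<open>rho P \<Phi> i\<close> (an involution), so mixes do not depend on this convention.\<close>

definition poset_aut :: "'f ranked_poset \<Rightarrow> ('f \<Rightarrow> 'f) set" where
  "poset_aut P = {f \<in> Bij (faces P).
     \<forall>F \<in> faces P. \<forall>G \<in> faces P. below P (f F) (f G) \<longleftrightarrow> below P F G}"

definition AutPoset :: "'f ranked_poset \<Rightarrow> ('f \<Rightarrow> 'f) monoid" where
  "AutPoset P = BijGroup (faces P) \<lparr>carrier := poset_aut P\<rparr>"

definition adjacent_flag :: "'f ranked_poset \<Rightarrow> nat \<Rightarrow> 'f set \<Rightarrow> 'f set" where
  "adjacent_flag P i \<Phi> = (THE \<Psi>. \<Psi> \<in> flags P \<and> \<Psi> \<noteq> \<Phi> \<and>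
     {F \<in> \<Psi>. face_rank P F \<noteq> int i} = {F \<in> \<Phi>. face_rank P F \<noteq> int i})"

definition rho :: "'f ranked_poset \<Rightarrow> 'f set \<Rightarrow> nat \<Rightarrow> 'f \<Rightarrow> 'f" where
  "rho P \<Phi> i = (THE f. f \<in> poset_aut P \<and> f ` \<Phi> = adjacent_flag P i \<Phi>)"

definition sigma :: "'f ranked_poset \<Rightarrow> 'f set \<Rightarrow> nat \<Rightarrow> 'f \<Rightarrow> 'f" where
  "sigma P \<Phi> i = rho P \<Phi> (i - 1) \<otimes>\<^bsub>AutPoset P\<^esub> rho P \<Phi> i"

definition rotation_group :: "nat \<Rightarrow> 'f ranked_poset \<Rightarrow> 'f set \<Rightarrow> ('f \<Rightarrow> 'f) monoid" where
  "rotation_group n P \<Phi> = subgroup_generated (AutPoset P) (sigma P \<Phi> ` {1..n-1})"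


section \<open>The mix\<close>

text \<open>A mix of rank \<open>n\<close> is formed from a list of polytopes with base flags.\<close>

definition mix_beta :: "('f ranked_poset \<times> 'f set) list \<Rightarrow> nat \<Rightarrow> nat \<Rightarrow> 'f \<Rightarrow> 'f" where
  "mix_beta Ps i = (\<lambda>r \<in> {..<length Ps}. sigma (fst (Ps ! r)) (snd (Ps ! r)) i)"

definition mix_group :: "nat \<Rightarrow> ('f ranked_poset \<times> 'f set) list \<Rightarrow> (nat \<Rightarrow> 'f \<Rightarrow> 'f) monoid" where
  "mix_group n Ps = subgroup_generated
     (product_group {..<length Ps} (\<lambda>r. rotation_group n (fst (Ps ! r)) (snd (Ps ! r))))
     (mix_beta Ps ` {1..n-1})"

definition beta_prod :: "nat \<Rightarrow> ('f ranked_poset \<times> 'f set) list \<Rightarrow> nat \<Rightarrow> nat \<Rightarrow> nat \<Rightarrow> 'f \<Rightarrow> 'f" where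
  "beta_prod n Ps i j =
     foldr (\<lambda>l x. mix_beta Ps l \<otimes>\<^bsub>mix_group n Ps\<^esub> x) [i..<Suc j] \<one>\<^bsub>mix_group n Ps\<^esub>"

definition mix_subgroup ::
    "nat \<Rightarrow> ('f ranked_poset \<times> 'f set) list \<Rightarrow> nat set \<Rightarrow> (nat \<Rightarrow> 'f \<Rightarrow> 'f) set" where
  "mix_subgroup n Ps I = generate (mix_group n Ps)
     {beta_prod n Ps i j | i j. 1 \<le> i \<and> i \<le> j \<and> j \<le> n - 1 \<and> i - 1 \<in> I \<and> j \<in> I}"

text \<open>Cosets carry their rank, so that faces of different ranks are distinct even if they
  should be equal as sets of group elements.\<close>

datatype 'g mix_face = Least_Face | Coset_Face nat "'g set" | Greatest_Face

fun mix_below :: "'g mix_face \<Rightarrow> 'g mix_face \<Rightarrow> bool" where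
  "mix_below Least_Face G \<longleftrightarrow> G \<noteq> Least_Face"
| "mix_below (Coset_Face j A) (Coset_Face k B) \<longleftrightarrow> j < k \<and> A \<inter> B \<noteq> {}"
| "mix_below (Coset_Face j A) G \<longleftrightarrow> G = Greatest_Face"
| "mix_below Greatest_Face G \<longleftrightarrow> False"

fun mix_rank :: "nat \<Rightarrow> 'g mix_face \<Rightarrow> int" where
  "mix_rank n Least_Face = -1"
| "mix_rank n (Coset_Face j A) = int j"
| "mix_rank n Greatest_Face = int n"

definition mix ::
    "nat \<Rightarrow> ('f ranked_poset \<times> 'f set) list \<Rightarrow> (nat \<Rightarrow> 'f \<Rightarrow> 'f) mix_face ranked_poset" where
  "mix n Ps = \<lparr>
     faces = {Least_Face, Greatest_Face} \<union>
       {Coset_Face j A | j A. j < n \<and>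
          A \<in> rcosets\<^bsub>mix_group n Ps\<^esub> (mix_subgroup n Ps ({0..n-1} - {j}))},
     below = mix_below,
     face_rank = mix_rank n\<rparr>"


section \<open>Simplex, cube and cross-polytope\<close>

text \<open>The empty face has rank \<open>aff_dim {} = -1\<close>.\<close>

definition face_lattice :: "'a::euclidean_space set \<Rightarrow> 'a set ranked_poset" where
  "face_lattice K = \<lparr>faces = {F. F face_of K}, below = (\<subset>), face_rank = aff_dim\<rparr>"

definition simplex_apex :: "'a::euclidean_space" where
  "simplex_apex = ((1 + sqrt (1 + real DIM('a))) / real DIM('a)) *\<^sub>R One"

text \<open>The apex is chosen such that the simplex below is regular, with edge length \<open>sqrt 2\<close>.\<close>

lemma simplex_vertices_equidistant:
  fixes x y :: "'a::euclidean_space"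
  assumes x: "x \<in> insert simplex_apex Basis" and y: "y \<in> insert simplex_apex Basis"
    and xy: "x \<noteq> y"
  shows "dist x y = sqrt 2"
proof -
  have basis: "dist b b' = sqrt 2" if "b \<in> Basis" "b' \<in> Basis" "b \<noteq> b'" for b b' :: 'a
    using that by (simp add: dist_norm norm_eq_sqrt_inner inner_diff_left inner_diff_right inner_Basis)
  have apex: "dist b simplex_apex = sqrt 2" if b: "b \<in> Basis" for b :: 'a
  proof -
    define d where "d = real DIM('a)"
    define c where "c = (1 + sqrt (1 + d)) / d"
    have d: "d > 0" by (simp add: d_def)
    have dc: "d * c = 1 + sqrt (1 + d)" using d by (simp add: c_def)
    have "d * (d * c\<^sup>2 - 2 * c - 1) = (d * c - 1)\<^sup>2 - (1 + d)"
      by (simp add: power2_eq_square algebra_simps)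
    also have "\<dots> = 0" using d by (simp add: dc)
    finally have root: "d * c\<^sup>2 - 2 * c = 1" using d by simp
    have bO: "b \<bullet> One = 1" "One \<bullet> b = 1" and OO: "One \<bullet> (One :: 'a) = d"
      using b by (simp_all add: inner_commute[of b] inner_sum_left inner_sum_right inner_Basis d_def)
    have "(b - c *\<^sub>R One) \<bullet> (b - c *\<^sub>R One) = 1 - 2 * c + d * c\<^sup>2"
      using b by (simp only: inner_diff_left inner_diff_right inner_scaleR_left inner_scaleR_right bO OO)
        (simp add: power2_eq_square algebra_simps)
    also have "\<dots> = 2" using root by simp
    finally show ?thesis
      by (simp add: dist_norm norm_eq_sqrt_inner simplex_apex_def c_def d_def)
  qed
  show ?thesis
    using x y xy basis apex apex[unfolded dist_commute[of _ simplex_apex]] by auto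
qed

definition simplex_lattice :: "'a::euclidean_space set ranked_poset" where
  "simplex_lattice = face_lattice (convex hull (insert simplex_apex Basis))"

definition cube_lattice :: "'a::euclidean_space set ranked_poset" where
  "cube_lattice = face_lattice (cbox (- One) One)"

definition cross_polytope_lattice :: "'a::euclidean_space set ranked_poset" where
  "cross_polytope_lattice = face_lattice (convex hull (Basis \<union> uminus ` Basis))"

end

theory Submission
  imports Defs "HOL-Combinatorics.Permutations"
begin

text \<open>
  Write \<open>\<rho>\<^sub>0, \<dots>, \<rho>\<^sub>n\<^sub>-\<^sub>1\<close> for the tuples of distinguished involutions of the factors. They generate a group
  \<open>\<Gamma>\<close> with a sign homomorphism that is \<open>-1\<close> on every \<open>\<rho>\<^sub>i\<close>, and \<open>\<Gamma>\<^sup>+\<close> consists of the products of even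
  length. Because \<open>\<beta>\<^sub>i \<cdots> \<beta>\<^sub>j = \<rho>\<^sub>i\<^sub>-\<^sub>1 \<rho>\<^sub>j\<close>, the subgroup that defines the \<open>k\<close>-faces is likewise the even part
  of the group generated by all \<open>\<rho>\<^sub>i\<close> with \<open>i \<noteq> k\<close>. Involutions with distant indices commute, so the
  latter group is the product of a lower part (indices below \<open>k\<close>) and an upper part (indices above
  \<open>k\<close>). Two consequences: a pairwise incident family of cosets always has a common representative in
  \<open>\<Gamma>\<close>, which makes \<open>\<Gamma>\<close> act simply transitively on the flags of the mix (\<open>card_flags_mix\<close>); and
  \<open>f\<^sub>k \<cdot> |lower part| \<cdot> |upper part| = |\<Gamma>|\<close> by the theorem of Lagrange (\<open>card_faces_mix\<close>).

  It remains to find the orders of \<open>\<Gamma>\<close> and of its lower and upper parts. On the simplex the involutions are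
  the adjacent transpositions of \<open>n + 1\<close> points. On the cube they are a sign change, followed by the
  adjacent transpositions of \<open>n\<close> coordinates; on the cross-polytope the same in the opposite order.
  Hence a lower or upper part that does not see the sign change of a factor is a symmetric group, acting on all such
  factors in the same way. Where a factor does see its sign change, the entry \<open>4\<close> of its Schlaefli
  symbol is opposite to an entry \<open>3\<close> of the other factors. The ninth power of the corresponding rotation
  is then trivial in the other factors and equals the rotation itself in this factor, so \<open>\<Gamma>\<close>
  contains that rotation alone. Conjugation along the diagram yields all rotations of this
  factor (\<open>even_words_in_kernel\<close>), and the order of the mix is the order of the mix of the other factors times
  the number of rotations of this one (\<open>card_pair_words\<close>).

  All groups are handled through words in the letters \<open>0, \<dots>, n - 1\<close>: a group element is the value
  \<open>R w\<close> of a word, and all counts depend only on which pairs of words have the same value.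

  The geometric input is that the face lattices of simplex, cross-polytope and cube are, respectively, the
  lattice of all subsets of \<open>n + 1\<close> points, the complex of antipode-free subsets of the \<open>2n\<close> points \<open>\<plusminus>b\<close> with a
  greatest element added, and the order dual of the latter. In such a lattice an
  automorphism that fixes a flag is trivial, and every flag becomes the standard flag after relabelling the
  points, so that the involutions can be read off from the labels.
\<close>

section \<open>Words in involutive generators\<close>

lemma card_image_cong_kernel:
  assumes "\<And>u v. u \<in> A \<Longrightarrow> v \<in> A \<Longrightarrow> f u = f v \<longleftrightarrow> g u = g v"
  shows "card (f ` A) = card (g ` A)"
proof (rule bij_betw_same_card)
  define h where "h y = g (SOME u. u \<in> A \<and> f u = y)" for y
  have h: "h (f u) = g u" if "u \<in> A" for u
  proof -
    have "\<exists>v. v \<in> A \<and> f v = f u" using that by blast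
    from someI_ex[OF this] show ?thesis using assms that unfolding h_def by blast
  qed
  show "bij_betw h (f ` A) (g ` A)"
    unfolding bij_betw_def inj_on_def using h assms by (auto simp: image_iff) 
qed

text \<open>Words stay in the form \<open>w \<in> lists I\<close>, on which the lemmas below are stated, instead of being
  unfolded to their letters.\<close>

declare in_listsD [rule del] in_listsI [rule del]

lemma rev_in_lists [simp]: "rev w \<in> lists A \<longleftrightarrow> w \<in> lists A"
  by (simp add: in_lists_conv_set)

definition even_words :: "nat set \<Rightarrow> nat list set" where
  "even_words I = {w \<in> lists I. even (length w)}"

text \<open>A map on words over \<open>I\<close> that behaves like evaluation in a group in which all letters are
  involutions; inverses are then values of reversed words, and no group needs to be named.\<close>

locale word_map =
  fixes I :: "nat set" and R :: "nat list \<Rightarrow> 'e"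
  assumes cong: "\<lbrakk>x \<in> lists I; u \<in> lists I; v \<in> lists I; y \<in> lists I; R u = R v\<rbrakk>
      \<Longrightarrow> R (x @ u @ y) = R (x @ v @ y)"
    and invol: "i \<in> I \<Longrightarrow> R [i, i] = R []"
begin

lemma cong_left: "\<lbrakk>x \<in> lists I; u \<in> lists I; v \<in> lists I; R u = R v\<rbrakk> \<Longrightarrow> R (x @ u) = R (x @ v)"
  using cong[of x u v "[]"] by simp

lemma cong_right: "\<lbrakk>u \<in> lists I; v \<in> lists I; y \<in> lists I; R u = R v\<rbrakk> \<Longrightarrow> R (u @ y) = R (v @ y)"
  using cong[of "[]" u v y] by simp

lemma drop_trivial:
  "\<lbrakk>x \<in> lists I; u \<in> lists I; y \<in> lists I; R u = R []\<rbrakk> \<Longrightarrow> R (x @ u @ y) = R (x @ y)"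
  using cong[of x u "[]" y] by simp

lemma rev_right: "w \<in> lists I \<Longrightarrow> R (w @ rev w) = R []"
proof (induction w rule: rev_induct)
  case (snoc i w)
  then show ?case using drop_trivial[of w "[i, i]" "rev w"] invol[of i] by simp
qed simp

lemma rev_left: "w \<in> lists I \<Longrightarrow> R (rev w @ w) = R []"
  using rev_right[of "rev w"] by simp

lemma cancel_left:
  assumes "x \<in> lists I" "u \<in> lists I" "v \<in> lists I"
  shows "R (x @ u) = R (x @ v) \<longleftrightarrow> R u = R v"
proof
  assume "R (x @ u) = R (x @ v)"
  then have "R (rev x @ x @ u) = R (rev x @ x @ v)" using assms by (simp add: cong_left[of "rev x" "x @ u" "x @ v"])
  moreover have e: "R (rev x @ x @ t) = R t" if "t \<in> lists I" for t
    using drop_trivial[of "[]" "rev x @ x" t] rev_left[of x] that assms by simp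
  ultimately show "R u = R v" using e[of u] e[of v] assms(2,3) by metis
next
  assume "R u = R v"
  then show "R (x @ u) = R (x @ v)" using assms by (intro cong_left)
qed

lemma cancel_right:
  assumes "x \<in> lists I" "u \<in> lists I" "v \<in> lists I"
  shows "R (u @ x) = R (v @ x) \<longleftrightarrow> R u = R v"
proof
  assume "R (u @ x) = R (v @ x)"
  then have "R ((u @ x) @ rev x) = R ((v @ x) @ rev x)" using assms cong_right[of "u @ x" "v @ x" "rev x"] by simp
  moreover have e: "R (t @ x @ rev x) = R t" if "t \<in> lists I" for t
    using drop_trivial[of t "x @ rev x" "[]"] rev_right[of x] that assms by simp
  ultimately show "R u = R v" using e[of u] e[of v] assms(2,3) by (metis append_assoc)
next
  assume "R u = R v"
  then show "R (u @ x) = R (v @ x)" using assms by (intro cong_right)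
qed

lemma rev_cong:
  assumes "u \<in> lists I" "v \<in> lists I" "R u = R v" shows "R (rev u) = R (rev v)"
proof -
  have "R (u @ rev u) = R (u @ rev v)"
    using cong_right[of u v "rev v"] rev_right[of u] rev_right[of v] assms by simp
  then show ?thesis using cancel_left[of u "rev u" "rev v"] assms by simp
qed

lemma eq_iff_rev:
  assumes "u \<in> lists I" "v \<in> lists I" shows "R u = R v \<longleftrightarrow> R (u @ rev v) = R []"
  using cancel_right[of "rev v" u v] rev_right[of v] assms by simp

lemma restrict:
  assumes "J \<subseteq> I" shows "word_map J R"
proof
  fix x u v y assume "x \<in> lists J" "u \<in> lists J" "v \<in> lists J" "y \<in> lists J" "R u = R v"
  then show "R (x @ u @ y) = R (x @ v @ y)" using lists_mono[OF assms] by (intro cong[of x u v y]) blast+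
next
  fix i assume "i \<in> J" then show "R [i, i] = R []" using assms invol by blast
qed

lemma same_parity:
  assumes par: "\<And>w. w \<in> lists I \<Longrightarrow> R w = R [] \<Longrightarrow> even (length w)"
    and "u \<in> lists I" "v \<in> lists I" "R u = R v"
  shows "even (length u) \<longleftrightarrow> even (length v)"
  using par[of "u @ rev v"] eq_iff_rev[of u v] assms by auto

lemma card_double_even:
  assumes par: "\<And>w. w \<in> lists I \<Longrightarrow> R w = R [] \<Longrightarrow> even (length w)"
    and fin: "finite (R ` lists I)" and ne: "I \<noteq> {}"
  shows "card (R ` lists I) = 2 * card (R ` even_words I)"
proof -
  obtain i where i: "i \<in> I" using ne by blast
  define W where "W = {w \<in> lists I. odd (length w)}"
  have un: "lists I = even_words I \<union> W" by (auto simp: even_words_def W_def)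
  have "R ` W = (\<lambda>v. R ([i] @ v)) ` even_words I"
  proof (intro equalityI subsetI)
    fix y assume "y \<in> R ` W"
    then obtain w where w: "w \<in> lists I" "odd (length w)" "y = R w" by (auto simp: W_def)
    have "R ([i] @ [i] @ w) = R w" using drop_trivial[of "[]" "[i,i]" w] w i invol by simp
    then show "y \<in> (\<lambda>v. R ([i] @ v)) ` even_words I"
      using w i by (intro image_eqI[of _ _ "i # w"]) (auto simp: even_words_def)
  qed (use i in \<open>auto simp: even_words_def W_def\<close>)
  moreover have "card ((\<lambda>v. R ([i] @ v)) ` even_words I) = card (R ` even_words I)"
    by (rule card_image_cong_kernel) (use i in \<open>simp add: even_words_def cancel_left[of "[i]", simplified]\<close>)
  ultimately have "card (R ` W) = card (R ` even_words I)" by simp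
  moreover have "R ` even_words I \<inter> R ` W = {}"
  proof (rule equals0I)
    fix y assume "y \<in> R ` even_words I \<inter> R ` W"
    then obtain u v where "u \<in> even_words I" "v \<in> W" "R u = R v" by (metis IntE imageE)
    then show False using same_parity[of u v] par by (simp add: even_words_def W_def)
  qed
  ultimately show ?thesis using fin unfolding un image_Un by (subst card_Un_disjoint) auto
qed

lemma move_letter:
  assumes "x \<in> I" "a \<in> lists A" "A \<subseteq> I" "\<And>y. y \<in> A \<Longrightarrow> R [x, y] = R [y, x]"
  shows "R (x # a) = R (a @ [x])"
  using assms(2)
proof (induction a)
  case (Cons y a)
  then have "y \<in> I" "a \<in> lists I" "y \<in> A" using assms(3) lists_mono[of A I] by auto
  then have "R (x # y # a) = R (y # x # a)"
    using cong_right[of "[x, y]" "[y, x]" a] assms by simp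
  also have "\<dots> = R ((y # a) @ [x])"
    using cong_left[of "[y]" "x # a" "a @ [x]"] Cons \<open>y \<in> I\<close> \<open>a \<in> lists I\<close> assms by simp
  finally show ?case .
qed simp

text \<open>Letters of \<open>B\<close> can be moved to the right past all letters of \<open>A\<close>.\<close>

lemma split_commuting:
  assumes "A \<subseteq> I" "B \<subseteq> I" "\<And>x y. x \<in> A \<Longrightarrow> y \<in> B \<Longrightarrow> R [x, y] = R [y, x]"
    and "w \<in> lists (A \<union> B)"
  shows "\<exists>a\<in>lists A. \<exists>b\<in>lists B. R w = R (a @ b)"
  using assms(4)
proof (induction w)
  case Nil then show ?case by (metis append.right_neutral lists.Nil)
next
  case (Cons x w)
  then obtain a b where ab: "a \<in> lists A" "b \<in> lists B" "R w = R (a @ b)" by auto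
  have I: "a \<in> lists I" "b \<in> lists I" "x \<in> I" "w \<in> lists I"
    using ab assms(1,2) Cons.hyps lists_mono[of A I] lists_mono[of B I] lists_mono[of "A \<union> B" I] by auto
  have 1: "R (x # w) = R (x # a @ b)" using cong_left[of "[x]" w "a @ b"] ab I by simp
  show ?case
  proof (cases "x \<in> A")
    case True
    then show ?thesis using 1 ab by (intro bexI[of _ "x # a"] bexI[of _ b]) auto
  next
    case False
    then have "x \<in> B" using Cons.hyps by auto
    then have "R (x # a) = R (a @ [x])"
      using move_letter[of x a A] assms I ab by metis
    then have "R (x # a @ b) = R (a @ x # b)" using cong_right[of "x # a" "a @ [x]" b] I by simp
    then show ?thesis using 1 ab \<open>x \<in> B\<close> by (intro bexI[of _ "a"] bexI[of _ "x # b"]) auto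
  qed
qed

lemma card_commuting:
  assumes AB: "A \<subseteq> I" "B \<subseteq> I" "\<And>x y. x \<in> A \<Longrightarrow> y \<in> B \<Longrightarrow> R [x, y] = R [y, x]"
    and triv: "\<And>a b. a \<in> lists A \<Longrightarrow> b \<in> lists B \<Longrightarrow> R a = R b \<Longrightarrow> R a = R []"
  shows "card (R ` lists (A \<union> B)) = card (R ` lists A) * card (R ` lists B)"
proof -
  have sub: "lists A \<subseteq> lists I" "lists B \<subseteq> lists I" using AB(1,2) by (blast dest: lists_mono)+
  have "R ` lists (A \<union> B) = (\<lambda>(a, b). R (a @ b)) ` (lists A \<times> lists B)"
  proof (intro equalityI subsetI)
    fix y assume "y \<in> R ` lists (A \<union> B)"
    then obtain w where w: "w \<in> lists (A \<union> B)" "y = R w" by blast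
    have "\<exists>a\<in>lists A. \<exists>b\<in>lists B. R w = R (a @ b)"
      by (intro split_commuting AB w)
    then obtain a b where "a \<in> lists A" "b \<in> lists B" "y = R (a @ b)" using w by auto
    then show "y \<in> (\<lambda>(a, b). R (a @ b)) ` (lists A \<times> lists B)"
      by (intro image_eqI[of _ _ "(a, b)"]) auto
  next
    fix y assume "y \<in> (\<lambda>(a, b). R (a @ b)) ` (lists A \<times> lists B)"
    then obtain a b where "a \<in> lists A" "b \<in> lists B" "y = R (a @ b)" by auto
    then show "y \<in> R ` lists (A \<union> B)"
      using lists_mono[of A "A \<union> B"] lists_mono[of B "A \<union> B"]
      by (intro image_eqI[of _ _ "a @ b"]) auto
  qed
  also have "card \<dots> = card ((\<lambda>(a, b). (R a, R b)) ` (lists A \<times> lists B))"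
  proof (rule card_image_cong_kernel, clarify)
    fix a b a' b' assume w: "a \<in> lists A" "b \<in> lists B" "a' \<in> lists A" "b' \<in> lists B"
    then have I: "a \<in> lists I" "b \<in> lists I" "a' \<in> lists I" "b' \<in> lists I" using sub by blast+
    have "R a = R a' \<and> R b = R b'" if eq: "R (a @ b) = R (a' @ b')"
    proof -
      have "R (rev a' @ (a @ b) @ rev b) = R (rev a' @ (a' @ b') @ rev b)"
        using I eq by (intro cong[of "rev a'" "a @ b" "a' @ b'" "rev b"]) simp_all
      moreover have "R (rev a' @ (a @ b) @ rev b) = R (rev a' @ a)"
        using drop_trivial[of "rev a' @ a" "b @ rev b" "[]"] rev_right[of b] I by simp
      moreover have "R (rev a' @ (a' @ b') @ rev b) = R (b' @ rev b)"
        using drop_trivial[of "[]" "rev a' @ a'" "b' @ rev b"] rev_left[of a'] I by simp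
      ultimately have *: "R (rev a' @ a) = R (b' @ rev b)" by simp
      then have "R (rev a' @ a) = R []" using w triv[of "rev a' @ a" "b' @ rev b"] by simp
      then have 1: "R a = R a'"
        using cancel_left[of "rev a'" a a'] rev_left[of a'] I by simp
      then have "R b = R b'"
        using cong_right[of a a' b] cancel_left[of a' b b'] eq I by simp
      with 1 show ?thesis by simp
    qed
    moreover have "R (a @ b) = R (a' @ b')" if "R a = R a'" "R b = R b'"
    proof -
      have "R (a @ b) = R (a @ b')" using cong_left[of a b b'] I that by blast
      also have "\<dots> = R (a' @ b')" using cong_right[of a a' b'] I that by blast
      finally show ?thesis .
    qed
    ultimately show "(R (a @ b) = R (a' @ b')) = ((R a, R b) = (R a', R b'))"
      unfolding prod.inject by (rule iffI) metis+
  qed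
  also have "(\<lambda>(a, b). (R a, R b)) ` (lists A \<times> lists B) = R ` lists A \<times> R ` lists B"
  proof -
    have "(\<lambda>(a, b). (R a, R b)) = map_prod R R" by (simp add: fun_eq_iff)
    then show ?thesis using map_prod_surj_on[of R "lists A" _ R "lists B", OF refl refl] by simp
  qed
  finally show ?thesis by (simp add: card_cartesian_product)
qed

end

lemma word_map_pair:
  assumes f: "word_map I f" and g: "word_map I g" shows "word_map I (\<lambda>w. (f w, g w))"
proof
  fix x u v y assume "x \<in> lists I" "u \<in> lists I" "v \<in> lists I" "y \<in> lists I" "(f u, g u) = (f v, g v)"
  then show "(f (x @ u @ y), g (x @ u @ y)) = (f (x @ v @ y), g (x @ v @ y))"
    using word_map.cong[OF f, of x u v y] word_map.cong[OF g, of x u v y] by auto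
next
  fix i assume "i \<in> I"
  then show "(f [i, i], g [i, i]) = (f [], g [])"
    using word_map.invol[OF f, of i] word_map.invol[OF g, of i] by simp
qed

text \<open>Over a fixed value \<open>f u\<close>, the possible second components are \<open>g (u @ v)\<close> with \<open>f v\<close> trivial.
  Such \<open>v\<close> are even, and by hypothesis the values \<open>g v\<close> are those of all even words, so
  every fibre of the first projection has the same size.\<close>

lemma card_pair_words:
  assumes f: "word_map I f" and g: "word_map I g"
    and par: "\<And>w. w \<in> lists I \<Longrightarrow> f w = f [] \<Longrightarrow> even (length w)"
    and full: "\<And>w. w \<in> even_words I \<Longrightarrow> \<exists>v\<in>lists I. f v = f [] \<and> g v = g w"
    and fin: "finite (f ` lists I)" "finite (g ` lists I)"
  shows "card ((\<lambda>w. (f w, g w)) ` lists I) = card (f ` lists I) * card (g ` even_words I)"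
proof -
  interpret f: word_map I f by (rule f)
  interpret g: word_map I g by (rule g)
  define F where "F a = g ` {w \<in> lists I. f w = a}" for a
  have "(\<lambda>w. (f w, g w)) ` lists I = (SIGMA a : f ` lists I. F a)"
  proof (intro equalityI subsetI)
    fix y assume "y \<in> (SIGMA a : f ` lists I. F a)"
    then obtain a b where "y = (a, b)" "b \<in> F a" by (elim SigmaE)
    then obtain w where "w \<in> lists I" "y = (f w, g w)" by (auto simp: F_def)
    then show "y \<in> (\<lambda>w. (f w, g w)) ` lists I" by (rule image_eqI[rotated])
  next
    fix y assume "y \<in> (\<lambda>w. (f w, g w)) ` lists I"
    then obtain w where w: "w \<in> lists I" "y = (f w, g w)" by (elim imageE)
    then have "g w \<in> F (f w)" unfolding F_def by (intro imageI) simp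
    then show "y \<in> (SIGMA a : f ` lists I. F a)" unfolding w(2) using w(1) by (intro SigmaI imageI)
  qed
  also have "card \<dots> = (\<Sum>a \<in> f ` lists I. card (F a))"
    using fin by (intro card_SigmaI) (auto simp: F_def intro: finite_subset[OF _ fin(2)])
  also have "\<dots> = (\<Sum>a \<in> f ` lists I. card (g ` even_words I))"
  proof (rule sum.cong[OF refl])
    fix a assume "a \<in> f ` lists I"
    then obtain u where u: "u \<in> lists I" "a = f u" by blast
    have "F a = (\<lambda>v. g (u @ v)) ` even_words I"
    proof (intro equalityI subsetI)
      fix y assume "y \<in> F a"
      then obtain w where w: "w \<in> lists I" "f w = f u" "y = g w" using u by (auto simp: F_def)
      have "f (w @ rev u) = f []" using w u f.eq_iff_rev[of w u] by simp
      then have "even (length (rev u @ w))" using par[of "w @ rev u"] w u by simp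
      moreover have "g (u @ rev u @ w) = g w"
        using g.drop_trivial[of "[]" "u @ rev u" w] g.rev_right[of u] u w by simp
      ultimately show "y \<in> (\<lambda>v. g (u @ v)) ` even_words I"
        using u w by (intro image_eqI[of _ _ "rev u @ w"]) (auto simp: even_words_def)
    next
      fix y assume "y \<in> (\<lambda>v. g (u @ v)) ` even_words I"
      then obtain v where v: "v \<in> even_words I" "y = g (u @ v)" by blast
      then obtain v' where v': "v' \<in> lists I" "f v' = f []" "g v' = g v" using full by blast
      have "v \<in> lists I" using v by (simp add: even_words_def)
      have "f (u @ v') = a" using f.cong_left[of u v' "[]"] v' u by simp
      moreover have "g (u @ v') = y" using g.cong_left[of u v' v] v v' u \<open>v \<in> lists I\<close> by simp
      ultimately show "y \<in> F a" using u v' unfolding F_def by (intro image_eqI[of _ _ "u @ v'"]) auto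
    qed
    then have "card (F a) = card ((\<lambda>v. g (u @ v)) ` even_words I)" by simp
    also have "\<dots> = card (g ` even_words I)"
      by (rule card_image_cong_kernel) (use u in \<open>simp add: even_words_def g.cancel_left\<close>)
    finally show "card (F a) = card (g ` even_words I)" .
  qed
  finally show ?thesis by simp
qed

text \<open>The letters \<open>d 0, d 1, \<dots>\<close> run through a diagram whose first edge is labelled \<open>3\<close> for \<open>f\<close> and
  \<open>4\<close> for \<open>g\<close>, all later edges being labelled \<open>3\<close> for \<open>g\<close>. Then every rotation of \<open>g\<close> is the second
  component of a word that is trivial for \<open>f\<close>. For the first edge this is a ninth power. The set \<open>N\<close>
  of words with this property is closed under products and conjugation, and if
  \<open>ab\<close> lies in it then so does \<open>(ab)\<^sup>-\<^sup>1 c (ab) c\<close>; when \<open>c\<close> commutes with \<open>a\<close> this is \<open>(bc)\<^sup>2\<close>, the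
  inverse of \<open>bc\<close>.\<close>

lemma even_words_in_kernel:
  fixes d :: "nat \<Rightarrow> nat"
  assumes f: "word_map I f" and g: "word_map I g" and I: "I = d ` {..<k}"
    and f3: "Suc 0 < k \<Longrightarrow> f [d 0, d 1, d 0, d 1, d 0, d 1] = f []"
    and g4: "Suc 0 < k \<Longrightarrow> g [d 0, d 1, d 0, d 1, d 0, d 1, d 0, d 1] = g []"
    and g3: "\<And>i. \<lbrakk>0 < i; Suc i < k\<rbrakk> \<Longrightarrow> g [d i, d (Suc i), d i, d (Suc i), d i, d (Suc i)] = g []"
    and g2: "\<And>i. Suc (Suc i) < k \<Longrightarrow> g [d i, d (Suc (Suc i))] = g [d (Suc (Suc i)), d i]"
    and w: "w \<in> even_words I"
  shows "\<exists>v\<in>lists I. f v = f [] \<and> g v = g w"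
proof -
  interpret f: word_map I f by (rule f)
  interpret g: word_map I g by (rule g)
  define N where "N = {w \<in> lists I. \<exists>v\<in>lists I. f v = f [] \<and> g v = g w}"
  have Nil: "[] \<in> N" by (auto simp: N_def)
  have N_cong: "v \<in> N" if "w \<in> N" "v \<in> lists I" "g w = g v" for w v
    using that by (auto simp: N_def)
  have N_app: "u @ v \<in> N" if uv: "u \<in> N" "v \<in> N" for u v
  proof -
    obtain u' v' where "u' \<in> lists I" "v' \<in> lists I" "f u' = f []" "f v' = f []" "g u' = g u" "g v' = g v"
      using uv by (auto simp: N_def)
    moreover have "u \<in> lists I" "v \<in> lists I" using uv by (auto simp: N_def)
    moreover have "f (u' @ v') = f []"
      using f.cong_left[of u' v' "[]"] calculation by simp
    moreover have "g (u' @ v') = g (u @ v)"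
      using g.cong_left[of u' v' v] g.cong_right[of u' u v] calculation by simp
    ultimately show ?thesis unfolding N_def by (auto intro!: bexI[of _ "u' @ v'"])
  qed
  have N_conj: "x @ u @ rev x \<in> N" if u: "u \<in> N" and x: "x \<in> lists I" for u x
  proof -
    obtain u' where "u' \<in> lists I" "f u' = f []" "g u' = g u"
      using u by (auto simp: N_def)
    moreover have "u \<in> lists I" using u by (auto simp: N_def)
    moreover have "f (x @ u' @ rev x) = f []"
      using f.drop_trivial[of x u' "rev x"] f.rev_right[of x] x calculation by simp
    moreover have "g (x @ u' @ rev x) = g (x @ u @ rev x)"
      using x calculation g.cong[of x u' u "rev x"] by simp
    ultimately show ?thesis unfolding N_def using x by (auto intro!: bexI[of _ "x @ u' @ rev x"])
  qed
  have N_rev: "rev u \<in> N" if u: "u \<in> N" for u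
  proof -
    obtain u' where u': "u' \<in> lists I" "f u' = f []" "g u' = g u"
      using u by (auto simp: N_def)
    moreover have "u \<in> lists I" using u by (auto simp: N_def)
    ultimately show ?thesis unfolding N_def using f.rev_cong[of u' "[]"] g.rev_cong[of u' u]
      by (auto intro!: bexI[of _ "rev u'"])
  qed
  have dI: "d i \<in> I" if "i < k" for i using that I by auto
  have N_step: "[d i, d (Suc i)] \<in> N" if "Suc i < k" for i
    using that
  proof (induction i)
    case 0
    let ?a = "d 0" and ?b = "d 1"
    let ?P = "[?a, ?b, ?a, ?b, ?a, ?b]" and ?Q = "[?a, ?b, ?a, ?b, ?a, ?b, ?a, ?b]"
    have ab: "?a \<in> I" "?b \<in> I" using dI 0 by auto
    have "f (?P @ ?P @ ?P) = f []"
      using f.drop_trivial[of ?P ?P ?P] f.cong_left[of ?P ?P "[]"] f3 0 ab by simp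
    \<comment> \<open>the ninth power of \<open>ab\<close> is trivial under \<open>f\<close> and has the value of \<open>ab\<close> under \<open>g\<close>\<close>
    moreover have "g (?P @ ?P @ ?P) = g [?a, ?b]"
      using g.drop_trivial[of "[]" ?Q "?Q @ [?a, ?b]"] g.drop_trivial[of "[]" ?Q "[?a, ?b]"] g4 0 ab by simp
    ultimately show ?case using ab unfolding N_def
      by (auto intro!: bexI[of _ "?P @ ?P @ ?P"])
  next
    case (Suc i)
    let ?a = "d i" and ?b = "d (Suc i)" and ?c = "d (Suc (Suc i))"
    have abc: "?a \<in> I" "?b \<in> I" "?c \<in> I" using dI Suc by auto
    have ab: "[?a, ?b] \<in> N" using Suc by simp
    have c2: "g [?c, ?a] = g [?a, ?c]" using g2[OF Suc.prems] by (rule sym)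
    have l: "[?b, ?a] \<in> lists I" "[?c, ?a] \<in> lists I" "[?a, ?c] \<in> lists I" "[?b, ?c] \<in> lists I"
      using abc by simp_all
    have "rev [?a, ?b] @ ([?c] @ [?a, ?b] @ rev [?c]) \<in> N"
      using N_app[OF N_rev[OF ab] N_conj[OF ab, of "[?c]"]] abc by simp
    moreover have "g ([?b, ?a] @ [?c, ?a] @ [?b, ?c]) = g ([?b, ?a] @ [?a, ?c] @ [?b, ?c])"
      by (rule g.cong[OF l c2])
    moreover have "g ([?b] @ [?a, ?a] @ [?c, ?b, ?c]) = g ([?b] @ [?c, ?b, ?c])"
      using g.invol[of ?a] abc by (intro g.drop_trivial) simp_all
    ultimately have "[?b, ?c, ?b, ?c] \<in> N"
      using abc by - (rule N_cong[of "rev [?a, ?b] @ ([?c] @ [?a, ?b] @ rev [?c])"], simp_all)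
    then have "[?c, ?b, ?c, ?b] \<in> N" using N_rev[of "[?b, ?c, ?b, ?c]"] by simp
    moreover have "g [?c, ?b, ?c, ?b] = g [?b, ?c]"
    proof -
      have "g ([?b, ?c, ?b, ?c, ?b, ?c] @ [?c, ?b, ?c, ?b]) = g [?c, ?b, ?c, ?b]"
        using g3[of "Suc i"] Suc abc g.drop_trivial[of "[]" "[?b, ?c, ?b, ?c, ?b, ?c]" "[?c, ?b, ?c, ?b]"] by simp
      moreover have "g ([?b, ?c] @ [?b, ?c, ?b, ?c] @ rev [?b, ?c, ?b, ?c]) = g [?b, ?c]"
        using abc g.rev_right[of "[?b, ?c, ?b, ?c]"] g.cong_left[of "[?b, ?c]" "[?b, ?c, ?b, ?c] @ rev [?b, ?c, ?b, ?c]" "[]"] by simp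
      ultimately show ?thesis by simp
    qed
    ultimately show ?case using abc by - (rule N_cong[of "[?c, ?b, ?c, ?b]"], auto)
  qed
  have N_less: "[d i, d j] \<in> N" if "i \<le> j" "j < k" for i j
    using that
  proof (induction j rule: dec_induct)
    case base
    then show ?case using N_cong[OF Nil, of "[d i, d i]"] dI g.invol[of "d i"] by simp
  next
    case (step j)
    have I: "d i \<in> I" "d j \<in> I" "d (Suc j) \<in> I" using step dI by auto
    have "[d i, d j] @ [d j, d (Suc j)] \<in> N" using N_app[OF step.IH N_step[of j]] step.prems by simp
    moreover have "g ([d i] @ [d j, d j] @ [d (Suc j)]) = g ([d i] @ [d (Suc j)])"
      using I g.invol by (intro g.drop_trivial) auto
    ultimately show ?case using I by - (rule N_cong[of "[d i, d j] @ [d j, d (Suc j)]"], auto)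
  qed
  have N_pair: "[x, y] \<in> N" if xy: "x \<in> I" "y \<in> I" for x y
  proof -
    obtain i j where ij: "x = d i" "i < k" "y = d j" "j < k" using xy unfolding I by blast
    then show ?thesis using N_less[of i j] N_rev[OF N_less[of j i]] by (cases "i \<le> j") auto
  qed
  have "w \<in> N" if "w \<in> even_words I" for w
    using that
  proof (induction w rule: induct_list012)
    case (3 x y zs)
    then show ?case using N_app[of "[x, y]" zs] N_pair by (auto simp: even_words_def)
  qed (auto simp: Nil even_words_def)
  then show ?thesis using w by (auto simp: N_def)
qed

text \<open>The properties of evaluation in the automorphism group of a regular polytope that the
  counting uses. The last one says that the stabilizers of the faces of the base flag intersect
  trivially.\<close>

locale string_words = word_map "{..<n}" R for n :: nat and R :: "nat list \<Rightarrow> 'e" +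
  assumes comm: "Suc i < j \<Longrightarrow> j < n \<Longrightarrow> R [i, j] = R [j, i]"
    and parity: "w \<in> lists {..<n} \<Longrightarrow> R w = R [] \<Longrightarrow> even (length w)"
    and inter: "w \<in> lists {..<n} \<Longrightarrow> (\<And>j. j < n \<Longrightarrow> \<exists>v\<in>lists ({..<n} - {j}). R w = R v) \<Longrightarrow> R w = R []"

text \<open>Everything about a map on words that matters here depends only on which words have the same value.
  This replaces the groups of lattice automorphisms by concrete permutation groups.\<close>

lemma string_words_cong_kernel:
  assumes E: "string_words n E"
    and eq: "\<And>u v. u \<in> lists {..<n} \<Longrightarrow> v \<in> lists {..<n} \<Longrightarrow> R u = R v \<longleftrightarrow> E u = E v"
  shows "string_words n R"
proof -
  interpret E: string_words n E by fact
  have sub: "lists ({..<n} - {j}) \<subseteq> lists {..<n}" for j by (rule lists_mono) auto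
  show ?thesis
  proof unfold_locales
    fix x u v y assume "x \<in> lists {..<n}" "u \<in> lists {..<n}" "v \<in> lists {..<n}" "y \<in> lists {..<n}" "R u = R v"
    then show "R (x @ u @ y) = R (x @ v @ y)" using E.cong[of x u v y] by (simp add: eq)
  next
    fix w assume "w \<in> lists {..<n}" "\<And>j. j < n \<Longrightarrow> \<exists>v\<in>lists ({..<n} - {j}). R w = R v"
    then show "R w = R []" using E.inter[of w] eq sub by (metis (no_types, opaque_lifting) lists.Nil subsetD)
  qed (use eq E.invol E.comm E.parity in auto)
qed

lemma string_words_pair:
  assumes f: "string_words n f" and g: "string_words n g"
  shows "string_words n (\<lambda>w. (f w, g w))"
proof -
  interpret f: string_words n f by fact
  interpret g: string_words n g by fact
  interpret fg: word_map "{..<n}" "\<lambda>w. (f w, g w)"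
    using word_map_pair f.word_map_axioms g.word_map_axioms by blast
  show ?thesis
  proof unfold_locales
    fix w assume "w \<in> lists {..<n}" "\<And>j. j < n \<Longrightarrow> \<exists>v\<in>lists ({..<n} - {j}). (f w, g w) = (f v, g v)"
    then show "(f w, g w) = (f [], g [])" using f.inter[of w] g.inter[of w] by (metis prod.inject)
  qed (use f.comm g.comm f.parity in auto)
qed

text \<open>A common value of a lower and an upper word avoids every letter: the lower word avoids
  the letters from \<open>k\<close> on, the upper one the letters up to \<open>k\<close>.\<close>

lemma (in string_words) card_omit_letter:
  assumes k: "k < n"
  shows "card (R ` lists ({..<n} - {k})) = card (R ` lists {..<k}) * card (R ` lists {k<..<n})"
proof -
  have U: "{..<n} - {k} = {..<k} \<union> {k<..<n}" using k by auto
  show ?thesis unfolding U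
  proof (rule card_commuting)
    fix a b assume ab: "a \<in> lists {..<k}" "b \<in> lists {k<..<n}" "R a = R b"
    have "\<exists>v\<in>lists ({..<n} - {j}). R a = R v" if "j < n" for j
    proof (cases "k \<le> j")
      case True
      have "{..<k} \<subseteq> {..<n} - {j}" using True k by auto
      then show ?thesis using ab lists_mono by blast
    next
      case False
      have "{k<..<n} \<subseteq> {..<n} - {j}" using False k by auto
      then show ?thesis using ab lists_mono by blast
    qed
    moreover have "a \<in> lists {..<n}" using ab(1) k lists_mono[of "{..<k}" "{..<n}"] by auto
    ultimately show "R a = R []" using inter by blast
  qed (use k in \<open>auto intro: comm\<close>)
qed

section \<open>Symmetric and hyperoctahedral groups as images of words\<close>

definition act :: "(nat \<Rightarrow> 'x \<Rightarrow> 'x) \<Rightarrow> nat list \<Rightarrow> 'x \<Rightarrow> 'x" where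
  "act s w = foldr (\<lambda>i f. s i \<circ> f) w id"

lemma act_Nil [simp]: "act s [] = id"
  and act_Cons [simp]: "act s (i # w) = s i \<circ> act s w"
  by (simp_all add: act_def)

lemma act_append [simp]: "act s (u @ v) = act s u \<circ> act s v"
  by (induction u) (auto simp: fun_eq_iff)

lemma act_map: "act s (map h w) = act (\<lambda>i. s (h i)) w"
  by (induction w) auto

lemma act_cong: "(\<And>i. i \<in> I \<Longrightarrow> s i = t i) \<Longrightarrow> w \<in> lists I \<Longrightarrow> act s w = act t w"
  by (induction w) auto

lemma word_map_act:
  assumes "\<And>i. i \<in> I \<Longrightarrow> s i \<circ> s i = id" shows "word_map I (act s)"
proof
  fix i assume "i \<in> I"
  then show "act s [i, i] = act s []" using assms by simp
qed simp

lemma act_preserves: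
  assumes "\<And>i x. i \<in> I \<Longrightarrow> P (s i x) \<longleftrightarrow> P x" and "w \<in> lists I"
  shows "P (act s w x) \<longleftrightarrow> P x"
  using assms(2) by (induction w) (simp_all add: assms(1))

lemma act_fixes:
  assumes "\<And>i. i \<in> I \<Longrightarrow> s i x = x" and "w \<in> lists I"
  shows "act s w x = x"
  using assms(2) by (induction w) (simp_all add: assms(1))

lemma permutation_act: "(\<And>i. i \<in> I \<Longrightarrow> permutation (s i)) \<Longrightarrow> w \<in> lists I \<Longrightarrow> permutation (act s w)"
  by (induction w) (auto intro: permutation_compose permutation_id)

lemma sign_act:
  assumes "\<And>i. i \<in> I \<Longrightarrow> permutation (s i)" and w: "w \<in> lists I"
  shows "sign (act s w) = prod_list (map (\<lambda>i. sign (s i)) w)"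
  using w
proof (induction w)
  case (Cons i w)
  have "sign (s i \<circ> act s w) = sign (s i) * sign (act s w)"
    using Cons.hyps assms(1) permutation_act[of I s w] by (intro sign_compose) auto
  then show ?case using Cons by (simp only: act_Cons list.map prod_list.Cons)
qed (simp add: sign_id)

definition agen :: "nat \<Rightarrow> nat \<Rightarrow> nat" where
  "agen i = Transposition.transpose i (Suc i)"

text \<open>The generators of the hyperoctahedral group, acting on pairs of a coordinate and a sign: the sign
  change of coordinate \<open>0\<close> and the exchanges of coordinates \<open>l\<close> and \<open>l + 1\<close>. They do not depend on the number of
  coordinates.\<close>

definition bgen :: "nat \<Rightarrow> nat \<times> bool \<Rightarrow> nat \<times> bool" where
  "bgen i = (case i of 0 \<Rightarrow> Transposition.transpose (0, True) (0, False)
     | Suc l \<Rightarrow> map_prod (agen l) id)"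

lemma bgen_0: "bgen 0 (x, b) = (x, if x = 0 then \<not> b else b)"
  by (auto simp: bgen_def Transposition.transpose_def)

lemma bgen_Suc: "bgen (Suc i) (x, b) = (agen i x, b)"
  by (simp add: bgen_def)

lemma bgen_Suc_transpose:
  "bgen (Suc i) = Transposition.transpose (i, True) (Suc i, True) \<circ> Transposition.transpose (i, False) (Suc i, False)"
  by (auto simp: bgen_def agen_def Transposition.transpose_def fun_eq_iff)

lemma agen_invol: "agen i \<circ> agen i = id"
  by (simp add: agen_def)

lemma bgen_invol: "bgen i \<circ> bgen i = id"
  using agen_invol by (cases i) (auto simp: fun_eq_iff bgen_0 bgen_Suc)

lemma agen_comm: "Suc i < j \<Longrightarrow> agen i \<circ> agen j = agen j \<circ> agen i"
  by (auto simp: agen_def Transposition.transpose_def fun_eq_iff)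

lemma agen_braid: "act agen [i, Suc i, i, Suc i, i, Suc i] = id"
  by (auto simp: agen_def Transposition.transpose_def fun_eq_iff)

lemma bgen_comm:
  assumes "Suc i < j" shows "bgen i \<circ> bgen j = bgen j \<circ> bgen i"
proof -
  obtain l where j: "j = Suc l" using assms by (cases j) auto
  show ?thesis
  proof (cases i)
    case 0
    with assms j have "l \<noteq> 0" by simp
    then show ?thesis unfolding 0 j by (auto simp: fun_eq_iff bgen_0 bgen_Suc agen_def Transposition.transpose_def)
  next
    case (Suc m)
    then show ?thesis using agen_comm[of m l] assms unfolding j
      by (auto simp: fun_eq_iff bgen_Suc)
  qed
qed

lemma bgen_braid: "0 < i \<Longrightarrow> act bgen [i, Suc i, i, Suc i, i, Suc i] = id"
  using agen_braid[of "i - 1"] by (cases i) (auto simp: fun_eq_iff bgen_Suc)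

lemma bgen_braid4: "act bgen [0, 1, 0, 1, 0, 1, 0, 1] = id"
  by (auto simp: fun_eq_iff bgen_Suc[of 0, simplified] bgen_0 agen_def Transposition.transpose_def)

lemma word_map_agen: "word_map I (act agen)" and word_map_bgen: "word_map I (act bgen)"
  by (intro word_map_act agen_invol bgen_invol)+

lemma act_agen_parity:
  assumes "act agen w = id" shows "even (length w)"
proof -
  have "sign (act agen w) = prod_list (map (\<lambda>i. sign (agen i)) w)"
    by (rule sign_act[of UNIV]) (auto simp: agen_def permutation_swap_id lists_UNIV)
  also have "map (\<lambda>i. sign (agen i)) w = replicate (length w) (- 1)"
    by (induction w) (auto simp: agen_def sign_swap_id)
  finally have "(- 1 :: int) ^ length w = 1" using assms by (simp add: sign_id)
  then show ?thesis by (metis minus_one_power_iff one_neq_neg_one)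
qed

text \<open>Neither the sign on signed points nor the sign on coordinates is \<open>-1\<close> on all generators, but their product is:
  a sign change is a single transposition of signed points, an exchange is a pair of them.\<close>

lemma act_bgen_parity:
  assumes "act bgen w = id" shows "even (length w)"
proof -
  define t where "t i = (case i of 0 \<Rightarrow> id | Suc l \<Rightarrow> agen l)" for i
  \<comment> \<open>forgetting signs, the flip becomes trivial; the other generators are even on signed points\<close>
  have fst_act: "fst (act bgen w p) = act t w (fst p)" for p
  proof (induction w)
    case (Cons i w)
    then show ?case by (cases i; cases "act bgen w p") (auto simp: bgen_0 bgen_Suc t_def)
  qed simp
  have "act t w x = x" for x using fst_act[of "(x, True)"] assms by simp
  then have "act t w = id" by (simp add: fun_eq_iff)
  moreover have "sign (act t w) = prod_list (map (\<lambda>i. sign (t i)) w)"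
    by (rule sign_act[of UNIV])
      (auto simp: t_def agen_def permutation_swap_id lists_UNIV permutation_id split: nat.splits)
  moreover have "sign (act bgen w) = prod_list (map (\<lambda>i. sign (bgen i)) w)"
  proof (rule sign_act[of UNIV])
    show "permutation (bgen i)" for i
      by (cases i) (auto simp: bgen_Suc_transpose bgen_def[of 0] intro: permutation_compose permutation_swap_id)
  qed (simp add: lists_UNIV)
  moreover have "sign (t i) * sign (bgen i) = - 1" for i
    by (cases i) (auto simp: t_def agen_def sign_swap_id bgen_def[of 0] bgen_Suc_transpose sign_compose
        permutation_swap_id)
  then have "prod_list (map (\<lambda>i. sign (t i)) w) * prod_list (map (\<lambda>i. sign (bgen i)) w) = (- 1) ^ length w"
    by (induction w) (auto simp: algebra_simps, metis mult.assoc mult.left_commute mult_minus_right mult.right_neutral)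
  ultimately have "(- 1 :: int) ^ length w = 1" using assms by (simp add: sign_id)
  then show ?thesis by (metis minus_one_power_iff one_neq_neg_one)
qed

text \<open>Words without the letter \<open>j\<close> preserve the initial segment \<open>{..j}\<close>; a permutation that preserves all
  initial segments is trivial.\<close>

lemma string_words_agen: "string_words n (act agen)"
proof -
  interpret word_map "{..<n}" "act agen" by (rule word_map_agen)
  show ?thesis
  proof
    fix w assume w: "w \<in> lists {..<n}"
      and ex: "\<And>j. j < n \<Longrightarrow> \<exists>v\<in>lists ({..<n} - {j}). act agen w = act agen v"
    have le: "act agen w x \<le> j \<longleftrightarrow> x \<le> j" if j: "j < n" for x j
    proof -
      obtain v where "v \<in> lists ({..<n} - {j})" "act agen w = act agen v" using ex[OF j] by blast
      moreover have "agen i y \<le> j \<longleftrightarrow> y \<le> j" if "i \<noteq> j" for i y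
        using that by (auto simp: agen_def Transposition.transpose_def)
      ultimately show ?thesis using act_preserves[of "{..<n} - {j}" "\<lambda>x. x \<le> j" agen v x] by simp
    qed
    have le_n: "act agen w x \<le> n \<longleftrightarrow> x \<le> n" for x
      using act_preserves[of "{..<n}" "\<lambda>x. x \<le> n" agen w x] w by (auto simp: agen_def Transposition.transpose_def)
    have "act agen w x = x" for x
    proof (cases "x \<le> n")
      case True
      have "act agen w x \<le> x" using le[of x x] le_n[of x] True by (cases "x = n") auto
      moreover have "\<not> act agen w x \<le> x - 1" if "x \<noteq> 0" using le[of "x - 1" x] True that by auto
      ultimately show ?thesis by (cases "x = 0") auto
    next
      case False
      then show ?thesis using act_fixes[of "{..<n}" agen x w] w by (auto simp: agen_def Transposition.transpose_def)
    qed
    then show "act agen w = act agen []" by auto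
  qed (use agen_comm act_agen_parity in \<open>auto simp: comp_assoc\<close>)
qed

lemma act_bgen_neg: "act bgen w (x, \<not> b) = map_prod id Not (act bgen w (x, b))"
proof (induction w)
  case (Cons i w)
  then show ?case by (cases i; cases "act bgen w (x, b)") (auto simp: bgen_0 bgen_Suc)
qed simp

text \<open>Words without the letter \<open>j\<close> preserve the set of positive points with coordinate at least \<open>j\<close>.\<close>

lemma string_words_bgen: "string_words n (act bgen)"
proof -
  interpret word_map "{..<n}" "act bgen" by (rule word_map_bgen)
  show ?thesis
  proof
    fix w assume w: "w \<in> lists {..<n}"
      and ex: "\<And>j. j < n \<Longrightarrow> \<exists>v\<in>lists ({..<n} - {j}). act bgen w = act bgen v"
    have ge: "j \<le> fst (act bgen w p) \<and> snd (act bgen w p) \<longleftrightarrow> j \<le> fst p \<and> snd p" if j: "j < n" for p j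
    proof -
      obtain v where v: "v \<in> lists ({..<n} - {j})" "act bgen w = act bgen v" using ex[OF j] by blast
      have "j \<le> fst (bgen i q) \<and> snd (bgen i q) \<longleftrightarrow> j \<le> fst q \<and> snd q" if "i \<noteq> j" for i q
        using that by (cases i; cases q) (auto simp: bgen_0 bgen_Suc agen_def Transposition.transpose_def)
      then show ?thesis unfolding v(2) by (intro act_preserves[OF _ v(1)]) auto
    qed
    have less_n: "fst (act bgen w p) < n \<longleftrightarrow> fst p < n" for p
    proof (intro act_preserves[OF _ w])
      fix i q assume "i \<in> {..<n}"
      then show "fst (bgen i q) < n \<longleftrightarrow> fst q < n"
        by (cases i; cases q) (auto simp: bgen_0 bgen_Suc agen_def Transposition.transpose_def)
    qed
    have T: "act bgen w (x, True) = (x, True)" for x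
    proof (cases "x < n")
      case True
      obtain y b where y: "act bgen w (x, True) = (y, b)" by fastforce
      have "x \<le> y" "b" using ge[of x "(x, True)"] True y by auto
      moreover have "y < n" using less_n[of "(x, True)"] True y by simp
      moreover have "\<not> Suc x \<le> y" if "Suc x < n" using ge[of "Suc x" "(x, True)"] y that \<open>b\<close> by auto
      ultimately show ?thesis using y by (cases "Suc x < n") auto
    next
      case False
      show ?thesis
      proof (rule act_fixes[OF _ w])
        fix i assume "i \<in> {..<n}"
        then show "bgen i (x, True) = (x, True)"
          using False by (cases i) (auto simp: bgen_0 bgen_Suc agen_def Transposition.transpose_def)
      qed
    qed
    have "act bgen w (x, b) = (x, b)" for x b
      using T[of x] act_bgen_neg[of w x True] by (cases b) auto
    then show "act bgen w = act bgen []" by auto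
  qed (use bgen_comm act_bgen_parity in \<open>auto simp: comp_assoc\<close>)
qed

text \<open>Reading a string diagram from the other end, which is what duality of polytopes does.\<close>

definition reflect :: "nat \<Rightarrow> nat list \<Rightarrow> nat list" where
  "reflect n w = map (\<lambda>i. n - Suc i) w"

lemma reflect_Nil [simp]: "reflect n [] = []"
  and reflect_Cons [simp]: "reflect n (i # w) = (n - Suc i) # reflect n w"
  and reflect_append [simp]: "reflect n (u @ v) = reflect n u @ reflect n v"
  and length_reflect [simp]: "length (reflect n w) = length w"
  by (simp_all add: reflect_def)

lemma reflect_lists [simp]: "w \<in> lists {..<n} \<Longrightarrow> reflect n w \<in> lists {..<n}"
  by (induction rule: lists.induct) auto

lemma reflect_reflect [simp]: "w \<in> lists {..<n} \<Longrightarrow> reflect n (reflect n w) = w"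
  by (induction rule: lists.induct) auto

lemma string_words_reflect:
  assumes "string_words n R" shows "string_words n (\<lambda>w. R (reflect n w))"
proof -
  interpret string_words n R by fact
  show ?thesis
  proof
    fix x u v y assume "x \<in> lists {..<n}" "u \<in> lists {..<n}" "v \<in> lists {..<n}" "y \<in> lists {..<n}"
      "R (reflect n u) = R (reflect n v)"
    then show "R (reflect n (x @ u @ y)) = R (reflect n (x @ v @ y))"
      using cong[of "reflect n x" "reflect n u" "reflect n v" "reflect n y"] by simp
  next
    fix i assume "i \<in> {..<n}"
    then show "R (reflect n [i, i]) = R (reflect n [])" using invol[of "n - Suc i"] by simp
  next
    fix i j assume ij: "Suc i < j" "j < n"
    then show "R (reflect n [i, j]) = R (reflect n [j, i])" using comm[of "n - Suc j" "n - Suc i"] by simp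
  next
    fix w assume "w \<in> lists {..<n}" "R (reflect n w) = R (reflect n [])"
    then show "even (length w)" using parity[of "reflect n w"] by simp
  next
    fix w assume w: "w \<in> lists {..<n}"
      and ex: "\<And>j. j < n \<Longrightarrow> \<exists>v\<in>lists ({..<n} - {j}). R (reflect n w) = R (reflect n v)"
    have "\<exists>v\<in>lists ({..<n} - {j}). R (reflect n w) = R v" if j: "j < n" for j
    proof -
      obtain v where v: "v \<in> lists ({..<n} - {n - Suc j})" "R (reflect n w) = R (reflect n v)"
        using ex[of "n - Suc j"] j by auto
      have "reflect n v \<in> lists ({..<n} - {j})" using v(1) j by (induction rule: lists.induct) auto
      then show ?thesis using v by blast
    qed
    then show "R (reflect n w) = R (reflect n [])" using inter[of "reflect n w"] w by simp
  qed
qed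

lemma act_rev_cancel:
  assumes "word_map UNIV (act s)" shows "act s (rev w) (act s w x) = x"
  using fun_cong[OF word_map.rev_left[OF assms, of w], of x] by (simp add: lists_UNIV)

lemma agen_path: "j \<le> k \<Longrightarrow> act agen [j..<k] k = j"
proof (induction j rule: inc_induct)
  case (step j)
  then show ?case by (simp add: upt_conv_Cons agen_def)
qed simp

lemma act_agen_permutes: "w \<in> lists {..<k} \<Longrightarrow> act agen w permutes {..k}"
proof (induction w rule: lists.induct)
  case Nil then show ?case unfolding act_Nil by (rule permutes_id)
next
  case (Cons i w)
  then have "agen i permutes {..k}" unfolding agen_def by (intro permutes_swap_id) auto
  then show ?case unfolding act_Cons using Cons by (intro permutes_compose)
qed

lemma act_agen_lists: "act agen ` lists {..<k} = {p. p permutes {..k}}"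
proof (intro equalityI subsetI)
  fix p assume "p \<in> act agen ` lists {..<k}"
  then obtain w where "w \<in> lists {..<k}" "p = act agen w" by blast
  then show "p \<in> {p. p permutes {..k}}" using act_agen_permutes by simp
next
  fix p :: "nat \<Rightarrow> nat" assume "p \<in> {p. p permutes {..k}}"
  then have "p permutes {..k}" by simp
  then show "p \<in> act agen ` lists {..<k}"
  proof (induction k arbitrary: p)
    case 0
    then have "p = id" using permutes_sing[of p 0] by (simp add: atMost_0)
    then show ?case by (intro image_eqI[of _ _ "[]"]) auto
  next
    case (Suc k)
    define u where "u = [p (Suc k)..<Suc k]"
    have le: "p (Suc k) \<le> Suc k" using permutes_in_image[OF Suc.prems, of "Suc k"] by simp
    have u: "u \<in> lists {..<Suc k}" unfolding u_def by (auto simp: in_lists_conv_set)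
    have inv: "act agen (rev u) (act agen u x) = x" for x by (rule act_rev_cancel[OF word_map_agen])
    have "act agen (rev u) \<circ> p permutes {..k}"
    proof (rule permutes_superset)
      have "act agen (rev u) permutes {..Suc k}" by (rule act_agen_permutes) (simp add: u)
      then show "act agen (rev u) \<circ> p permutes {..Suc k}" using Suc.prems by (intro permutes_compose)
      fix x assume "x \<in> {..Suc k} - {..k}"
      then have "x = Suc k" by auto
      then show "(act agen (rev u) \<circ> p) x = x"
        using inv[of "Suc k"] agen_path[OF le] by (simp add: u_def)
    qed
    from Suc.IH[OF this] obtain w where w: "w \<in> lists {..<k}" "act agen (rev u) \<circ> p = act agen w" by blast
    have "act agen u (act agen (rev u) y) = y" for y
      using act_rev_cancel[OF word_map_agen, of "rev u" y] by simp
    then have "p = act agen (u @ w)" unfolding act_append w(2)[symmetric] by (auto simp: fun_eq_iff)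
    moreover have "u @ w \<in> lists {..<Suc k}" using u w lists_mono[of "{..<k}" "{..<Suc k}"] by auto
    ultimately show ?case by blast
  qed
qed

lemma card_act_agen: "card (act agen ` lists {..<k}) = fact (Suc k)"
  unfolding act_agen_lists using card_permutations[of "{..k}" "Suc k"] by simp

definition signed_perms :: "nat \<Rightarrow> (nat \<times> bool \<Rightarrow> nat \<times> bool) set" where
  "signed_perms k = {f. (\<forall>x b. fst (f (x, b)) < k \<longleftrightarrow> x < k) \<and> (\<forall>x b. k \<le> x \<longrightarrow> f (x, b) = (x, b)) \<and>
     (\<forall>x b. f (x, \<not> b) = map_prod id Not (f (x, b))) \<and> inj f}"

lemma signed_perms_comp: "f \<in> signed_perms k \<Longrightarrow> g \<in> signed_perms k \<Longrightarrow> f \<circ> g \<in> signed_perms k"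
proof -
  assume f: "f \<in> signed_perms k" and g: "g \<in> signed_perms k"
  have "fst (f p) < k \<longleftrightarrow> fst p < k" for p using f by (cases p) (auto simp: signed_perms_def)
  moreover have "f (map_prod id Not p) = map_prod id Not (f p)" for p
    using f by (cases p) (auto simp: signed_perms_def)
  ultimately show ?thesis using f g by (auto simp: signed_perms_def intro: inj_compose)
qed

lemma act_bgen_signed_perms: "w \<in> lists {..<k} \<Longrightarrow> act bgen w \<in> signed_perms k"
proof (induction w rule: lists.induct)
  case Nil
  then show ?case by (auto simp: signed_perms_def)
next
  case (Cons i w)
  have "inj (bgen i)" using bgen_invol[of i] by (metis inj_on_id inj_on_imageI2)
  then have "bgen i \<in> signed_perms k" using Cons.hyps
    by (cases i) (auto simp: signed_perms_def bgen_0 bgen_Suc agen_def Transposition.transpose_def)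
  then show ?case using Cons unfolding act_Cons by (intro signed_perms_comp)
qed

lemma bgen_path: "j \<le> k \<Longrightarrow> act bgen [Suc j..<Suc k] (k, b) = (j, b)"
proof (induction j rule: inc_induct)
  case (step j)
  then show ?case by (simp add: upt_conv_Cons bgen_Suc agen_def del: upt_Suc)
qed simp

lemma bgen_reach:
  assumes "j \<le> k" shows "\<exists>w\<in>lists {..<Suc k}. act bgen w (k, True) = (j, b)"
proof (cases b)
  case True
  then show ?thesis using bgen_path[OF assms]
    by (intro bexI[of _ "[Suc j..<Suc k]"]) (auto simp: in_lists_conv_set)
next
  case False
  have "act bgen (rev [Suc 0..<Suc j]) (0, False) = (j, False)"
    using act_rev_cancel[OF word_map_bgen, of "[Suc 0..<Suc j]" "(j, False)"] bgen_path[of 0 j False] by simp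
  then have "act bgen (rev [Suc 0..<Suc j] @ [0] @ [Suc 0..<Suc k]) (k, True) = (j, False)"
    using bgen_path[of 0 k True] by (simp add: bgen_0 del: upt_Suc)
  moreover have "rev [Suc 0..<Suc j] @ [0] @ [Suc 0..<Suc k] \<in> lists {..<Suc k}"
    using assms by (auto simp: in_lists_conv_set)
  moreover have "b = False" using False by simp
  ultimately show ?thesis by (simp only:) (rule bexI)
qed

lemma signed_perms_0: "signed_perms 0 = {id}"
  by (auto simp: signed_perms_def fun_eq_iff)

lemma signed_perms_restrict:
  assumes f: "f \<in> signed_perms (Suc k)" "f (k, True) = (k, True)"
  shows "f \<in> signed_perms k"
proof -
  have neg: "f (x, \<not> b) = map_prod id Not (f (x, b))" for x b using f by (auto simp: signed_perms_def)
  have fk: "f (k, b) = (k, b)" for b using f(2) neg[of k True] by (cases b) auto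
  have "fst (f (x, b)) = k \<longleftrightarrow> x = k" for x b
  proof
    assume "fst (f (x, b)) = k"
    then obtain c where "f (x, b) = f (k, c)" using fk by (metis prod.collapse)
    then show "x = k" using f(1) by (auto simp: signed_perms_def dest: injD)
  qed (simp add: fk)
  moreover have "fst (f (x, b)) < Suc k \<longleftrightarrow> x < Suc k" for x b using f by (auto simp: signed_perms_def)
  ultimately have "fst (f (x, b)) < k \<longleftrightarrow> x < k" for x b by (metis less_Suc_eq nat_neq_iff)
  moreover have "f (x, b) = (x, b)" if "k \<le> x" for x b
    using f fk that by (cases "x = k") (auto simp: signed_perms_def)
  ultimately show ?thesis using f neg by (auto simp: signed_perms_def)
qed

lemma signed_perms_step:
  assumes f: "f \<in> signed_perms (Suc k)"
  shows "\<exists>j\<le>k. \<exists>b. f (k, True) = (j, b)"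
    and "w \<in> lists {..<Suc k} \<Longrightarrow> act bgen w (k, True) = f (k, True) \<Longrightarrow> act bgen (rev w) \<circ> f \<in> signed_perms k"
proof -
  have "fst (f (k, True)) < Suc k" using f unfolding signed_perms_def by blast
  then show "\<exists>j\<le>k. \<exists>b. f (k, True) = (j, b)" by (cases "f (k, True)") simp
next
  assume w: "w \<in> lists {..<Suc k}" "act bgen w (k, True) = f (k, True)"
  then have "act bgen (rev w) (f (k, True)) = (k, True)"
    using act_rev_cancel[OF word_map_bgen, of w "(k, True)"] by simp
  moreover have "act bgen (rev w) \<circ> f \<in> signed_perms (Suc k)"
    using w f by (intro signed_perms_comp act_bgen_signed_perms) simp_all
  ultimately show "act bgen (rev w) \<circ> f \<in> signed_perms k" by - (rule signed_perms_restrict, simp_all)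
qed

lemma bgen_act_cancel: "act bgen w \<circ> (act bgen (rev w) \<circ> f) = f"
  using act_rev_cancel[OF word_map_bgen, of "rev w"] by (auto simp: fun_eq_iff)

lemma signed_perms_mono: "signed_perms k \<subseteq> signed_perms (Suc k)"
proof
  fix f assume f: "f \<in> signed_perms k"
  have "fst (f (x, b)) < Suc k \<longleftrightarrow> x < Suc k" for x b
  proof (cases "x < k")
    case True
    then have "fst (f (x, b)) < k" using f by (simp add: signed_perms_def)
    then show ?thesis using True by simp
  next
    case False
    then have "f (x, b) = (x, b)" using f by (simp add: signed_perms_def)
    then show ?thesis by simp
  qed
  then show "f \<in> signed_perms (Suc k)" using f by (auto simp: signed_perms_def)
qed

lemma act_bgen_lists: "act bgen ` lists {..<k} = signed_perms k"
proof (intro equalityI subsetI)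
  fix f assume "f \<in> signed_perms k"
  then show "f \<in> act bgen ` lists {..<k}"
  proof (induction k arbitrary: f)
    case 0
    then show ?case by (intro image_eqI[of _ _ "[]"]) (auto simp: signed_perms_0)
  next
    case (Suc k)
    obtain j b where "j \<le> k" "f (k, True) = (j, b)" using signed_perms_step(1)[OF Suc.prems] by blast
    then obtain w where w: "w \<in> lists {..<Suc k}" "act bgen w (k, True) = f (k, True)"
      using bgen_reach[of j k b] by auto
    obtain v where v: "v \<in> lists {..<k}" "act bgen (rev w) \<circ> f = act bgen v"
      using Suc.IH[OF signed_perms_step(2)[OF Suc.prems w]] by blast
    have "f = act bgen (w @ v)" using bgen_act_cancel[of w f] by (simp add: v)
    moreover have "w @ v \<in> lists {..<Suc k}" using w v lists_mono[of "{..<k}" "{..<Suc k}"] by auto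
    ultimately show ?case by blast
  qed
next
  fix f assume "f \<in> act bgen ` lists {..<k}"
  then show "f \<in> signed_perms k" by (elim imageE) (simp only: act_bgen_signed_perms)
qed

text \<open>The point \<open>(k, True)\<close> has an orbit of \<open>2 (k + 1)\<close> points, and its stabilizer is the group for \<open>k\<close>.\<close>

lemma card_signed_perms: "finite (signed_perms k) \<and> card (signed_perms k) = 2 ^ k * fact k"
proof (induction k)
  case 0
  then show ?case by (simp add: signed_perms_0)
next
  case (Suc k)
  obtain r where r: "\<And>j b. j \<le> k \<Longrightarrow> r (j, b) \<in> lists {..<Suc k} \<and> act bgen (r (j, b)) (k, True) = (j, b)"
  proof -
    have "\<exists>w. fst p \<le> k \<longrightarrow> w \<in> lists {..<Suc k} \<and> act bgen w (k, True) = p" for p :: "nat \<times> bool"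
      using bgen_reach[of "fst p" k "snd p"] by auto
    then obtain r where "\<And>p :: nat \<times> bool. fst p \<le> k \<longrightarrow> r p \<in> lists {..<Suc k} \<and> act bgen (r p) (k, True) = p"
      by metis
    then show thesis using that[of r] by simp
  qed
  define h :: "(nat \<times> bool) \<times> (nat \<times> bool \<Rightarrow> nat \<times> bool) \<Rightarrow> nat \<times> bool \<Rightarrow> nat \<times> bool"
    where "h = (\<lambda>(p, g). act bgen (r p) \<circ> g)"
  let ?D = "({..k} \<times> (UNIV :: bool set)) \<times> signed_perms k"
  have "bij_betw h ?D (signed_perms (Suc k))"
  proof (rule bij_betw_imageI)
    show "inj_on h ?D"
    proof (rule inj_onI)
      fix x y assume x: "x \<in> ?D" and y: "y \<in> ?D" and eq: "h x = h y"
      obtain j b g where xe: "x = ((j, b), g)" by (metis prod.collapse)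
      obtain j' b' g' where ye: "y = ((j', b'), g')" by (metis prod.collapse)
      have g: "g (k, True) = (k, True)" "g' (k, True) = (k, True)"
        using x y unfolding xe ye by (auto simp: signed_perms_def)
      have "h x (k, True) = (j, b)" "h y (k, True) = (j', b')"
        using r[of j b] r[of j' b'] x y g unfolding xe ye h_def by auto
      then have e: "j = j'" "b = b'" using eq by auto
      have "act bgen (rev (r (j, b))) (act bgen (r (j, b)) (g z)) = act bgen (rev (r (j, b))) (act bgen (r (j, b)) (g' z))" for z
        using fun_cong[OF eq, of z] unfolding xe ye e h_def by simp
      then have "g z = g' z" for z by (simp add: act_rev_cancel[OF word_map_bgen])
      then show "x = y" unfolding xe ye e by auto
    qed
    show "h ` ?D = signed_perms (Suc k)"
    proof (intro equalityI subsetI)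
      fix f assume "f \<in> h ` ?D"
      then obtain j b g where "j \<le> k" "g \<in> signed_perms k" "f = act bgen (r (j, b)) \<circ> g"
        by (auto simp: h_def)
      then show "f \<in> signed_perms (Suc k)"
        using r[of j b] signed_perms_mono[of k] by (auto intro!: signed_perms_comp act_bgen_signed_perms)
    next
      fix f assume f: "f \<in> signed_perms (Suc k)"
      then obtain j b where jb: "j \<le> k" "f (k, True) = (j, b)" using signed_perms_step(1) by blast
      then have "act bgen (rev (r (j, b))) \<circ> f \<in> signed_perms k"
        using r[of j b] by (intro signed_perms_step(2)[OF f]) auto
      then show "f \<in> h ` ?D" using jb bgen_act_cancel[of "r (j, b)" f]
        by (intro image_eqI[of _ _ "((j, b), act bgen (rev (r (j, b))) \<circ> f)"]) (auto simp: h_def)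
    qed
  qed
  from bij_betw_same_card[OF this] bij_betw_finite[OF this] Suc
  show ?case by (simp add: card_cartesian_product algebra_simps)
qed

lemma card_act_bgen: "card (act bgen ` lists {..<k}) = 2 ^ k * fact k"
  by (simp add: act_bgen_lists card_signed_perms)

text \<open>Reversing the diagram of the symmetric group is conjugation by the order-reversing permutation.\<close>

lemma act_agen_reflect:
  fixes n :: nat and \<kappa> :: "nat \<Rightarrow> nat"
  defines "\<kappa> \<equiv> \<lambda>x. if x \<le> n then n - x else x"
  assumes "w \<in> lists {..<n}"
  shows "act agen (reflect n w) = \<kappa> \<circ> act agen w \<circ> \<kappa>"
proof -
  have kk: "\<kappa> (\<kappa> x) = x" for x by (simp add: \<kappa>_def)
  have gen: "agen (n - Suc i) x = \<kappa> (agen i (\<kappa> x))" if "i < n" for i x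
    using that by (auto simp: agen_def Transposition.transpose_def \<kappa>_def)
  show ?thesis using assms(2)
  proof (induction w rule: lists.induct)
    case Nil
    then show ?case by (simp add: fun_eq_iff kk)
  next
    case (Cons i w)
    then show ?case by (simp add: fun_eq_iff kk gen)
  qed
qed

lemma agen_reflect_cong:
  assumes "u \<in> lists {..<n}" "v \<in> lists {..<n}"
  shows "act agen (reflect n u) = act agen (reflect n v) \<longleftrightarrow> act agen u = act agen v"
proof -
  have *: "act agen (reflect n u) = act agen (reflect n v)"
    if "act agen u = act agen v" "u \<in> lists {..<n}" "v \<in> lists {..<n}" for u v
    using that by (simp add: act_agen_reflect)
  show ?thesis
  proof
    assume "act agen (reflect n u) = act agen (reflect n v)"
    from *[OF this] show "act agen u = act agen v" using assms by simp
  qed (use assms in \<open>intro *\<close>)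
qed

text \<open>Without the sign change, the coordinates are permuted as by adjacent transpositions shifted by one.\<close>

lemma bgen_agen_cong:
  assumes "u \<in> lists {0<..}" "v \<in> lists {0<..}"
  shows "act bgen u = act bgen v \<longleftrightarrow> act agen u = act agen v"
proof -
  define t where "t i = agen (i - 1)" for i
  have t_Suc: "t (Suc l) = agen l" for l by (simp add: t_def)
  have b: "act bgen w (x, b) = (act t w x, b)" and a: "act agen w 0 = 0" "act agen w (Suc x) = Suc (act t w x)"
    if "w \<in> lists {0<..}" for w x b
    using that
  proof (induction rule: lists.induct)
    case (Cons i w)
    obtain l where i: "i = Suc l" using Cons.hyps by (cases i) auto
    have "agen (Suc l) (Suc y) = Suc (agen l y)" "agen (Suc l) 0 = 0" for y
      by (auto simp: agen_def Transposition.transpose_def)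
    then show "act bgen (i # w) (x, b) = (act t (i # w) x, b)"
      "act agen (i # w) 0 = 0" "act agen (i # w) (Suc x) = Suc (act t (i # w) x)"
      using Cons by (simp_all add: i bgen_Suc t_Suc)
  qed simp_all
  have "act bgen u = act bgen v \<longleftrightarrow> act t u = act t v"
    by (simp add: fun_eq_iff b[OF assms(1)] b[OF assms(2)])
  moreover have "act agen u = act agen v \<longleftrightarrow> act t u = act t v"
  proof
    assume "act agen u = act agen v"
    then have "Suc (act t u x) = Suc (act t v x)" for x by (simp flip: a(2)[OF assms(1)] a(2)[OF assms(2)])
    then show "act t u = act t v" by (simp add: fun_eq_iff)
  next
    assume "act t u = act t v"
    then have "act agen u x = act agen v x" for x
      by (cases x) (simp_all add: a[OF assms(1)] a[OF assms(2)])
    then show "act agen u = act agen v" by (simp add: fun_eq_iff)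
  qed
  ultimately show ?thesis by simp
qed

lemma agen_braid': "act agen [Suc i, i, Suc i, i, Suc i, i] = id"
  by (auto simp: agen_def Transposition.transpose_def fun_eq_iff)

abbreviation actT :: "nat list \<Rightarrow> nat \<Rightarrow> nat" where "actT \<equiv> act agen"
abbreviation actB :: "nat list \<Rightarrow> nat \<times> bool \<Rightarrow> nat \<times> bool" where "actB \<equiv> act bgen"

definition actC :: "nat \<Rightarrow> nat list \<Rightarrow> nat \<times> bool \<Rightarrow> nat \<times> bool" where
  "actC n w = act bgen (reflect n w)"

lemma actC_act: "actC n = act (\<lambda>i. bgen (n - Suc i))"
  by (simp add: fun_eq_iff actC_def reflect_def act_map)

lemma word_map_actC: "word_map I (actC n)"
  unfolding actC_act by (intro word_map_act bgen_invol)

lemma string_words_actC: "string_words n (actC n)"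
  unfolding actC_def by (intro string_words_reflect string_words_bgen)

lemma actC_parity: "actC n w = actC n [] \<Longrightarrow> even (length w)"
  using act_bgen_parity[of "reflect n w"] by (simp add: actC_def)

lemma actB_actT_upper:
  "u \<in> lists {k<..<n} \<Longrightarrow> v \<in> lists {k<..<n} \<Longrightarrow> actB u = actB v \<longleftrightarrow> actT u = actT v"
  by (intro bgen_agen_cong) (auto elim!: subsetD[OF lists_mono, rotated])

lemma reflect_lower: "w \<in> lists {..<k} \<Longrightarrow> k < n \<Longrightarrow> reflect n w \<in> lists {0<..}"
  by (induction w rule: lists.induct) auto

lemma actC_actT_lower:
  assumes "u \<in> lists {..<k}" "v \<in> lists {..<k}" "k < n"
  shows "actC n u = actC n v \<longleftrightarrow> actT u = actT v"
proof -
  have n: "u \<in> lists {..<n}" "v \<in> lists {..<n}" using assms lists_mono[of "{..<k}" "{..<n}"] by auto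
  have "actC n u = actC n v \<longleftrightarrow> actT (reflect n u) = actT (reflect n v)"
    unfolding actC_def using assms by (intro bgen_agen_cong reflect_lower)
  then show ?thesis using agen_reflect_cong[OF n] by simp
qed

lemma reflect_upper:
  assumes "m \<le> n" shows "reflect n ` lists ((\<lambda>i. n - Suc i) ` {..<m}) = lists {..<m}"
proof (intro equalityI subsetI)
  fix w assume "w \<in> reflect n ` lists ((\<lambda>i. n - Suc i) ` {..<m})"
  then obtain u where "u \<in> lists ((\<lambda>i. n - Suc i) ` {..<m})" "w = reflect n u" by blast
  then show "w \<in> lists {..<m}" using assms by (auto simp: reflect_def in_lists_conv_set)
next
  fix w assume w: "w \<in> lists {..<m}"
  then have "w \<in> lists {..<n}" using assms lists_mono[of "{..<m}" "{..<n}"] by auto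
  then have "reflect n (reflect n w) = w" by simp
  moreover have "reflect n w \<in> lists ((\<lambda>i. n - Suc i) ` {..<m})"
    using w by (auto simp: reflect_def in_lists_conv_set)
  ultimately show "w \<in> reflect n ` lists ((\<lambda>i. n - Suc i) ` {..<m})" by (metis imageI)
qed

lemma greaterThanLessThan_reflect: "k < n \<Longrightarrow> {k<..<n} = (\<lambda>i. n - Suc i) ` {..<n - Suc k}"
proof (intro equalityI subsetI)
  fix i assume "k < n" "i \<in> {k<..<n}"
  then show "i \<in> (\<lambda>i. n - Suc i) ` {..<n - Suc k}" by (intro image_eqI[of _ _ "n - Suc i"]) auto
qed auto

lemma card_actT_reflected:
  assumes "m \<le> n" shows "card (actT ` lists ((\<lambda>i. n - Suc i) ` {..<m})) = fact (Suc m)"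
proof -
  have sub: "lists ((\<lambda>i. n - Suc i) ` {..<m}) \<subseteq> lists {..<n}" using assms by (intro lists_mono) auto
  have "card (actT ` lists ((\<lambda>i. n - Suc i) ` {..<m}))
      = card ((\<lambda>w. actT (reflect n w)) ` lists ((\<lambda>i. n - Suc i) ` {..<m}))"
    using sub by (intro card_image_cong_kernel) (simp add: agen_reflect_cong subset_iff)
  also have "\<dots> = card (actT ` lists {..<m})"
    by (simp only: reflect_upper[OF assms, symmetric] image_image)
  finally show ?thesis by (simp only: card_act_agen)
qed

lemma card_actC_reflected:
  assumes "m \<le> n" shows "card (actC n ` lists ((\<lambda>i. n - Suc i) ` {..<m})) = 2 ^ m * fact m"
proof -
  have "actC n ` lists ((\<lambda>i. n - Suc i) ` {..<m}) = actB ` lists {..<m}"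
    unfolding reflect_upper[OF assms, symmetric] image_image actC_def by (rule refl)
  then show ?thesis by (simp only: card_act_bgen)
qed

lemma finite_pair_image: "finite (f ` A) \<Longrightarrow> finite (g ` A) \<Longrightarrow> finite ((\<lambda>w. (f w, g w)) ` A)"
  by (rule finite_subset[of _ "f ` A \<times> g ` A"]) auto

lemma finite_actT: "finite (actT ` lists {..<k})" and finite_actB: "finite (actB ` lists {..<k})"
  using card_act_agen[of k] card_act_bgen[of k] by (auto intro: card_ge_0_finite)

text \<open>Here the edge labelled \<open>4\<close> is the first one, so the diagram is traversed from its beginning.\<close>

lemma card_pair_actB:
  assumes f: "word_map {..<k} f" and k: "0 < k"
    and f3: "f [0, 1, 0, 1, 0, 1] = f []"
    and par: "\<And>w. w \<in> lists {..<k} \<Longrightarrow> f w = f [] \<Longrightarrow> even (length w)"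
    and fin: "finite (f ` lists {..<k})"
  shows "2 * card ((\<lambda>w. (f w, actB w)) ` lists {..<k}) = card (f ` lists {..<k}) * (2 ^ k * fact k)"
proof -
  have "card ((\<lambda>w. (f w, actB w)) ` lists {..<k}) = card (f ` lists {..<k}) * card (actB ` even_words {..<k})"
  proof (rule card_pair_words[OF f word_map_bgen par _ fin finite_actB])
    fix w assume w: "w \<in> even_words {..<k}"
    show "\<exists>v\<in>lists {..<k}. f v = f [] \<and> actB v = actB w"
    proof (rule even_words_in_kernel[OF f word_map_bgen, where d = id and k = k])
      fix i assume "Suc (Suc i) < k"
      show "actB [id i, id (Suc (Suc i))] = actB [id (Suc (Suc i)), id i]"
        using bgen_comm[of i "Suc (Suc i)"] by simp
    qed (use f3 bgen_braid bgen_braid4 w in simp_all)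
  qed
  moreover have "2 * card (actB ` even_words {..<k}) = card (actB ` lists {..<k})"
    using act_bgen_parity k finite_actB
    by (intro word_map.card_double_even[OF word_map_bgen, symmetric]) auto
  ultimately show ?thesis by (simp add: card_act_bgen)
qed

text \<open>Here the edge labelled \<open>4\<close> is the last one; the letters are enumerated from the end.\<close>

lemma card_pair_actC:
  assumes m: "0 < m" "m \<le> n" and I: "I = (\<lambda>i. n - Suc i) ` {..<m}"
  shows "2 * card ((\<lambda>w. (actT w, actC n w)) ` lists I) = fact (Suc m) * (2 ^ m * fact m)"
proof -
  let ?d = "\<lambda>i. n - Suc i"
  have r: "n - Suc (n - Suc i) = i" if "i < m" for i using that m by simp
  have fin: "finite (actT ` lists I)" "finite (actC n ` lists I)"
    using card_actT_reflected[OF m(2)] card_actC_reflected[OF m(2)] unfolding I by (auto intro: card_ge_0_finite)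
  have "card ((\<lambda>w. (actT w, actC n w)) ` lists I) = card (actT ` lists I) * card (actC n ` even_words I)"
  proof (rule card_pair_words[OF word_map_agen word_map_actC _ _ fin])
    fix w assume w: "w \<in> even_words I"
    show "\<exists>v\<in>lists I. actT v = actT [] \<and> actC n v = actC n w"
    proof (rule even_words_in_kernel[OF word_map_agen word_map_actC I])
      assume "Suc 0 < m"
      then have d: "?d 0 = Suc (?d 1)" using m by simp
      show "actT [?d 0, ?d 1, ?d 0, ?d 1, ?d 0, ?d 1] = actT []"
        unfolding d using agen_braid' by simp
    next
      assume "Suc 0 < m"
      then have "reflect n [?d 0, ?d 1, ?d 0, ?d 1, ?d 0, ?d 1, ?d 0, ?d 1] = [0, 1, 0, 1, 0, 1, 0, 1]"
        using r[of 0] r[of 1] by simp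
      then show "actC n [?d 0, ?d 1, ?d 0, ?d 1, ?d 0, ?d 1, ?d 0, ?d 1] = actC n []"
        unfolding actC_def by (simp only: bgen_braid4 reflect_Nil act_Nil)
    next
      fix i assume i: "0 < i" "Suc i < m"
      then have "reflect n [?d i, ?d (Suc i), ?d i, ?d (Suc i), ?d i, ?d (Suc i)] = [i, Suc i, i, Suc i, i, Suc i]"
        using r[of i] r[of "Suc i"] by simp
      then show "actC n [?d i, ?d (Suc i), ?d i, ?d (Suc i), ?d i, ?d (Suc i)] = actC n []"
        unfolding actC_def using i by (simp only: bgen_braid reflect_Nil act_Nil)
    next
      fix i assume i: "Suc (Suc i) < m"
      then have "reflect n [?d i, ?d (Suc (Suc i))] = [i, Suc (Suc i)]"
        "reflect n [?d (Suc (Suc i)), ?d i] = [Suc (Suc i), i]"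
        using r[of i] r[of "Suc (Suc i)"] by simp_all
      then show "actC n [?d i, ?d (Suc (Suc i))] = actC n [?d (Suc (Suc i)), ?d i]"
        using bgen_comm[of i "Suc (Suc i)"] by (simp add: actC_def del: reflect_Cons)
    qed (rule w)
  qed (use act_agen_parity in auto)
  moreover have "2 * card (actC n ` even_words I) = card (actC n ` lists I)"
    using actC_parity m fin(2) unfolding I
    by (intro word_map.card_double_even[OF word_map_actC, symmetric]) auto
  ultimately show ?thesis
    using card_actT_reflected[OF m(2)] card_actC_reflected[OF m(2)] by (simp add: I)
qed

lemma lessThan_reflect: "{..<n} = (\<lambda>i. n - Suc i) ` {..<n}"
proof (intro equalityI subsetI)
  fix i assume "i \<in> {..<n}"
  then show "i \<in> (\<lambda>i. n - Suc i) ` {..<n}" by (intro image_eqI[of _ _ "n - Suc i"]) auto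
qed auto

lemma card_TB_lower:
  assumes "0 < k"
  shows "2 * card ((\<lambda>w. (actT w, actB w)) ` lists {..<k}) = fact (Suc k) * (2 ^ k * fact k)"
proof -
  have "2 * card ((\<lambda>w. (actT w, actB w)) ` lists {..<k}) = card (actT ` lists {..<k}) * (2 ^ k * fact k)"
    using agen_braid[of 0] act_agen_parity finite_actT assms
    by (intro card_pair_actB word_map_agen) simp_all
  then show ?thesis by (simp only: card_act_agen)
qed

lemma card_TB_upper:
  assumes "k < n" shows "card ((\<lambda>w. (actT w, actB w)) ` lists {k<..<n}) = fact (n - k)"
proof -
  have "card ((\<lambda>w. (actT w, actB w)) ` lists {k<..<n}) = card (actT ` lists {k<..<n})"
    by (rule card_image_cong_kernel) (simp add: actB_actT_upper)
  then show ?thesis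
    using card_actT_reflected[of "n - Suc k" n] assms by (simp only: greaterThanLessThan_reflect) (simp add: Suc_diff_Suc)
qed

lemma card_TC_lower:
  assumes "k < n" shows "card ((\<lambda>w. (actT w, actC n w)) ` lists {..<k}) = fact (Suc k)"
proof -
  have "card ((\<lambda>w. (actT w, actC n w)) ` lists {..<k}) = card (actT ` lists {..<k})"
    using assms by (intro card_image_cong_kernel) (simp add: actC_actT_lower)
  then show ?thesis by (simp only: card_act_agen)
qed

lemma card_TC_upper:
  assumes "Suc k < n"
  shows "2 * card ((\<lambda>w. (actT w, actC n w)) ` lists {k<..<n}) = fact (n - k) * (2 ^ (n - Suc k) * fact (n - Suc k))"
proof -
  have "{k<..<n} = (\<lambda>i. n - Suc i) ` {..<n - Suc k}" using assms by (intro greaterThanLessThan_reflect) simp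
  from card_pair_actC[OF _ _ this] show ?thesis using assms by (simp add: Suc_diff_Suc del: fact_Suc)
qed

lemma card_TC_full:
  "0 < n \<Longrightarrow> 2 * card ((\<lambda>w. (actT w, actC n w)) ` lists {..<n}) = fact (Suc n) * (2 ^ n * fact n)"
  by (rule card_pair_actC[OF _ order_refl lessThan_reflect])

lemma card_CB_lower:
  assumes "k < n"
  shows "card ((\<lambda>w. (actC n w, actB w)) ` lists {..<k}) = card ((\<lambda>w. (actT w, actB w)) ` lists {..<k})"
  using assms by (intro card_image_cong_kernel) (simp add: actC_actT_lower)

lemma card_CB_upper:
  "card ((\<lambda>w. (actC n w, actB w)) ` lists {k<..<n}) = card ((\<lambda>w. (actT w, actC n w)) ` lists {k<..<n})"
  by (rule card_image_cong_kernel) (auto simp: actB_actT_upper)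

lemma actC_braid:
  assumes "3 \<le> n" shows "actC n [0, 1, 0, 1, 0, 1] = actC n []"
proof -
  define i where "i = n - 3"
  have "reflect n [0, 1, 0, 1, 0, 1] = [Suc (Suc i), Suc i, Suc (Suc i), Suc i, Suc (Suc i), Suc i]"
    using assms unfolding i_def reflect_Cons reflect_Nil by (auto simp del: One_nat_def)
  moreover have "act bgen [Suc (Suc i), Suc i, Suc (Suc i), Suc i, Suc (Suc i), Suc i] = id"
    using agen_braid'[of i] by (auto simp: fun_eq_iff bgen_Suc)
  ultimately show ?thesis unfolding actC_def by (simp only: reflect_Nil act_Nil)
qed

lemma card_actC_full: "card (actC n ` lists {..<n}) = 2 ^ n * fact n"
  using card_actC_reflected[OF order_refl, of n] by (simp flip: lessThan_reflect)

lemma card_CB_full: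
  assumes "3 \<le> n"
  shows "2 * card ((\<lambda>w. (actC n w, actB w)) ` lists {..<n}) = (2 ^ n * fact n) * (2 ^ n * fact n)"
proof -
  have "finite (actC n ` lists {..<n})" using card_actC_full[of n] by (intro card_ge_0_finite) simp
  then have "2 * card ((\<lambda>w. (actC n w, actB w)) ` lists {..<n}) = card (actC n ` lists {..<n}) * (2 ^ n * fact n)"
    using assms actC_parity actC_braid by (intro card_pair_actB word_map_actC) simp_all
  then show ?thesis by (simp only: card_actC_full)
qed

lemma card_TCB_lower:
  assumes "k < n"
  shows "card ((\<lambda>w. ((actT w, actC n w), actB w)) ` lists {..<k}) = card ((\<lambda>w. (actT w, actB w)) ` lists {..<k})"
  using assms by (intro card_image_cong_kernel) (simp add: actC_actT_lower)

lemma card_TCB_upper: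
  "card ((\<lambda>w. ((actT w, actC n w), actB w)) ` lists {k<..<n}) = card ((\<lambda>w. (actT w, actC n w)) ` lists {k<..<n})"
  by (rule card_image_cong_kernel) (auto simp: actB_actT_upper)

lemma card_TCB_full:
  assumes "3 \<le> n"
  shows "4 * card ((\<lambda>w. ((actT w, actC n w), actB w)) ` lists {..<n})
    = fact (Suc n) * (2 ^ n * fact n) * (2 ^ n * fact n)"
proof -
  have "finite ((\<lambda>w. (actT w, actC n w)) ` lists {..<n})"
    using finite_pair_image[OF finite_actT, of "actC n" n] card_actC_full[of n] by (simp add: card_ge_0_finite)
  then have "2 * card ((\<lambda>w. ((actT w, actC n w), actB w)) ` lists {..<n})
      = card ((\<lambda>w. (actT w, actC n w)) ` lists {..<n}) * (2 ^ n * fact n)"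
    using assms actC_braid agen_braid[of 0] act_agen_parity
    by (intro card_pair_actB word_map_pair word_map_agen word_map_actC) simp_all
  then have "4 * card ((\<lambda>w. ((actT w, actC n w), actB w)) ` lists {..<n})
      = (2 * card ((\<lambda>w. (actT w, actC n w)) ` lists {..<n})) * (2 ^ n * fact n)" by linarith
  then show ?thesis using card_TC_full[of n] assms by simp
qed

section \<open>The mix in terms of words\<close>

definition word_prod :: "('g, 'h) monoid_scheme \<Rightarrow> (nat \<Rightarrow> 'g) \<Rightarrow> nat list \<Rightarrow> 'g" where
  "word_prod G a w = foldr (\<lambda>i x. a i \<otimes>\<^bsub>G\<^esub> x) w \<one>\<^bsub>G\<^esub>"

lemma word_prod_Nil [simp]: "word_prod G a [] = \<one>\<^bsub>G\<^esub>"
  and word_prod_Cons [simp]: "word_prod G a (i # w) = a i \<otimes>\<^bsub>G\<^esub> word_prod G a w"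
  by (simp_all add: word_prod_def)

text \<open>Evaluation of words in an actual group.\<close>

locale involution_words = group G for G (structure) +
  fixes n :: nat and a :: "nat \<Rightarrow> 'a"
  assumes a_closed: "i < n \<Longrightarrow> a i \<in> carrier G"
    and a_invol: "i < n \<Longrightarrow> a i \<otimes> a i = \<one>"
begin

abbreviation "R \<equiv> word_prod G a"

lemma R_closed: "w \<in> lists {..<n} \<Longrightarrow> R w \<in> carrier G"
  by (induction w rule: lists.induct) (auto simp: a_closed)

lemma R_append: "u \<in> lists {..<n} \<Longrightarrow> v \<in> lists {..<n} \<Longrightarrow> R (u @ v) = R u \<otimes> R v"
  by (induction u rule: lists.induct) (auto simp: a_closed R_closed m_assoc)

lemma R_rev: "w \<in> lists {..<n} \<Longrightarrow> R w \<otimes> R (rev w) = \<one>"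
proof (induction w rule: lists.induct)
  case (Cons i w)
  then have i: "i < n" by simp
  have "R (i # w) \<otimes> R (rev (i # w)) = (a i \<otimes> R w) \<otimes> (R (rev w) \<otimes> a i)"
    using Cons i by (simp add: R_append a_closed)
  also have "\<dots> = a i \<otimes> (R w \<otimes> R (rev w)) \<otimes> a i"
    using Cons.hyps i by (simp add: m_assoc a_closed R_closed)
  also have "\<dots> = \<one>" unfolding Cons.IH using i by (simp add: a_closed a_invol)
  finally show ?case .
qed simp

lemma inv_R: "w \<in> lists {..<n} \<Longrightarrow> inv (R w) = R (rev w)"
  using R_rev[of w] R_rev[of "rev w"] R_closed by (intro inv_equality) auto

text \<open>All products of two generators of \<open>I\<close> generate the even part; the set \<open>S\<close> may be any
  family of even products that yields them.\<close>

lemma generate_pairs: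
  assumes I: "I \<subseteq> {..<n}" and S: "S \<subseteq> R ` even_words I"
    and pairs: "\<And>i j. \<lbrakk>i \<in> I; j \<in> I; i < j\<rbrakk> \<Longrightarrow> R [i, j] \<in> generate G S"
  shows "generate G S = R ` even_words I"
proof (intro equalityI subsetI)
  have sub: "w \<in> lists {..<n}" if "w \<in> even_words I" for w
    using that lists_mono[OF I] by (auto simp: even_words_def)
  fix x assume "x \<in> generate G S"
  then show "x \<in> R ` even_words I"
  proof (induction rule: generate.induct)
    case one
    show ?case by (rule image_eqI[of _ _ "[]"]) (auto simp: even_words_def)
  next
    case (incl h)
    then show ?case using S by blast
  next
    case (inv h)
    then obtain w where w: "w \<in> even_words I" "h = R w" using S by blast
    then have "inv h = R (rev w)" using inv_R sub by simp
    then show ?case using w by (intro image_eqI[of _ _ "rev w"]) (auto simp: even_words_def)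
  next
    case (eng h1 h2)
    then obtain u v where uv: "u \<in> even_words I" "h1 = R u" "v \<in> even_words I" "h2 = R v" by blast
    then have "h1 \<otimes> h2 = R (u @ v)" using R_append sub by simp
    then show ?case using uv by (intro image_eqI[of _ _ "u @ v"]) (auto simp: even_words_def)
  qed
next
  have SG: "S \<subseteq> carrier G"
  proof
    fix x assume "x \<in> S"
    then obtain w where "w \<in> even_words I" "x = R w" using S by blast
    then show "x \<in> carrier G" using R_closed lists_mono[OF I] by (auto simp: even_words_def)
  qed
  interpret H: subgroup "generate G S" G by (rule generate_is_subgroup[OF SG])
  have pair: "R [i, j] \<in> generate G S" if ij: "i \<in> I" "j \<in> I" for i j
  proof -
    have n: "i < n" "j < n" using ij I by auto
    consider "i < j" | "i = j" | "j < i" by linarith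
    then show ?thesis
    proof cases
      case 2
      then show ?thesis using n by (simp add: a_closed a_invol)
    next
      case 3
      then have "R [j, i] \<in> generate G S" using ij pairs by blast
      then have "inv (R [j, i]) \<in> generate G S" by (rule H.m_inv_closed)
      then show ?thesis using inv_R[of "[j, i]"] n by simp
    qed (use ij pairs in blast)
  qed
  have "R w \<in> generate G S" if "w \<in> even_words I" for w
    using that
  proof (induction w rule: induct_list012)
    case (3 i j w)
    then have ij: "i \<in> I" "j \<in> I" and w: "w \<in> even_words I" by (auto simp: even_words_def)
    have wn: "w \<in> lists {..<n}" using w lists_mono[OF I] by (auto simp: even_words_def)
    have "R ([i, j] @ w) = R [i, j] \<otimes> R w" using ij I wn by (intro R_append) auto
    then show ?case using H.m_closed[OF pair[OF ij] 3(1)[OF w]] by simp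
  qed (auto simp: even_words_def)
  then show "x \<in> generate G S" if "x \<in> R ` even_words I" for x using that by blast
qed

lemma generate_adjacent_pairs:
  assumes "S = (\<lambda>i. R [i - 1, i]) ` {1..n - 1}"
  shows "generate G S = R ` even_words {..<n}"
proof (rule generate_pairs)
  show S: "S \<subseteq> R ` even_words {..<n}"
    unfolding assms
  proof
    fix x assume "x \<in> (\<lambda>i. R [i - 1, i]) ` {1..n - 1}"
    then obtain i where "i \<in> {1..n - 1}" "x = R [i - 1, i]" by blast
    then show "x \<in> R ` even_words {..<n}"
      by (intro image_eqI[of _ _ "[i - 1, i]"]) (auto simp: even_words_def)
  qed
  have SG: "S \<subseteq> carrier G"
  proof
    fix x assume "x \<in> S"
    then obtain w where "w \<in> even_words {..<n}" "x = R w" using S by blast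
    then show "x \<in> carrier G" using R_closed by (auto simp: even_words_def)
  qed
  interpret H: subgroup "generate G S" G by (rule generate_is_subgroup[OF SG])
  fix i j assume ij: "i \<in> {..<n}" "j \<in> {..<n}" "i < j"
  have "Suc i \<le> j" using ij by simp
  then show "R [i, j] \<in> generate G S" using ij(2)
  proof (induction j rule: dec_induct)
    case base
    then have "R [Suc i - 1, Suc i] \<in> S" unfolding assms by (intro imageI) auto
    then show ?case by (simp add: generate.incl)
  next
    case (step j)
    then have jn: "j < n" "Suc j < n" "i < n" by auto
    have "R [Suc j - 1, Suc j] \<in> S" unfolding assms using jn by (intro imageI) auto
    then have 1: "R [j, Suc j] \<in> generate G S" by (simp add: generate.incl)
    have "R [i, j] \<in> generate G S" using step jn by simp
    then have "R [i, j] \<otimes> R [j, Suc j] \<in> generate G S" using 1 by (rule H.m_closed)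
    moreover have "R [i, j] \<otimes> R [j, Suc j] = a i \<otimes> (a j \<otimes> a j) \<otimes> a (Suc j)"
      using jn by (simp add: a_closed m_assoc)
    then have "R [i, j] \<otimes> R [j, Suc j] = R [i, Suc j]" using jn by (simp add: a_closed a_invol)
    ultimately show ?case by simp
  qed
qed simp

end

lemma group_AutPoset: "group (AutPoset P)"
  and AutPoset_mult_closed: "f \<in> poset_aut P \<Longrightarrow> g \<in> poset_aut P \<Longrightarrow> compose (faces P) f g \<in> poset_aut P"
proof -
  let ?B = "BijGroup (faces P)"
  interpret B: group ?B by (rule group_BijGroup)
  show comp: "compose (faces P) f g \<in> poset_aut P" if fg: "f \<in> poset_aut P" "g \<in> poset_aut P" for f g
  proof -
    have "g F \<in> faces P" if "F \<in> faces P" for F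
      using fg(2) that by (auto simp: poset_aut_def dest: Bij_imp_funcset)
    then show ?thesis using fg by (auto simp: poset_aut_def compose_Bij compose_eq)
  qed
  have "subgroup (poset_aut P) ?B"
  proof (rule B.subgroupI)
    show "poset_aut P \<subseteq> carrier ?B" by (auto simp: poset_aut_def BijGroup_def)
    have "(\<lambda>x\<in>faces P. x) \<in> poset_aut P" by (auto simp: poset_aut_def id_Bij)
    then show "poset_aut P \<noteq> {}" by blast
  next
    fix f assume f: "f \<in> poset_aut P"
    then have fB: "f \<in> Bij (faces P)" by (simp add: poset_aut_def)
    have "below P (inv_into (faces P) f F) (inv_into (faces P) f G) \<longleftrightarrow> below P F G"
      if "F \<in> faces P" "G \<in> faces P" for F G
    proof -
      have im: "f ` faces P = faces P" using fB by (simp add: Bij_def bij_betw_def)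
      have inv: "f (inv_into (faces P) f H) = H" "inv_into (faces P) f H \<in> faces P" if "H \<in> faces P" for H
        using that im by (auto intro: f_inv_into_f inv_into_into)
      have "below P (f H) (f K) \<longleftrightarrow> below P H K" if "H \<in> faces P" "K \<in> faces P" for H K
        using f that by (simp add: poset_aut_def)
      from this[OF inv(2)[OF that(1)] inv(2)[OF that(2)]] show ?thesis
        by (simp only: inv(1)[OF that(1)] inv(1)[OF that(2)])
    qed
    then show "inv\<^bsub>?B\<^esub> f \<in> poset_aut P"
      using fB by (simp add: inv_BijGroup poset_aut_def restrict_inv_into_Bij)
  next
    fix f g assume "f \<in> poset_aut P" "g \<in> poset_aut P"
    then show "f \<otimes>\<^bsub>?B\<^esub> g \<in> poset_aut P"
      using comp[of f g] by (simp add: BijGroup_def poset_aut_def)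
  qed
  then show "group (AutPoset P)" unfolding AutPoset_def by (rule subgroup.subgroup_is_group) (rule group_BijGroup)
qed

lemma AutPoset_simps:
  "carrier (AutPoset P) = poset_aut P" "\<one>\<^bsub>AutPoset P\<^esub> = (\<lambda>F\<in>faces P. F)"
  "f \<in> poset_aut P \<Longrightarrow> g \<in> poset_aut P \<Longrightarrow> f \<otimes>\<^bsub>AutPoset P\<^esub> g = compose (faces P) f g"
  by (auto simp: AutPoset_def BijGroup_def poset_aut_def)

text \<open>The descriptions \<open>rho P \<Phi> i\<close> denote automorphisms, and these are involutions.\<close>

definition reflexible :: "nat \<Rightarrow> 'f ranked_poset \<Rightarrow> 'f set \<Rightarrow> bool" where
  "reflexible n P \<Phi> \<longleftrightarrow> involution_words (AutPoset P) n (rho P \<Phi>)"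

abbreviation rho_word :: "'f ranked_poset \<Rightarrow> 'f set \<Rightarrow> nat list \<Rightarrow> 'f \<Rightarrow> 'f" where
  "rho_word P \<Phi> \<equiv> word_prod (AutPoset P) (rho P \<Phi>)"

lemma rotation_group_eq:
  assumes "reflexible n P \<Phi>"
  shows "rotation_group n P \<Phi> = AutPoset P \<lparr>carrier := rho_word P \<Phi> ` even_words {..<n}\<rparr>"
proof -
  interpret involution_words "AutPoset P" n "rho P \<Phi>" using assms by (simp add: reflexible_def)
  have S: "sigma P \<Phi> ` {1..n - 1} = (\<lambda>i. rho_word P \<Phi> [i - 1, i]) ` {1..n - 1}"
  proof (intro image_cong refl)
    fix i assume "i \<in> {1..n - 1}"
    then have "i < n" by auto
    then show "sigma P \<Phi> i = rho_word P \<Phi> [i - 1, i]" by (simp add: sigma_def a_closed)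
  qed
  moreover have "sigma P \<Phi> ` {1..n - 1} \<subseteq> carrier (AutPoset P)"
    unfolding S
  proof
    fix x assume "x \<in> (\<lambda>i. rho_word P \<Phi> [i - 1, i]) ` {1..n - 1}"
    then obtain i where "i \<in> {1..n - 1}" "x = rho_word P \<Phi> [i - 1, i]" by blast
    then show "x \<in> carrier (AutPoset P)" by (simp only:) (rule R_closed, auto)
  qed
  ultimately show ?thesis
    using generate_adjacent_pairs[OF S] by (simp add: rotation_group_def subgroup_generated_def Int_absorb1)
qed

definition aut_product :: "('f ranked_poset \<times> 'f set) list \<Rightarrow> (nat \<Rightarrow> 'f \<Rightarrow> 'f) monoid" where
  "aut_product Ps = product_group {..<length Ps} (\<lambda>r. AutPoset (fst (Ps ! r)))"

definition mix_rho :: "('f ranked_poset \<times> 'f set) list \<Rightarrow> nat \<Rightarrow> nat \<Rightarrow> 'f \<Rightarrow> 'f" where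
  "mix_rho Ps i = (\<lambda>r\<in>{..<length Ps}. rho (fst (Ps ! r)) (snd (Ps ! r)) i)"

abbreviation mix_word :: "('f ranked_poset \<times> 'f set) list \<Rightarrow> nat list \<Rightarrow> nat \<Rightarrow> 'f \<Rightarrow> 'f" where
  "mix_word Ps \<equiv> word_prod (aut_product Ps) (mix_rho Ps)"

lemma mix_word_eq:
  "mix_word Ps w = (\<lambda>r\<in>{..<length Ps}. rho_word (fst (Ps ! r)) (snd (Ps ! r)) w)"
proof (induction w)
  case Nil
  then show ?case by (simp add: aut_product_def)
next
  case (Cons i w)
  show ?case unfolding word_prod_Cons Cons.IH by (simp add: aut_product_def mix_rho_def cong: restrict_cong)
qed

locale reflexible_mix =
  fixes n :: nat and Ps :: "('f ranked_poset \<times> 'f set) list"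
  assumes refl: "r < length Ps \<Longrightarrow> reflexible n (fst (Ps ! r)) (snd (Ps ! r))"
begin

sublocale involution_words "aut_product Ps" n "mix_rho Ps"
proof -
  interpret group "aut_product Ps"
    unfolding aut_product_def by (rule product_group) (rule group_AutPoset)
  show "involution_words (aut_product Ps) n (mix_rho Ps)"
  proof
    fix i assume i: "i < n"
    have r: "rho (fst (Ps ! r)) (snd (Ps ! r)) i \<in> carrier (AutPoset (fst (Ps ! r)))"
      "rho (fst (Ps ! r)) (snd (Ps ! r)) i \<otimes>\<^bsub>AutPoset (fst (Ps ! r))\<^esub> rho (fst (Ps ! r)) (snd (Ps ! r)) i
        = \<one>\<^bsub>AutPoset (fst (Ps ! r))\<^esub>"
      if "r < length Ps" for r
      using refl[OF that] i by (auto simp: reflexible_def involution_words_def involution_words_axioms_def)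
    then show "mix_rho Ps i \<in> carrier (aut_product Ps)" by (auto simp: aut_product_def mix_rho_def)
    show "mix_rho Ps i \<otimes>\<^bsub>aut_product Ps\<^esub> mix_rho Ps i = \<one>\<^bsub>aut_product Ps\<^esub>"
      using r(2) by (auto simp: aut_product_def mix_rho_def intro!: restrict_ext)
  qed
qed

lemma mix_beta_eq: "mix_beta Ps i = mix_word Ps [i - 1, i]" if i: "1 \<le> i" "i \<le> n - 1"
proof -
  have "i < n" using i by simp
  then
  have "sigma (fst (Ps ! r)) (snd (Ps ! r)) i = rho_word (fst (Ps ! r)) (snd (Ps ! r)) [i - 1, i]"
    if "r < length Ps" for r
  proof -
    interpret r: involution_words "AutPoset (fst (Ps ! r))" n "rho (fst (Ps ! r)) (snd (Ps ! r))"
      using refl[OF that] by (simp add: reflexible_def)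
    show ?thesis using \<open>i < n\<close> by (simp add: sigma_def r.a_closed)
  qed
  then show ?thesis unfolding mix_word_eq mix_beta_def by (auto intro!: restrict_ext)
qed

lemma even_subgroup:
  assumes "I \<subseteq> {..<n}" shows "subgroup (R ` even_words I) (aut_product Ps)"
proof -
  have S: "R ` even_words I \<subseteq> carrier (aut_product Ps)"
    using R_closed lists_mono[OF assms] by (auto simp: even_words_def)
  moreover have "R [i, j] \<in> generate (aut_product Ps) (R ` even_words I)" if "i \<in> I" "j \<in> I" for i j
  proof (rule generate.incl)
    show "R [i, j] \<in> R ` even_words I"
      using that by (intro imageI) (simp add: even_words_def)
  qed
  ultimately have "generate (aut_product Ps) (R ` even_words I) = R ` even_words I"
    by (intro generate_pairs assms) auto
  then show ?thesis using generate_is_subgroup[OF S] by simp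
qed

text \<open>The product of the rotation groups has the multiplication of the product of the full automorphism groups,
  so the mix may be computed inside the latter, where the involutions themselves are available.\<close>

lemma mix_group_eq: "mix_group n Ps = aut_product Ps \<lparr>carrier := R ` even_words {..<n}\<rparr>"
proof -
  let ?rot = "\<lambda>r. rotation_group n (fst (Ps ! r)) (snd (Ps ! r))"
  define H where "H = (\<Pi>\<^sub>E r\<in>{..<length Ps}. carrier (?rot r))"
  have rot: "?rot r = AutPoset (fst (Ps ! r)) \<lparr>carrier := rho_word (fst (Ps ! r)) (snd (Ps ! r)) ` even_words {..<n}\<rparr>"
    if "r < length Ps" for r
    by (rule rotation_group_eq[OF refl[OF that]])
  have prod: "product_group {..<length Ps} ?rot = aut_product Ps \<lparr>carrier := H\<rparr>"
    unfolding aut_product_def product_group_def H_def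
    by (simp add: rotation_group_def)
  have "subgroup (carrier (?rot r)) (AutPoset (fst (Ps ! r)))" if "r < length Ps" for r
  proof -
    interpret r: involution_words "AutPoset (fst (Ps ! r))" n "rho (fst (Ps ! r)) (snd (Ps ! r))"
      using refl[OF that] by (simp add: reflexible_def)
    show ?thesis unfolding rotation_group_def carrier_subgroup_generated
      by (intro r.generate_is_subgroup) auto
  qed
  then have sub: "subgroup H (aut_product Ps)"
    unfolding H_def aut_product_def by (subst PiE_subgroup_product_group) (auto intro: group_AutPoset)
  have beta: "mix_beta Ps ` {1..n - 1} = (\<lambda>i. R [i - 1, i]) ` {1..n - 1}"
    by (intro image_cong refl mix_beta_eq) auto
  have "mix_beta Ps ` {1..n - 1} \<subseteq> H"
  proof
    fix x assume "x \<in> mix_beta Ps ` {1..n - 1}"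
    then obtain i where i: "i \<in> {1..n - 1}" "x = R [i - 1, i]" unfolding beta by blast
    show "x \<in> H" unfolding i(2) mix_word_eq H_def
    proof (rule restrict_PiE_iff[THEN iffD2], rule ballI)
      fix r assume "r \<in> {..<length Ps}"
      then have r: "r < length Ps" by simp
      show "rho_word (fst (Ps ! r)) (snd (Ps ! r)) [i - 1, i] \<in> carrier (?rot r)"
        unfolding rot[OF r] using i(1) by (auto simp: even_words_def simp del: word_prod_Cons intro!: imageI)
    qed
  qed
  then have "mix_group n Ps = aut_product Ps \<lparr>carrier := generate (aut_product Ps) (mix_beta Ps ` {1..n - 1})\<rparr>"
    unfolding mix_group_def prod subgroup_generated_def
    by (simp add: Int_absorb1 generate_consistent[OF _ sub])
  then show ?thesis using generate_adjacent_pairs[OF beta] by simp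
qed

text \<open>The product telescopes: consecutive factors share an involution.\<close>

lemma beta_prod_eq:
  assumes "1 \<le> i" "i \<le> j" "j \<le> n - 1" shows "beta_prod n Ps i j = R [i - 1, j]"
  using assms(2,1)
proof (induction i rule: inc_induct)
  case base
  have "R [j - 1, j] \<otimes>\<^bsub>aut_product Ps\<^esub> \<one>\<^bsub>aut_product Ps\<^esub> = R [j - 1, j]"
    using assms by (intro r_one R_closed) auto
  then show ?case using base assms by (simp add: beta_prod_def mix_group_eq mix_beta_eq del: word_prod_Cons)
next
  case (step i)
  then have i: "1 \<le> i" "i < j" "i < n" "j < n" using assms by auto
  have "beta_prod n Ps i j = R [i - 1, i] \<otimes>\<^bsub>aut_product Ps\<^esub> beta_prod n Ps (Suc i) j"
    using i by (simp add: beta_prod_def mix_group_eq mix_beta_eq upt_conv_Cons del: word_prod_Cons upt_Suc)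
  also have "beta_prod n Ps (Suc i) j = R [i, j]" using step by simp
  also have "R [i - 1, i] \<otimes>\<^bsub>aut_product Ps\<^esub> R [i, j]
      = mix_rho Ps (i - 1) \<otimes>\<^bsub>aut_product Ps\<^esub> (mix_rho Ps i \<otimes>\<^bsub>aut_product Ps\<^esub> mix_rho Ps i) \<otimes>\<^bsub>aut_product Ps\<^esub> mix_rho Ps j"
    using i by (simp add: m_assoc a_closed del: mult_product_group)
  also have "\<dots> = R [i - 1, j]" using i by (simp add: a_closed a_invol)
  finally show ?case .
qed

lemma mix_subgroup_eq:
  assumes "I \<subseteq> {..<n}" shows "mix_subgroup n Ps I = R ` even_words I"
proof -
  define S where "S = {R [i, j] | i j. i \<in> I \<and> j \<in> I \<and> i < j}"
  have "{beta_prod n Ps i j | i j. 1 \<le> i \<and> i \<le> j \<and> j \<le> n - 1 \<and> i - 1 \<in> I \<and> j \<in> I} = S"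
  proof (intro equalityI subsetI)
    fix x assume "x \<in> {beta_prod n Ps i j | i j. 1 \<le> i \<and> i \<le> j \<and> j \<le> n - 1 \<and> i - 1 \<in> I \<and> j \<in> I}"
    then obtain i j where ij: "1 \<le> i" "i \<le> j" "j \<le> n - 1" "i - 1 \<in> I" "j \<in> I" "x = beta_prod n Ps i j" by blast
    then have "x = R [i - 1, j]" "i - 1 < j" using beta_prod_eq by auto
    then show "x \<in> S" unfolding S_def using ij by blast
  next
    fix x assume "x \<in> S"
    then obtain i j where ij: "i \<in> I" "j \<in> I" "i < j" "x = R [i, j]" unfolding S_def by blast
    then have "j \<le> n - 1" using assms by auto
    then have "x = beta_prod n Ps (Suc i) j" using ij beta_prod_eq[of "Suc i" j] by simp
    then show "x \<in> {beta_prod n Ps i j | i j. 1 \<le> i \<and> i \<le> j \<and> j \<le> n - 1 \<and> i - 1 \<in> I \<and> j \<in> I}"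
      using ij \<open>j \<le> n - 1\<close> by (intro CollectI exI[of _ "Suc i"] exI[of _ j]) simp
  qed
  moreover have S: "S \<subseteq> R ` even_words I"
    unfolding S_def by (auto simp: even_words_def simp del: word_prod_Cons intro!: imageI)
  moreover have "even_words I \<subseteq> even_words {..<n}"
    using lists_mono[OF assms] by (auto simp: even_words_def)
  ultimately have "mix_subgroup n Ps I = generate (aut_product Ps) S"
    unfolding mix_subgroup_def mix_group_eq by (simp, intro generate_consistent even_subgroup) auto
  moreover have "generate (aut_product Ps) S = R ` even_words I"
    using S by (intro generate_pairs assms generate.incl) (auto simp: S_def)
  ultimately show ?thesis by simp
qed

end

declare word_prod_Cons [simp del]

section \<open>Faces and flags of the mix\<close>

locale string_mix = reflexible_mix n Ps for n and Ps :: "('f ranked_poset \<times> 'f set) list" +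
  assumes n3: "3 \<le> n"
    and string: "string_words n (mix_word Ps)"
    and finite_words: "finite (mix_word Ps ` lists {..<n})"
begin

sublocale S: string_words n "mix_word Ps" by (rule string)

abbreviation omit :: "nat \<Rightarrow> nat list set" where
  "omit j \<equiv> lists ({..<n} - {j})"

lemma omit_lists: "w \<in> omit j \<Longrightarrow> w \<in> lists {..<n}"
  using lists_mono[of "{..<n} - {j}" "{..<n}"] by blast

text \<open>The \<open>j\<close>-face at the word \<open>u\<close>. For even \<open>u\<close> this is the coset of \<open>R u\<close>; odd words are admitted as well,
  because half of the flags of the mix have no common element in the rotation group.\<close>

definition fcoset :: "nat \<Rightarrow> nat list \<Rightarrow> (nat \<Rightarrow> 'f \<Rightarrow> 'f) set" where
  "fcoset j u = {R v | v. v \<in> even_words {..<n} \<and> (\<exists>w\<in>omit j. R v = R (w @ u))}"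

lemma fcoset_eqI:
  assumes u: "u \<in> lists {..<n}" "u' \<in> lists {..<n}" and w: "w \<in> omit j" "R u' = R (w @ u)"
  shows "fcoset j u' = fcoset j u"
proof -
  have wn: "w \<in> lists {..<n}" using w omit_lists by blast
  have ru: "R u = R (rev w @ u')"
  proof -
    have "R (rev w @ u') = R (rev w @ w @ u)" using S.cong_left[of "rev w" u' "w @ u"] w u wn by simp
    also have "\<dots> = R u" using S.drop_trivial[of "[]" "rev w @ w" u] S.rev_left[of w] u wn by simp
    finally show ?thesis by simp
  qed
  have sub: "fcoset j p \<subseteq> fcoset j q"
    if pq: "p \<in> lists {..<n}" "q \<in> lists {..<n}" "x \<in> omit j" "R p = R (x @ q)" for p q x
  proof
    fix y assume "y \<in> fcoset j p"
    then obtain v z where v: "y = R v" "v \<in> even_words {..<n}" "z \<in> omit j" "R v = R (z @ p)"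
      by (auto simp: fcoset_def)
    have "R (z @ p) = R (z @ x @ q)" using S.cong_left[of z p "x @ q"] pq v omit_lists by simp
    then have "z @ x \<in> omit j" "R v = R ((z @ x) @ q)" using v pq by simp_all
    then show "y \<in> fcoset j q" using v unfolding fcoset_def by blast
  qed
  have "rev w \<in> omit j" using w by simp
  then show ?thesis using sub[OF u(2) u(1) w] sub[OF u(1) u(2) _ ru] by blast
qed

lemma fcoset_cong: "u \<in> lists {..<n} \<Longrightarrow> u' \<in> lists {..<n} \<Longrightarrow> R u = R u' \<Longrightarrow> fcoset j u = fcoset j u'"
  by (rule fcoset_eqI[of u' u "[]"]) auto

text \<open>This needs a letter different from \<open>j\<close> and \<open>k\<close>, hence at least three letters.\<close>

lemma exists_even:
  assumes u: "u \<in> lists {..<n}"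
  shows "\<exists>a\<in>omit j \<inter> omit k. a @ u \<in> even_words {..<n}"
proof (cases "even (length u)")
  case True
  then show ?thesis using u by (intro bexI[of _ "[]"]) (auto simp: even_words_def)
next
  case False
  obtain i where i: "i < n" "i \<noteq> j" "i \<noteq> k"
  proof -
    have "\<exists>i<3. i \<noteq> j \<and> i \<noteq> k" by presburger
    then show thesis using that n3 by (meson less_le_trans)
  qed
  then show ?thesis using u False by (intro bexI[of _ "[i]"]) (auto simp: even_words_def)
qed

lemma fcoset_meet:
  assumes u: "u \<in> lists {..<n}" "u' \<in> lists {..<n}"
  shows "fcoset j u \<inter> fcoset k u' \<noteq> {} \<longleftrightarrow> (\<exists>w\<in>omit j. \<exists>w'\<in>omit k. R (w @ u) = R (w' @ u'))"
proof
  assume "fcoset j u \<inter> fcoset k u' \<noteq> {}"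
  then obtain y where y: "y \<in> fcoset j u" "y \<in> fcoset k u'" by blast
  from y(1) obtain w where "w \<in> omit j" "y = R (w @ u)" by (auto simp: fcoset_def)
  moreover from y(2) obtain w' where "w' \<in> omit k" "y = R (w' @ u')" by (auto simp: fcoset_def)
  ultimately show "\<exists>w\<in>omit j. \<exists>w'\<in>omit k. R (w @ u) = R (w' @ u')" by metis
next
  assume "\<exists>w\<in>omit j. \<exists>w'\<in>omit k. R (w @ u) = R (w' @ u')"
  then obtain w w' where w: "w \<in> omit j" "w' \<in> omit k" "R (w @ u) = R (w' @ u')" by blast
  note wn = omit_lists[OF w(1)] omit_lists[OF w(2)]
  obtain a where a: "a \<in> omit j" "a \<in> omit k" "a @ w @ u \<in> even_words {..<n}"
    using exists_even[of "w @ u" j k] u wn by auto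
  have "R (a @ w @ u) = R (a @ w' @ u')"
    using S.cong_left[of a "w @ u" "w' @ u'"] omit_lists[OF a(1)] w u wn by simp
  moreover have "a @ w \<in> omit j" "a @ w' \<in> omit k" using a w by simp_all
  ultimately have "R (a @ w @ u) \<in> fcoset j u" "R (a @ w @ u) \<in> fcoset k u'"
    using a(3) unfolding fcoset_def
    by (intro CollectI exI[of _ "a @ w @ u"] conjI bexI[of _ "a @ w"] bexI[of _ "a @ w'"]; simp)+
  then show "fcoset j u \<inter> fcoset k u' \<noteq> {}" by blast
qed

lemma fcoset_meet_self:
  assumes u: "u \<in> lists {..<n}" shows "fcoset j u \<inter> fcoset k u \<noteq> {}"
proof -
  have "\<exists>w\<in>omit j. \<exists>w'\<in>omit k. R (w @ u) = R (w' @ u)" by (intro bexI[of _ "[]"]) simp_all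
  then show ?thesis using fcoset_meet[OF u u] by blast
qed

lemma rcosets_eq:
  assumes j: "j < n"
  shows "rcosets\<^bsub>mix_group n Ps\<^esub> (mix_subgroup n Ps ({0..n - 1} - {j})) = fcoset j ` lists {..<n}"
proof -
  have I: "{0..n - 1} - {j} = {..<n} - {j}" using n3 by auto
  have sub: "mix_subgroup n Ps ({0..n - 1} - {j}) = R ` even_words ({..<n} - {j})"
    unfolding I by (rule mix_subgroup_eq) auto
  have coset: "(\<Union>h\<in>R ` even_words ({..<n} - {j}). {h \<otimes>\<^bsub>aut_product Ps\<^esub> R u}) = fcoset j u"
    if u: "u \<in> even_words {..<n}" for u
  proof (intro equalityI subsetI)
    have un: "u \<in> lists {..<n}" "even (length u)" using u by (auto simp: even_words_def)
    {
      fix x assume "x \<in> (\<Union>h\<in>R ` even_words ({..<n} - {j}). {h \<otimes>\<^bsub>aut_product Ps\<^esub> R u})"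
      then obtain w where w: "w \<in> even_words ({..<n} - {j})" "x = R w \<otimes>\<^bsub>aut_product Ps\<^esub> R u" by blast
      then have wo: "w \<in> omit j" "even (length w)" by (auto simp: even_words_def)
      have "x = R (w @ u)" using R_append[OF omit_lists[OF wo(1)] un(1)] w by simp
      moreover have "w @ u \<in> even_words {..<n}" using omit_lists[OF wo(1)] wo un by (simp add: even_words_def)
      ultimately show "x \<in> fcoset j u" unfolding fcoset_def using wo by blast
    }
    fix x assume "x \<in> fcoset j u"
    then obtain v w where v: "x = R v" "v \<in> even_words {..<n}" "w \<in> omit j" "R v = R (w @ u)"
      by (auto simp: fcoset_def)
    note wn = omit_lists[OF v(3)]
    have "even (length v) \<longleftrightarrow> even (length (w @ u))"
      using v un wn by (intro S.same_parity[OF S.parity]) (auto simp: even_words_def)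
    then have "w \<in> even_words ({..<n} - {j})" using v un by (auto simp: even_words_def)
    moreover have "x = R w \<otimes>\<^bsub>aut_product Ps\<^esub> R u" using R_append[OF wn un(1)] v by simp
    ultimately show "x \<in> (\<Union>h\<in>R ` even_words ({..<n} - {j}). {h \<otimes>\<^bsub>aut_product Ps\<^esub> R u})" by blast
  qed
  have "rcosets\<^bsub>mix_group n Ps\<^esub> (mix_subgroup n Ps ({0..n - 1} - {j})) = fcoset j ` even_words {..<n}"
    unfolding sub RCOSETS_def r_coset_def mix_group_eq using coset by auto
  also have "\<dots> = fcoset j ` lists {..<n}"
  proof (intro equalityI subsetI)
    fix y assume "y \<in> fcoset j ` lists {..<n}"
    then obtain u where u: "u \<in> lists {..<n}" "y = fcoset j u" by blast
    obtain a where a: "a \<in> omit j" "a @ u \<in> even_words {..<n}" using exists_even[OF u(1), of j j] by blast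
    have "fcoset j (a @ u) = fcoset j u" using a u by (intro fcoset_eqI[of _ _ a]) (auto simp: even_words_def)
    then show "y \<in> fcoset j ` even_words {..<n}" using a u(2) by (intro image_eqI[of _ _ "a @ u"]) simp_all
  qed (auto simp: even_words_def)
  finally show ?thesis .
qed

lemma faces_mix:
  "faces (mix n Ps) = {Least_Face, Greatest_Face} \<union> {Coset_Face j (fcoset j u) | j u. j < n \<and> u \<in> lists {..<n}}"
proof -
  have "{Coset_Face j A | j A. j < n \<and> A \<in> rcosets\<^bsub>mix_group n Ps\<^esub> (mix_subgroup n Ps ({0..n - 1} - {j}))}
      = {Coset_Face j A | j A. j < n \<and> A \<in> fcoset j ` lists {..<n}}"
    by (simp only: rcosets_eq cong: conj_cong)
  also have "\<dots> = {Coset_Face j (fcoset j u) | j u. j < n \<and> u \<in> lists {..<n}}" by blast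
  finally show ?thesis by (simp add: mix_def)
qed

definition word_flag :: "nat list \<Rightarrow> (nat \<Rightarrow> 'f \<Rightarrow> 'f) mix_face set" where
  "word_flag u = {Least_Face, Greatest_Face} \<union> (\<lambda>j. Coset_Face j (fcoset j u)) ` {..<n}"

lemma word_flag_chain:
  assumes u: "u \<in> lists {..<n}"
  shows "pred_on.chain (faces (mix n Ps)) (below (mix n Ps)) (word_flag u)"
proof -
  have pair: "F = G \<or> mix_below F G \<or> mix_below G F"
    if "F = Coset_Face j (fcoset j u)" "G = Coset_Face k (fcoset k u)" for F G j k
    using that fcoset_meet_self[OF u, of j k] fcoset_meet_self[OF u, of k j]
    by (cases j k rule: linorder_cases) simp_all
  have "F = G \<or> mix_below F G \<or> mix_below G F" if FG: "F \<in> word_flag u" "G \<in> word_flag u" for F G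
  proof -
    consider "F = Least_Face \<or> F = Greatest_Face \<or> G = Least_Face \<or> G = Greatest_Face"
      | j k where "F = Coset_Face j (fcoset j u)" "G = Coset_Face k (fcoset k u)"
      using FG unfolding word_flag_def by blast
    then show ?thesis
    proof cases
      case 1
      then show ?thesis by (cases F; cases G) auto
    qed (rule pair)
  qed
  moreover have "word_flag u \<subseteq> faces (mix n Ps)" unfolding faces_mix word_flag_def using u by auto
  ultimately show ?thesis unfolding pred_on.chain_def by (auto simp: mix_def)
qed

text \<open>Extending a common representative \<open>u\<close> of the faces of rank below \<open>k\<close> to the \<open>k\<close>-face: let \<open>m\<close>
  be the largest rank already treated. Incidence of the two faces gives a word \<open>w\<close> without the letter \<open>m\<close> that leads
  from \<open>u\<close> to the \<open>k\<close>-face. It splits into commuting words below and above \<open>m\<close>. The upper one fixes all faces of rank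
  at most \<open>m\<close>, the lower one fixes the \<open>k\<close>-face, so applying only the upper one to \<open>u\<close> yields a
  representative of all.\<close>

lemma chain_in_word_flag:
  assumes C: "pred_on.chain (faces (mix n Ps)) (below (mix n Ps)) C"
  shows "\<exists>u\<in>lists {..<n}. C \<subseteq> word_flag u"
proof -
  have sub: "C \<subseteq> faces (mix n Ps)"
    and comp: "\<And>F G. F \<in> C \<Longrightarrow> G \<in> C \<Longrightarrow> F = G \<or> mix_below F G \<or> mix_below G F"
    using C unfolding pred_on.chain_def by (auto simp: mix_def)
  define J where "J = {j. j < n \<and> (\<exists>u\<in>lists {..<n}. Coset_Face j (fcoset j u) \<in> C)}"
  obtain U where U: "\<And>j. j \<in> J \<Longrightarrow> U j \<in> lists {..<n} \<and> Coset_Face j (fcoset j (U j)) \<in> C"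
    using bchoice[of J "\<lambda>j u. u \<in> lists {..<n} \<and> Coset_Face j (fcoset j u) \<in> C"] unfolding J_def by auto
  have "\<exists>u\<in>lists {..<n}. \<forall>j\<in>J. j < k \<longrightarrow> fcoset j (U j) = fcoset j u" if "k \<le> n" for k
    using that
  proof (induction k)
    case 0
    show ?case by (rule bexI[of _ "[]"]) auto
  next
    case (Suc k)
    then obtain u where u: "u \<in> lists {..<n}" "\<forall>j\<in>J. j < k \<longrightarrow> fcoset j (U j) = fcoset j u" by auto
    consider "k \<notin> J" | "k \<in> J" "\<forall>j\<in>J. \<not> j < k" | "k \<in> J" "\<exists>j\<in>J. j < k" by blast
    then show ?case
    proof cases
      case 1
      then show ?thesis using u by (intro bexI[of _ u]) (auto elim: less_SucE)
    next
      case 2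
      then show ?thesis using U[of k] by (intro bexI[of _ "U k"]) (auto elim: less_SucE)
    next
      case 3
      define m where "m = Max {j \<in> J. j < k}"
      have "m \<in> {j \<in> J. j < k}" unfolding m_def using 3 by (intro Max_in) auto
      then have m: "m \<in> J" "m < k" by auto
      have m_max: "j \<le> m" if "j \<in> J" "j < k" for j unfolding m_def using that by (intro Max_ge) auto
      note Uk = U[OF 3(1)] and Um = U[OF m(1)]
      have mn: "m < n" "k < n" using m Suc.prems by auto
      have "mix_below (Coset_Face m (fcoset m (U m))) (Coset_Face k (fcoset k (U k)))"
        using comp[of "Coset_Face m (fcoset m (U m))" "Coset_Face k (fcoset k (U k))"] Uk Um m by auto
      then have "fcoset m u \<inter> fcoset k (U k) \<noteq> {}" using u(2) m by simp
      then obtain w w' where w: "w \<in> omit m" "w' \<in> omit k" "R (w @ u) = R (w' @ U k)"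
        using fcoset_meet[OF u(1), of "U k" m k] Uk by blast
      have split: "{..<n} - {m} = {..<m} \<union> {m<..<n}" using mn by auto
      have "\<exists>a\<in>lists {..<m}. \<exists>b\<in>lists {m<..<n}. R w = R (a @ b)"
      proof (rule S.split_commuting)
        fix x y assume "x \<in> {..<m}" "y \<in> {m<..<n}"
        then show "R [x, y] = R [y, x]" by (intro S.comm) auto
      qed (use mn w(1) split in auto)
      then obtain a b where ab: "a \<in> lists {..<m}" "b \<in> lists {m<..<n}" "R w = R (a @ b)" by blast
      have a_in: "a \<in> omit k" using ab(1) mn m by (intro subsetD[OF lists_mono ab(1)]) auto
      have b_in: "b \<in> omit j" if "j \<le> m" for j
        using that by (intro subsetD[OF lists_mono ab(2)]) auto
      have an: "a \<in> lists {..<n}" and bn: "b \<in> lists {..<n}" and wn: "w \<in> lists {..<n}" "w' \<in> lists {..<n}"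
        using omit_lists a_in b_in[of m] w by auto
      have bu: "b @ u \<in> lists {..<n}" using bn u by simp
      have "fcoset j (U j) = fcoset j (b @ u)" if "j \<in> J" "j < k" for j
      proof -
        have "fcoset j (b @ u) = fcoset j u"
          using m_max[OF that] b_in bu u(1) by (intro fcoset_eqI[of _ _ b]) auto
        then show ?thesis using u(2) that by simp
      qed
      moreover have "fcoset k (U k) = fcoset k (b @ u)"
      proof -
        have "R (a @ b @ u) = R (w' @ U k)"
          using S.cong_right[of w "a @ b" u] ab(3) an bn wn u w(3) by simp
        then have "R (rev a @ a @ b @ u) = R (rev a @ w' @ U k)"
          using S.cong_left[of "rev a" "a @ b @ u" "w' @ U k"] an bn wn u Uk by simp
        moreover have "R (rev a @ a @ b @ u) = R (b @ u)"
          using S.drop_trivial[of "[]" "rev a @ a" "b @ u"] S.rev_left[of a] an bu by simp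
        ultimately have "R (b @ u) = R ((rev a @ w') @ U k)" by simp
        then show ?thesis
          using a_in w(2) Uk bu by (intro fcoset_eqI[of _ _ "rev a @ w'", symmetric]) auto
      qed
      ultimately show ?thesis using bu by (intro bexI[of _ "b @ u"]) (auto elim: less_SucE)
    qed
  qed
  from this[OF order_refl] obtain u where u: "u \<in> lists {..<n}" "\<forall>j\<in>J. j < n \<longrightarrow> fcoset j (U j) = fcoset j u" by blast
  have "F \<in> word_flag u" if F: "F \<in> C" for F
  proof -
    have "F \<in> faces (mix n Ps)" using F sub by blast
    then consider "F = Least_Face" | "F = Greatest_Face"
      | j v where "F = Coset_Face j (fcoset j v)" "j < n" "v \<in> lists {..<n}"
      unfolding faces_mix by blast
    then show ?thesis
    proof cases
      case 3
      then have j: "j \<in> J" using F unfolding J_def by blast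
      then have "F = Coset_Face j (fcoset j (U j))" using comp[OF F, of "Coset_Face j (fcoset j (U j))"] U[OF j] 3 by auto
      then show ?thesis using u(2) j 3 unfolding word_flag_def by auto
    qed (auto simp: word_flag_def)
  qed
  then show ?thesis using u(1) by blast
qed

lemma word_flag_inject:
  assumes u: "u \<in> lists {..<n}" "u' \<in> lists {..<n}" and sub: "word_flag u \<subseteq> word_flag u'"
  shows "R u = R u'"
proof -
  have "\<exists>v\<in>omit j. R (u @ rev u') = R v" if j: "j < n" for j
  proof -
    have "Coset_Face j (fcoset j u) \<in> word_flag u'" using sub j unfolding word_flag_def by blast
    then have "fcoset j u = fcoset j u'" unfolding word_flag_def by auto
    moreover have "fcoset j u \<inter> fcoset j u \<noteq> {}" by (rule fcoset_meet_self[OF u(1)])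
    ultimately obtain w w' where w: "w \<in> omit j" "w' \<in> omit j" "R (w @ u) = R (w' @ u')"
      using fcoset_meet[OF u, of j j] by auto
    note wn = omit_lists[OF w(1)] omit_lists[OF w(2)]
    have "R (rev w @ (w @ u) @ rev u') = R (rev w @ (w' @ u') @ rev u')"
      using w(3) wn u by (intro S.cong[of "rev w" "w @ u" "w' @ u'" "rev u'"]) simp_all
    moreover have "R (rev w @ (w @ u) @ rev u') = R (u @ rev u')"
      using S.drop_trivial[of "[]" "rev w @ w" "u @ rev u'"] S.rev_left[of w] wn u by simp
    moreover have "R (rev w @ (w' @ u') @ rev u') = R (rev w @ w')"
      using S.drop_trivial[of "rev w @ w'" "u' @ rev u'" "[]"] S.rev_right[of u'] wn u by simp
    ultimately show ?thesis using w(1,2) by (intro bexI[of _ "rev w @ w'"]) simp_all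
  qed
  then have "R (u @ rev u') = R []" using u by (intro S.inter) simp_all
  then show ?thesis using S.eq_iff_rev[OF u] by simp
qed

lemma flags_mix: "flags (mix n Ps) = word_flag ` lists {..<n}"
proof (intro equalityI subsetI)
  fix C assume "C \<in> flags (mix n Ps)"
  then have C: "pred_on.chain (faces (mix n Ps)) (below (mix n Ps)) C"
    and max: "\<nexists>S. pred_on.chain (faces (mix n Ps)) (below (mix n Ps)) S \<and> C \<subset> S"
    unfolding flags_def pred_on.maxchain_def by auto
  obtain u where "u \<in> lists {..<n}" "C \<subseteq> word_flag u" using chain_in_word_flag[OF C] by blast
  then show "C \<in> word_flag ` lists {..<n}" using max word_flag_chain[of u] by blast
next
  fix C assume "C \<in> word_flag ` lists {..<n}"
  then obtain u where u: "u \<in> lists {..<n}" "C = word_flag u" by blast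
  have "\<not> word_flag u \<subset> S" if S: "pred_on.chain (faces (mix n Ps)) (below (mix n Ps)) S" for S
  proof
    assume less: "word_flag u \<subset> S"
    obtain u' where u': "u' \<in> lists {..<n}" "S \<subseteq> word_flag u'" using chain_in_word_flag[OF S] by blast
    then have "R u = R u'" using word_flag_inject[OF u(1) u'(1)] less by blast
    then have "word_flag u = word_flag u'" unfolding word_flag_def using fcoset_cong[OF u(1) u'(1)] by auto
    then show False using less u' by blast
  qed
  then show "C \<in> flags (mix n Ps)"
    using word_flag_chain[OF u(1)] unfolding flags_def pred_on.maxchain_def u(2) by blast
qed

lemma card_flags_mix: "card (flags (mix n Ps)) = card (R ` lists {..<n})"
  unfolding flags_mix
proof (rule card_image_cong_kernel)
  fix u v assume uv: "u \<in> lists {..<n}" "v \<in> lists {..<n}"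
  show "word_flag u = word_flag v \<longleftrightarrow> R u = R v"
  proof
    assume "R u = R v"
    then show "word_flag u = word_flag v" unfolding word_flag_def using fcoset_cong[OF uv] by auto
  qed (use word_flag_inject[OF uv] in auto)
qed

lemma card_faces_mix:
  assumes k: "k < n"
  shows "card (k_faces (mix n Ps) (int k)) * (card (R ` lists {..<k}) * card (R ` lists {k<..<n}))
    = card (R ` lists {..<n})"
proof -
  let ?M = "mix_group n Ps" and ?H = "mix_subgroup n Ps ({0..n - 1} - {k})"
  have I: "{0..n - 1} - {k} = {..<n} - {k}" using n3 by auto
  have H: "?H = R ` even_words ({..<n} - {k})" unfolding I by (rule mix_subgroup_eq) auto
  have "k_faces (mix n Ps) (int k) = Coset_Face k ` (rcosets\<^bsub>?M\<^esub> ?H)"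
    using k unfolding k_faces_def by (auto simp: mix_def)
  then have faces: "card (k_faces (mix n Ps) (int k)) = card (rcosets\<^bsub>?M\<^esub> ?H)"
    by (simp add: card_image inj_on_def)
  have sub: "subgroup (R ` even_words {..<n}) (aut_product Ps)" by (rule even_subgroup) auto
  interpret M: group ?M
    unfolding mix_group_eq using subgroup.subgroup_is_group[OF sub is_group] .
  have "subgroup ?H ?M" unfolding H mix_group_eq
  proof (rule subgroup_incl[OF even_subgroup sub])
    show "R ` even_words ({..<n} - {k}) \<subseteq> R ` even_words {..<n}"
      using lists_mono[of "{..<n} - {k}" "{..<n}"] by (intro image_mono) (auto simp: even_words_def)
  qed auto
  then have "card (rcosets\<^bsub>?M\<^esub> ?H) * card ?H = order ?M" by (rule M.lagrange)
  then have 1: "card (k_faces (mix n Ps) (int k)) * card (R ` even_words ({..<n} - {k})) = card (R ` even_words {..<n})"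
    unfolding faces H by (simp add: order_def mix_group_eq)
  have 2: "card (R ` lists {..<n}) = 2 * card (R ` even_words {..<n})"
    using finite_words n3 by (intro S.card_double_even S.parity) (auto simp: lessThan_empty_iff)
  interpret K: word_map "{..<n} - {k}" R by (rule S.restrict) auto
  have "(if k = 0 then 1 else 0) \<in> {..<n} - {k}" using n3 by auto
  then have "{..<n} - {k} \<noteq> {}" by blast
  then have 3: "card (R ` omit k) = 2 * card (R ` even_words ({..<n} - {k}))"
    using omit_lists by (intro K.card_double_even S.parity finite_subset[OF image_mono finite_words]) blast+
  show ?thesis using 1 unfolding S.card_omit_letter[OF k, symmetric] 2 3 by simp
qed

end

section \<open>Flags and automorphisms of simplicial lattices\<close>

lemma maxchain_mem:
  assumes "pred_on.maxchain L (\<subset>) C" "A \<in> L" "\<And>U. U \<in> C \<Longrightarrow> A \<subseteq> U \<or> U \<subseteq> A"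
  shows "A \<in> C"
proof (rule ccontr)
  assume A: "A \<notin> C"
  have "pred_on.chain L (\<subset>) (insert A C)"
    using assms unfolding pred_on.maxchain_def pred_on.chain_def by (auto simp: psubset_eq)
  then show False using assms(1) A unfolding pred_on.maxchain_def by blast
qed

text \<open>Only comparability is preserved, not the order itself, so that dual lattices are covered.\<close>

lemma maxchain_image:
  assumes c: "bij_betw c L F"
    and comp: "\<And>A B. A \<in> L \<Longrightarrow> B \<in> L \<Longrightarrow> (lt (c A) (c B) \<or> lt (c B) (c A)) \<longleftrightarrow> (A \<subset> B \<or> B \<subset> A)"
    and max: "pred_on.maxchain F lt D"
  shows "\<exists>C. pred_on.maxchain L (\<subset>) C \<and> D = c ` C"
proof -
  have inj: "inj_on c L" and im: "c ` L = F" using c by (auto simp: bij_betw_def)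
  have chain_iff: "pred_on.chain F lt (c ` C) \<longleftrightarrow> pred_on.chain L (\<subset>) C" if CL: "C \<subseteq> L" for C
  proof -
    have eq: "(lt\<^sup>=\<^sup>= (c A) (c B) \<or> lt\<^sup>=\<^sup>= (c B) (c A)) \<longleftrightarrow> ((\<subset>)\<^sup>=\<^sup>= A B \<or> (\<subset>)\<^sup>=\<^sup>= B A)" if "A \<in> C" "B \<in> C" for A B
    proof -
      have "A \<in> L" "B \<in> L" using that CL by auto
      then show ?thesis using comp[of A B] inj_on_eq_iff[OF inj] by auto
    qed
    have "c ` C \<subseteq> F" using CL im by blast
    then show ?thesis using CL unfolding pred_on.chain_def
      by (simp only: ball_simps simp_thms) (intro ball_cong refl eq)
  qed
  define C where "C = {A \<in> L. c A \<in> D}"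
  have D: "pred_on.chain F lt D" "\<And>S. pred_on.chain F lt S \<Longrightarrow> \<not> D \<subset> S"
    using max by (auto simp: pred_on.maxchain_def)
  then have "D \<subseteq> F" by (simp add: pred_on.chain_def)
  then have DC: "D = c ` C" unfolding C_def using im by auto
  have CL: "C \<subseteq> L" by (auto simp: C_def)
  have "\<not> C \<subset> S" if S: "pred_on.chain L (\<subset>) S" for S
  proof
    assume less: "C \<subset> S"
    have SL: "S \<subseteq> L" using S by (simp add: pred_on.chain_def)
    then have "c ` C \<subset> c ` S" using less inj_on_image_eq_iff[OF inj CL SL] by blast
    moreover have "pred_on.chain F lt (c ` S)" using chain_iff[OF SL] S by blast
    ultimately show False using D(2) DC by blast
  qed
  then have "pred_on.maxchain L (\<subset>) C"
    using D(1) chain_iff[OF CL] DC unfolding pred_on.maxchain_def by blast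
  then show ?thesis using DC by blast
qed

lemma poset_aut_flag:
  assumes f: "f \<in> poset_aut P" and \<Phi>: "\<Phi> \<in> flags P" shows "f ` \<Phi> \<in> flags P"
proof -
  have bij: "bij_betw f (faces P) (faces P)"
    and ord: "\<And>F G. F \<in> faces P \<Longrightarrow> G \<in> faces P \<Longrightarrow> below P (f F) (f G) \<longleftrightarrow> below P F G"
    using f by (auto simp: poset_aut_def Bij_def)
  have inj: "inj_on f (faces P)" and im: "f ` faces P = faces P" using bij by (auto simp: bij_betw_def)
  have chain_iff: "pred_on.chain (faces P) (below P) (f ` C) \<longleftrightarrow> pred_on.chain (faces P) (below P) C"
    if CL: "C \<subseteq> faces P" for C
  proof -
    have eq: "(below P)\<^sup>=\<^sup>= (f A) (f B) \<longleftrightarrow> (below P)\<^sup>=\<^sup>= A B" if "A \<in> C" "B \<in> C" for A B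
    proof -
      have "A \<in> faces P" "B \<in> faces P" using that CL by auto
      then show ?thesis using ord[of A B] inj_on_eq_iff[OF inj] by auto
    qed
    have "f ` C \<subseteq> faces P" using CL im by blast
    then show ?thesis using CL unfolding pred_on.chain_def
      by (simp only: ball_simps simp_thms) (intro ball_cong refl arg_cong2[of _ _ _ _ "(\<or>)"] eq)
  qed
  have \<Phi>c: "pred_on.chain (faces P) (below P) \<Phi>" "\<And>S. pred_on.chain (faces P) (below P) S \<Longrightarrow> \<not> \<Phi> \<subset> S"
    using \<Phi> by (auto simp: flags_def pred_on.maxchain_def)
  then have sub: "\<Phi> \<subseteq> faces P" by (simp add: pred_on.chain_def)
  have "\<not> f ` \<Phi> \<subset> S" if S: "pred_on.chain (faces P) (below P) S" for S
  proof
    assume less: "f ` \<Phi> \<subset> S"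
    have "S \<subseteq> faces P" using S by (simp add: pred_on.chain_def)
    then obtain T where T: "T \<subseteq> faces P" "S = f ` T" using im by (metis subset_image_iff)
    then have "\<Phi> \<subset> T" using less inj_on_image_subset_iff[OF inj sub T(1)] by blast
    moreover have "pred_on.chain (faces P) (below P) T" using chain_iff[OF T(1)] S T by blast
    ultimately show False using \<Phi>c(2) by blast
  qed
  then show ?thesis using \<Phi>c(1) chain_iff[OF sub] by (auto simp: flags_def pred_on.maxchain_def)
qed

definition prefix_chain :: "nat \<Rightarrow> 'v set \<Rightarrow> (nat \<Rightarrow> 'v) \<Rightarrow> 'v set set" where
  "prefix_chain n V p = insert V ((\<lambda>k. p ` {..<k}) ` {..n})"

text \<open>The proper members of \<open>L\<close> form a simplicial complex all of whose maximal simplices have \<open>n\<close> vertices; the vertex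
  set itself is added as greatest element. It has more than \<open>n\<close> elements, so it is not a simplex of the complex.\<close>

locale pure_complex =
  fixes n :: nat and V :: "'v set" and L :: "'v set set"
  assumes n1: "1 \<le> n" and fin: "finite V" and sub: "A \<in> L \<Longrightarrow> A \<subseteq> V" and top: "V \<in> L"
    and down: "\<lbrakk>A \<in> L; A \<noteq> V; B \<subseteq> A\<rbrakk> \<Longrightarrow> B \<in> L"
    and single: "x \<in> V \<Longrightarrow> {x} \<in> L"
    and card_le: "\<lbrakk>A \<in> L; A \<noteq> V\<rbrakk> \<Longrightarrow> card A \<le> n"
    and nV: "n < card V"
    and ext: "\<lbrakk>A \<in> L; card A < n\<rbrakk> \<Longrightarrow> \<exists>x\<in>V - A. insert x A \<in> L"
begin

lemma fin_L: "A \<in> L \<Longrightarrow> finite A"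
  using sub fin by (meson finite_subset)

lemma not_top: "card A \<le> n \<Longrightarrow> A \<noteq> V"
  using nV by auto

lemma empty_L: "{} \<in> L"
proof -
  have "V \<noteq> {}" using nV by auto
  then obtain x where "x \<in> V" by blast
  moreover have "{x} \<noteq> V" using n1 by (intro not_top) simp
  ultimately show ?thesis using down[OF single, of x "{}"] by simp
qed

text \<open>Above a member \<open>S\<close> of a maximal chain with less than \<open>n\<close> elements, let \<open>T\<close> be the next
  one. Some \<open>insert x S\<close> lies in \<open>L\<close> and below \<open>T\<close>, hence is comparable to the whole chain and belongs to it.\<close>

lemma maxchain_enum:
  assumes C: "pred_on.maxchain L (\<subset>) C"
  shows "\<exists>q. inj_on q {..<n} \<and> q ` {..<n} \<in> L \<and> C = prefix_chain n V q"
proof -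
  have CL: "C \<subseteq> L" and total: "\<And>A B. A \<in> C \<Longrightarrow> B \<in> C \<Longrightarrow> A \<subseteq> B \<or> B \<subseteq> A"
    using C unfolding pred_on.maxchain_def pred_on.chain_def by (auto simp: psubset_eq)
  have VC: "V \<in> C" using CL sub by (intro maxchain_mem[OF C top]) blast
  have "\<exists>q. inj_on q {..<k} \<and> (\<forall>j\<le>k. q ` {..<j} \<in> C)" if "k \<le> n" for k
    using that
  proof (induction k)
    case 0
    have "{} \<in> C" by (intro maxchain_mem[OF C empty_L]) simp
    then show ?case by simp
  next
    case (Suc k)
    then obtain q where q: "inj_on q {..<k}" "\<forall>j\<le>k. q ` {..<j} \<in> C" by auto
    define S where "S = q ` {..<k}"
    have S: "S \<in> C" "S \<in> L" "card S = k" using q CL by (auto simp: S_def card_image)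
    have SV: "S \<noteq> V" using S Suc.prems by (intro not_top) simp
    have "V \<in> C \<and> S \<subset> V" using VC SV sub[OF S(2)] by blast
    then obtain T where T: "T \<in> C" "S \<subset> T" and min: "\<And>U. U \<in> C \<Longrightarrow> S \<subset> U \<Longrightarrow> card T \<le> card U"
      using ex_has_least_nat[of "\<lambda>T. T \<in> C \<and> S \<subset> T" V card] by auto
    have T_le: "T \<subseteq> U" if U: "U \<in> C" "S \<subset> U" for U
    proof (rule ccontr)
      assume "\<not> T \<subseteq> U"
      then have "U \<subset> T" using total[OF T(1) U(1)] by blast
      then have "card U < card T" using T(1) CL fin_L by (intro psubset_card_mono) auto
      then show False using min[OF U] by simp
    qed
    obtain x where x: "x \<notin> S" "x \<in> T" "insert x S \<in> L"
    proof (cases "T = V")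
      case True
      then show thesis using ext[OF S(2)] S(3) Suc.prems that by auto
    next
      case False
      obtain x where "x \<in> T" "x \<notin> S" using T by blast
      then show thesis using that down[of T "insert x S"] False T CL by blast
    qed
    have "insert x S \<in> C"
    proof (rule maxchain_mem[OF C x(3)])
      fix U assume U: "U \<in> C"
      then show "insert x S \<subseteq> U \<or> U \<subseteq> insert x S"
        using total[OF U S(1)] T_le[OF U] x by blast
    qed
    moreover have im: "(q(k := x)) ` {..<j} = (if j \<le> k then q ` {..<j} else insert x S)" if "j \<le> Suc k" for j
      using that by (cases "j = Suc k") (auto simp: S_def lessThan_Suc image_iff)
    ultimately have "\<forall>j\<le>Suc k. (q(k := x)) ` {..<j} \<in> C" using q(2) by simp
    moreover have "inj_on (q(k := x)) {..<Suc k}"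
      using q(1) x(1) by (auto simp: inj_on_def S_def lessThan_Suc)
    ultimately show ?case by blast
  qed
  from this[OF order_refl] obtain q where q: "inj_on q {..<n}" "\<forall>j\<le>n. q ` {..<j} \<in> C" by blast
  have "C = prefix_chain n V q"
  proof (intro equalityI subsetI)
    fix U assume U: "U \<in> C"
    show "U \<in> prefix_chain n V q"
    proof (cases "U = V")
      case False
      then have k: "card U \<le> n" using U CL card_le by blast
      have "inj_on q {..<card U}" using q(1) k by (meson inj_on_subset lessThan_subset_iff)
      then have "card (q ` {..<card U}) = card U" by (simp add: card_image)
      moreover have "U \<subseteq> q ` {..<card U} \<or> q ` {..<card U} \<subseteq> U" using total[OF U] q(2) k by blast
      moreover have "finite U" "finite (q ` {..<card U})" using U CL fin_L by auto
      ultimately have "U = q ` {..<card U}" by (metis card_subset_eq)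
      then show ?thesis using k unfolding prefix_chain_def by blast
    qed (simp add: prefix_chain_def)
  qed (use q(2) VC in \<open>auto simp: prefix_chain_def\<close>)
  then show ?thesis using q CL by blast
qed

end

text \<open>A simplicial lattice with standard flag \<open>p 0, p 1, \<dots>\<close> and symmetries \<open>s k\<close> that move only
  its member with \<open>k + 1\<close> elements. The assumption \<open>thin\<close> is the diamond condition at the top; at the other
  ranks it holds for any lattice of sets.\<close>

locale simplicial_model = pure_complex n V L
  for n and V :: "'v set" and L :: "'v set set" +
  fixes s :: "nat \<Rightarrow> 'v \<Rightarrow> 'v" and p :: "nat \<Rightarrow> 'v"
  assumes p_inj: "inj_on p {..<n}" and p_L: "p ` {..<n} \<in> L"
    and s_invol: "k < n \<Longrightarrow> s k (s k x) = x"
    and s_outside: "k < n \<Longrightarrow> x \<notin> V \<Longrightarrow> s k x = x"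
    and s_L: "k < n \<Longrightarrow> A \<in> L \<Longrightarrow> s k ` A \<in> L"
    and s_fix: "\<lbrakk>k < n; j \<le> n; j \<noteq> Suc k\<rbrakk> \<Longrightarrow> s k ` p ` {..<j} = p ` {..<j}"
    and s_move: "k < n \<Longrightarrow> s k (p k) \<noteq> p k"
    and thin: "\<lbrakk>x \<in> V; x \<notin> p ` {..<n - 1}; insert x (p ` {..<n - 1}) \<in> L\<rbrakk>
      \<Longrightarrow> x = p (n - 1) \<or> x = s (n - 1) (p (n - 1))"
    and rigid: "\<lbrakk>bij_betw w V V; \<And>A. A \<in> L \<Longrightarrow> w ` A \<in> L; \<And>j. j < n \<Longrightarrow> w (p j) = p j; x \<in> V\<rbrakk>
      \<Longrightarrow> w x = x"
begin

abbreviation "S k \<equiv> p ` {..<k}"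

lemma S_L: "k \<le> n \<Longrightarrow> S k \<in> L"
  using down[OF p_L not_top image_mono, of "{..<k}"] p_inj by (simp add: card_image)

lemma card_S: "k \<le> n \<Longrightarrow> card (S k) = k"
  using inj_on_subset[OF p_inj, of "{..<k}"] by (simp add: card_image)

lemma S_not_top: "k \<le> n \<Longrightarrow> S k \<noteq> V"
  by (intro not_top) (simp add: card_S)

lemma chain_L: "A \<in> prefix_chain n V p \<Longrightarrow> A \<in> L"
  using S_L top by (auto simp: prefix_chain_def)

text \<open>An order automorphism that maps the standard chain to itself fixes it elementwise, since the chain is finite. It
  permutes the atoms and is determined by this permutation \<open>w\<close> of the vertices; \<open>w\<close> fixes the differences
  \<open>p j\<close> of consecutive members of the chain.\<close>

lemma lattice_rigid:
  assumes h: "bij_betw h L L" and ord: "\<And>A B. A \<in> L \<Longrightarrow> B \<in> L \<Longrightarrow> h A \<subset> h B \<longleftrightarrow> A \<subset> B"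
    and chain: "h ` prefix_chain n V p = prefix_chain n V p" and A: "A \<in> L"
  shows "h A = A"
proof -
  have inj: "inj_on h L" and hL: "\<And>A. A \<in> L \<Longrightarrow> h A \<in> L" using h by (auto simp: bij_betw_def)
  have ord': "h A \<subseteq> h B \<longleftrightarrow> A \<subseteq> B" if "A \<in> L" "B \<in> L" for A B
    using ord[OF that] inj_on_eq_iff[OF inj that] by (auto simp: psubset_eq)
  have total: "A \<subseteq> B \<or> B \<subseteq> A" if "A \<in> prefix_chain n V p" "B \<in> prefix_chain n V p" for A B
  proof -
    have "S j \<subseteq> V" if "j \<le> n" for j using sub S_L that by blast
    moreover have "S j \<subseteq> S k \<or> S k \<subseteq> S j" for j k by (cases j k rule: le_cases) auto
    ultimately show ?thesis using that unfolding prefix_chain_def by blast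
  qed
  have fix_chain: "h A = A" if "A \<in> prefix_chain n V p" for A
    using that
  proof (induction "card A" arbitrary: A rule: less_induct)
    case less
    have IH: "h B = B" if "B \<in> prefix_chain n V p" "B \<subset> A" for B
      using less.hyps[of B] that psubset_card_mono[OF fin_L[OF chain_L[OF less.prems]]] by blast
    have AL: "A \<in> L" and hA: "h A \<in> prefix_chain n V p" using chain_L less.prems chain by auto
    obtain B where B: "B \<in> prefix_chain n V p" "h B = A" using less.prems chain by (metis imageE)
    show ?case
    proof (rule ccontr)
      assume ne: "h A \<noteq> A"
      consider "h A \<subset> A" | "A \<subset> h A" using total[OF hA less.prems] ne by blast
      then show False
      proof cases
        case 1
        then have "h (h A) = h A" by (rule IH[OF hA])
        then show False using inj_on_eq_iff[OF inj hL[OF AL] AL] ne by simp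
      next
        case 2
        then have "B \<subset> A" using B(2) ord[OF chain_L[OF B(1)] AL] by simp
        then have "h B = B" by (rule IH[OF B(1)])
        then show False using B(2) \<open>B \<subset> A\<close> by simp
      qed
    qed
  qed
  have h_empty: "h {} = {}" using fix_chain[of "{}"] by (auto simp: prefix_chain_def image_iff intro!: bexI[of _ 0])
  have h_inv: "\<exists>B\<in>L. h B = A" if "A \<in> L" for A using h that unfolding bij_betw_def by (metis imageE)
  have "\<exists>y\<in>V. h {x} = {y}" if x: "x \<in> V" for x
  proof -
    have xL: "{x} \<in> L" by (rule single[OF x])
    have "h {x} \<noteq> {}" using inj_on_eq_iff[OF inj xL empty_L] h_empty by auto
    then obtain y where y: "y \<in> h {x}" by blast
    have yV: "y \<in> V" using y sub[OF hL[OF xL]] by blast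
    obtain B where B: "B \<in> L" "h B = {y}" using h_inv[OF single[OF yV]] by blast
    have "B \<subseteq> {x}" using ord'[OF B(1) xL] B(2) y by simp
    moreover have "B \<noteq> {}" using B(2) h_empty by auto
    ultimately have "B = {x}" by blast
    then show ?thesis using B(2) yV by blast
  qed
  then obtain w where w: "\<And>x. x \<in> V \<Longrightarrow> w x \<in> V \<and> h {x} = {w x}" by metis
  have h_image: "h A = w ` A" if A: "A \<in> L" for A
  proof (intro equalityI subsetI)
    fix y assume y: "y \<in> h A"
    then have yV: "y \<in> V" using sub[OF hL[OF A]] by blast
    obtain B where B: "B \<in> L" "h B = {y}" using h_inv[OF single[OF yV]] by blast
    have "B \<noteq> {}" using B(2) h_empty by auto
    then obtain x where x: "x \<in> B" by blast
    then have "x \<in> V" using sub[OF B(1)] by blast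
    have "B \<subseteq> A" using ord'[OF B(1) A] B(2) y by simp
    moreover have "{w x} \<subseteq> {y}" using ord'[OF single[OF \<open>x \<in> V\<close>] B(1)] x B(2) w[OF \<open>x \<in> V\<close>] by simp
    ultimately show "y \<in> w ` A" using x by blast
  next
    fix y assume "y \<in> w ` A"
    then obtain x where x: "x \<in> A" "y = w x" by blast
    then have "x \<in> V" using sub[OF A] by blast
    then have "h {x} \<subseteq> h A" using ord'[OF single A, of x] x by simp
    then show "y \<in> h A" using w[OF \<open>x \<in> V\<close>] x by simp
  qed
  have w_inj: "inj_on w V"
  proof (rule inj_onI)
    fix x y assume xy: "x \<in> V" "y \<in> V" "w x = w y"
    then have "h {x} = h {y}" using w by simp
    then show "x = y" using inj_on_eq_iff[OF inj single single] xy by auto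
  qed
  have "w ` V \<subseteq> V" using w by blast
  then have w_bij: "bij_betw w V V" using w_inj endo_inj_surj[OF fin] by (simp add: bij_betw_def)
  have w_p: "w (p j) = p j" if j: "j < n" for j
  proof -
    have im: "w ` S k = S k" if "k \<le> n" for k
      using fix_chain[of "S k"] h_image[OF S_L[OF that]] that by (simp add: prefix_chain_def)
    have SV: "S (Suc j) \<subseteq> V" using sub S_L j by (meson Suc_leI)
    have pV: "p j \<in> V" using SV by auto
    have notS: "p j \<notin> S j" using inj_onD[OF p_inj, of j] j by fastforce
    have "w (p j) \<in> S (Suc j)" using im[of "Suc j"] j by (metis Suc_leI imageI lessI lessThan_iff)
    moreover have "w (p j) \<notin> S j"
    proof
      assume "w (p j) \<in> S j"
      then have "w (p j) \<in> w ` S j" using im[of j] j by simp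
      moreover have "S j \<subseteq> V" using j by (intro sub S_L) simp
      ultimately show False using notS inj_on_image_mem_iff[OF w_inj pV, of "S j"] by simp
    qed
    ultimately show ?thesis by (auto simp: lessThan_Suc)
  qed
  have "w ` A \<in> L" if "A \<in> L" for A using h_image[OF that] hL[OF that] by simp
  then have "w x = x" if "x \<in> V" for x using rigid[OF w_bij _ w_p that] by blast
  then have "w ` A = A" using sub[OF A] by (auto simp: image_iff subset_iff)
  then show ?thesis using h_image[OF A] by simp
qed

end

text \<open>A ranked poset with an isomorphism \<open>c\<close>, or an anti-isomorphism if \<open>dual\<close> holds, from a simplicial
  lattice; its base flag is the image of the standard chain.\<close>

locale modelled_polytope = simplicial_model n V L s p
  for n and V :: "'v set" and L s p +
  fixes P :: "'f ranked_poset" and c :: "'v set \<Rightarrow> 'f" and dual :: bool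
  assumes c_bij: "bij_betw c L (faces P)"
    and c_below: "\<lbrakk>A \<in> L; B \<in> L\<rbrakk> \<Longrightarrow> below P (c A) (c B) \<longleftrightarrow> (if dual then B \<subset> A else A \<subset> B)"
    and c_rank: "A \<in> L \<Longrightarrow> face_rank P (c A) =
      (if dual then (if A = V then -1 else int n - int (card A))
       else (if A = V then int n else int (card A) - 1))"
    and flag: "c ` prefix_chain n V p \<in> flags P"
begin

abbreviation "\<Phi> \<equiv> c ` prefix_chain n V p"

text \<open>The number of the symmetry \<open>s k\<close> that changes the face of rank \<open>i\<close>.\<close>

definition idx :: "nat \<Rightarrow> nat" where
  "idx i = (if dual then n - Suc i else i)"

lemma idx_less: "i < n \<Longrightarrow> idx i < n"
  by (auto simp: idx_def)

definition W :: "('v \<Rightarrow> 'v) set" where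
  "W = {w. bij_betw w V V \<and> (\<forall>A\<in>L. w ` A \<in> L)}"

text \<open>The automorphism of the poset induced by a symmetry of the vertex set.\<close>

definition \<theta> :: "('v \<Rightarrow> 'v) \<Rightarrow> 'f \<Rightarrow> 'f" where
  "\<theta> w = (\<lambda>F\<in>faces P. c (w ` inv_into L c F))"

lemma c_face: "A \<in> L \<Longrightarrow> c A \<in> faces P"
  using c_bij by (auto simp: bij_betw_def)

lemma c_inj: "inj_on c L"
  using c_bij by (auto simp: bij_betw_def)

lemma faceE: assumes "F \<in> faces P" obtains A where "A \<in> L" "F = c A"
  using assms c_bij by (auto simp: bij_betw_def)

lemma \<theta>_c: "A \<in> L \<Longrightarrow> \<theta> w (c A) = c (w ` A)"
  using c_inj by (simp add: \<theta>_def c_face)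

lemma W_bij: assumes w: "w \<in> W" shows "bij_betw ((`) w) L L"
proof -
  have inj: "inj_on w V" and im: "\<And>A. A \<in> L \<Longrightarrow> w ` A \<in> L" using w by (auto simp: W_def bij_betw_def)
  have "inj_on ((`) w) L"
    using inj_on_image_eq_iff[OF inj] sub by (intro inj_onI) blast
  moreover have "finite L" using sub fin by (intro finite_subset[of L "Pow V"]) auto
  ultimately show ?thesis using endo_inj_surj[of L "(`) w"] im unfolding bij_betw_def by blast
qed

lemma W_psubset: assumes w: "w \<in> W" and A: "A \<in> L" "B \<in> L" shows "w ` A \<subset> w ` B \<longleftrightarrow> A \<subset> B"
proof -
  have inj: "inj_on w V" using w by (auto simp: W_def bij_betw_def)
  show ?thesis
    using inj_on_image_subset_iff[OF inj sub[OF A(1)] sub[OF A(2)]] inj_on_image_eq_iff[OF inj sub[OF A(1)] sub[OF A(2)]]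
    by (simp add: psubset_eq)
qed

lemma \<theta>_aut: assumes w: "w \<in> W" shows "\<theta> w \<in> poset_aut P"
proof -
  have wL: "\<And>A. A \<in> L \<Longrightarrow> w ` A \<in> L" using w by (auto simp: W_def)
  have "bij_betw (c \<circ> (`) w \<circ> inv_into L c) (faces P) (faces P)"
    using c_bij bij_betw_inv_into[OF c_bij] W_bij[OF w] by (blast intro: bij_betw_trans)
  then have "bij_betw (\<theta> w) (faces P) (faces P)" by (rule bij_betw_cong[THEN iffD1, rotated]) (simp add: \<theta>_def)
  moreover have "below P (\<theta> w F) (\<theta> w G) \<longleftrightarrow> below P F G" if FG: "F \<in> faces P" "G \<in> faces P" for F G
  proof -
    obtain A B where "A \<in> L" "F = c A" "B \<in> L" "G = c B" using FG by (elim faceE)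
    then show ?thesis by (simp add: \<theta>_c c_below wL W_psubset[OF w])
  qed
  ultimately show ?thesis by (simp add: poset_aut_def Bij_def \<theta>_def)
qed

lemma s_W: assumes k: "k < n" shows "s k \<in> W"
proof -
  have V: "s k ` V \<subseteq> V" using sub[OF s_L[OF k top]] .
  have "inj_on (s k) V" by (rule inj_on_inverseI[of _ "s k"]) (rule s_invol[OF k])
  then have "bij_betw (s k) V V" using endo_inj_surj[OF fin V] by (simp add: bij_betw_def)
  then show ?thesis using s_L[OF k] by (simp add: W_def)
qed

lemma id_W: "id \<in> W" by (simp add: W_def)

lemma comp_W: "u \<in> W \<Longrightarrow> v \<in> W \<Longrightarrow> u \<circ> v \<in> W"
  unfolding W_def by (auto intro: bij_betw_trans simp only: image_comp[symmetric])

lemma \<theta>_id: "\<theta> id = \<one>\<^bsub>AutPoset P\<^esub>"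
  unfolding AutPoset_simps \<theta>_def
proof (rule restrict_ext)
  fix F assume "F \<in> faces P"
  then show "c (id ` inv_into L c F) = F" using c_bij by (simp add: bij_betw_def f_inv_into_f)
qed

lemma \<theta>_comp:
  assumes u: "u \<in> W" and v: "v \<in> W" shows "\<theta> u \<otimes>\<^bsub>AutPoset P\<^esub> \<theta> v = \<theta> (u \<circ> v)"
proof -
  have vL: "\<And>A. A \<in> L \<Longrightarrow> v ` A \<in> L" using v by (auto simp: W_def)
  have "\<theta> u (\<theta> v F) = \<theta> (u \<circ> v) F" if F: "F \<in> faces P" for F
  proof -
    obtain A where "A \<in> L" "F = c A" using F by (elim faceE)
    then show ?thesis by (simp add: \<theta>_c vL image_comp)
  qed
  then have "(\<lambda>F\<in>faces P. \<theta> u (\<theta> v F)) = (\<lambda>F\<in>faces P. \<theta> (u \<circ> v) F)" by (rule restrict_ext)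
  also have "\<dots> = \<theta> (u \<circ> v)" unfolding \<theta>_def[of "u \<circ> v"] by (simp cong: restrict_cong)
  finally show ?thesis unfolding AutPoset_simps(3)[OF \<theta>_aut[OF u] \<theta>_aut[OF v]] compose_def .
qed

lemma \<theta>_inj:
  assumes u: "u \<in> W" and v: "v \<in> W" and eq: "\<theta> u = \<theta> v" and x: "x \<in> V" shows "u x = v x"
proof -
  have xL: "{x} \<in> L" by (rule single[OF x])
  have "u ` {x} \<in> L" "v ` {x} \<in> L" using u v xL by (auto simp: W_def)
  moreover have "c (u ` {x}) = c (v ` {x})" using \<theta>_c[OF xL, of u] \<theta>_c[OF xL, of v] eq by simp
  ultimately have "u ` {x} = v ` {x}" by (rule inj_onD[OF c_inj, rotated 1])
  then show ?thesis by simp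
qed

lemma stabilizer_trivial:
  assumes f: "f \<in> poset_aut P" and stab: "f ` \<Phi> = \<Phi>" and F: "F \<in> faces P" shows "f F = F"
proof -
  have bij: "bij_betw f (faces P) (faces P)"
    and ord: "\<And>F G. F \<in> faces P \<Longrightarrow> G \<in> faces P \<Longrightarrow> below P (f F) (f G) \<longleftrightarrow> below P F G"
    using f by (auto simp: poset_aut_def Bij_def)
  define h where "h A = inv_into L c (f (c A))" for A
  have c_inv: "inv_into L c F \<in> L" "c (inv_into L c F) = F" if "F \<in> faces P" for F
    using that c_bij by (auto simp: bij_betw_def inv_into_into f_inv_into_f)
  have f_face: "f F \<in> faces P" if "F \<in> faces P" for F using bij that by (auto simp: bij_betw_def)
  have h: "h A \<in> L" "c (h A) = f (c A)" if "A \<in> L" for A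
    using c_inv[OF f_face[OF c_face[OF that]]] by (simp_all add: h_def)
  have "bij_betw (inv_into L c \<circ> f \<circ> c) L L"
    using c_bij bij bij_betw_inv_into[OF c_bij] by (blast intro: bij_betw_trans)
  then have h_bij: "bij_betw h L L" by (simp add: h_def[abs_def] comp_def)
  have h_ord: "h A \<subset> h B \<longleftrightarrow> A \<subset> B" if AB: "A \<in> L" "B \<in> L" for A B
    using ord[OF c_face c_face, OF AB] ord[OF c_face c_face, OF AB(2,1)] c_below AB h
    by (cases dual) (metis (full_types))+
  have "c ` h ` prefix_chain n V p = f ` \<Phi>" using h(2) chain_L by (force simp: image_iff)
  then have "c ` h ` prefix_chain n V p = c ` prefix_chain n V p" using stab by simp
  moreover have "h ` prefix_chain n V p \<subseteq> L" "prefix_chain n V p \<subseteq> L" using h(1) chain_L by auto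
  ultimately have h_chain: "h ` prefix_chain n V p = prefix_chain n V p"
    by (simp only: inj_on_image_eq_iff[OF c_inj])
  obtain A where A: "A \<in> L" "F = c A" using F by (elim faceE)
  have "h A = A" by (rule lattice_rigid[OF h_bij h_ord h_chain A(1)])
  then show ?thesis using h(2)[OF A(1)] A(2) by simp
qed

lemma aut_determined:
  assumes f: "f \<in> poset_aut P" and g: "g \<in> poset_aut P" and eq: "f ` \<Phi> = g ` \<Phi>" shows "f = g"
proof -
  interpret G: group "AutPoset P" by (rule group_AutPoset)
  have fG: "f \<in> carrier (AutPoset P)" "g \<in> carrier (AutPoset P)" using f g by (simp_all add: AutPoset_simps)
  define h where "h = inv\<^bsub>AutPoset P\<^esub> g"
  have h: "h \<in> poset_aut P" using G.inv_closed[OF fG(2)] by (simp add: h_def AutPoset_simps)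
  have \<Phi>_sub: "\<Phi> \<subseteq> faces P" using chain_L c_face by auto
  have "h \<otimes>\<^bsub>AutPoset P\<^esub> g = \<one>\<^bsub>AutPoset P\<^esub>" unfolding h_def by (rule G.l_inv[OF fG(2)])
  then have "compose (faces P) h g = (\<lambda>F\<in>faces P. F)" by (simp only: AutPoset_simps(3)[OF h g] AutPoset_simps(2))
  then have hg: "h (g F) = F" if "F \<in> faces P" for F using that by (metis compose_eq restrict_apply')
  have hf: "compose (faces P) h f \<in> poset_aut P" by (rule AutPoset_mult_closed[OF h f])
  have "compose (faces P) h f ` \<Phi> = h ` f ` \<Phi>" using \<Phi>_sub by (auto simp: compose_def image_iff subset_iff)
  also have "\<dots> = (\<lambda>F. h (g F)) ` \<Phi>" unfolding eq by (simp add: image_image)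
  also have "\<dots> = \<Phi>" using hg \<Phi>_sub by (force simp: image_iff)
  finally have st: "compose (faces P) h f ` \<Phi> = \<Phi>" .
  have "compose (faces P) h f F = F" if "F \<in> faces P" for F by (rule stabilizer_trivial[OF hf st that])
  then have "compose (faces P) h f = (\<lambda>F\<in>faces P. F)" by (auto simp: compose_def intro!: restrict_ext)
  then have "h \<otimes>\<^bsub>AutPoset P\<^esub> f = \<one>\<^bsub>AutPoset P\<^esub>" by (simp only: AutPoset_simps(3)[OF h f] AutPoset_simps(2))
  then have "inv\<^bsub>AutPoset P\<^esub> f = h" using fG h by (intro G.inv_equality) (simp_all add: AutPoset_simps(1))
  then show "f = g" using G.inv_inv fG unfolding h_def by metis
qed

lemma rank_eq_iff:
  assumes A: "A \<in> L" and i: "i < n"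
  shows "face_rank P (c A) = int i \<longleftrightarrow> A \<noteq> V \<and> card A = Suc (idx i)"
proof (cases "A = V")
  case False
  have "card A \<le> n" by (rule card_le[OF A False])
  then show ?thesis using c_rank[OF A] False i by (auto simp: idx_def)
qed (use c_rank[OF A] i in auto)

lemma chain_card:
  assumes "A \<in> prefix_chain n V p" "A \<noteq> V" shows "A = S (card A)"
  using assms by (auto simp: prefix_chain_def card_S)

lemma move_S: "k < n \<Longrightarrow> s k ` S (Suc k) = insert (s k (p k)) (S k)"
  using s_fix[of k k] by (simp add: lessThan_Suc)

lemma s_pk: assumes k: "k < n" shows "s k (p k) \<notin> S (Suc k)"
proof -
  have "p k \<notin> S k" using inj_onD[OF p_inj, of k] k by fastforce
  moreover have "s k (p k) \<notin> S k"
  proof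
    assume "s k (p k) \<in> S k"
    then have "s k (s k (p k)) \<in> s k ` S k" by (rule imageI)
    then show False using s_fix[of k k] s_invol[OF k] \<open>p k \<notin> S k\<close> k by simp
  qed
  ultimately show ?thesis using s_move[OF k] by (auto simp: lessThan_Suc)
qed

text \<open>A flag that agrees with the base flag except in rank \<open>i\<close> has, in the model, a single deviating
  member \<open>insert x (S k)\<close>. Either it lies in \<open>S (k + 2)\<close>, which leaves one choice of \<open>x\<close> besides \<open>p k\<close>, or \<open>k\<close> is the
  largest index and \<open>thin\<close> applies.\<close>

lemma adjacent:
  assumes i: "i < n" shows "adjacent_flag P i \<Phi> = \<theta> (s (idx i)) ` \<Phi>"
proof -
  define k where "k = idx i"
  have k: "k < n" using idx_less[OF i] by (simp add: k_def)
  let ?C = "prefix_chain n V p"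
  define D where "D = (`) (s k) ` ?C"
  have sV: "s k ` V = V" using s_W[OF k] by (simp add: W_def bij_betw_def)
  have D: "D = insert V (insert (s k ` S (Suc k)) (S ` ({..n} - {Suc k})))"
  proof -
    have "D = insert V ((\<lambda>j. s k ` S j) ` {..n})" by (simp add: D_def prefix_chain_def sV image_image)
    also have "{..n} = insert (Suc k) ({..n} - {Suc k})" using k by auto
    also have "(\<lambda>j. s k ` S j) ` \<dots> = insert (s k ` S (Suc k)) (S ` ({..n} - {Suc k}))"
      unfolding image_insert by (intro arg_cong[where f = "insert _"] image_cong refl s_fix[OF k]) auto
    finally show ?thesis .
  qed
  have DL: "D \<subseteq> L" using s_L[OF k] chain_L by (auto simp: D_def)
  have \<theta>\<Phi>: "\<theta> (s k) ` \<Phi> = c ` D" unfolding D_def image_image using \<theta>_c chain_L by (intro image_cong) auto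
  have T_card: "card (s k ` S (Suc k)) = Suc k"
  proof -
    have "inj (s k)" by (rule inj_on_inverseI[of _ "s k"]) (rule s_invol[OF k])
    then have "card (s k ` S (Suc k)) = card (S (Suc k))" by (intro card_image) (rule inj_on_subset, auto)
    then show ?thesis using card_S[of "Suc k"] k by simp
  qed
  have T_V: "s k ` S (Suc k) \<noteq> V" using T_card k by (intro not_top) simp
  have T_S: "s k ` S (Suc k) \<noteq> S (Suc k)" using move_S[OF k] s_pk[OF k] by blast
  have filter: "{F \<in> c ` E. face_rank P F \<noteq> int i} = c ` {A \<in> E. \<not> (A \<noteq> V \<and> card A = Suc k)}" if "E \<subseteq> L" for E
    using rank_eq_iff[OF _ i] that unfolding k_def by blast
  have CL: "?C \<subseteq> L" using chain_L by blast
  have C_rest: "{A \<in> ?C. \<not> (A \<noteq> V \<and> card A = Suc k)} = insert V (S ` ({..n} - {Suc k}))"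
    using k S_not_top by (auto simp: prefix_chain_def card_S)
  have D_rest: "{A \<in> D. \<not> (A \<noteq> V \<and> card A = Suc k)} = insert V (S ` ({..n} - {Suc k}))"
    unfolding D using T_V T_card S_not_top by (auto simp: card_S)
  show ?thesis unfolding adjacent_flag_def k_def[symmetric] \<theta>\<Phi>
  proof (rule the_equality, intro conjI)
    show "c ` D \<in> flags P" using poset_aut_flag[OF \<theta>_aut[OF s_W[OF k]] flag] \<theta>\<Phi> by simp
    have "s k ` S (Suc k) \<notin> ?C" using chain_card[of "s k ` S (Suc k)"] T_V T_card T_S by auto
    moreover have "s k ` S (Suc k) \<in> D" using D by blast
    ultimately show "c ` D \<noteq> \<Phi>" unfolding inj_on_image_eq_iff[OF c_inj DL CL] by blast
    show "{F \<in> c ` D. face_rank P F \<noteq> int i} = {F \<in> \<Phi>. face_rank P F \<noteq> int i}"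
      unfolding filter[OF DL] filter[OF CL] C_rest D_rest by (rule refl)
  next
    fix \<Psi> assume \<Psi>: "\<Psi> \<in> flags P \<and> \<Psi> \<noteq> \<Phi> \<and> {F \<in> \<Psi>. face_rank P F \<noteq> int i} = {F \<in> \<Phi>. face_rank P F \<noteq> int i}"
    then have "pred_on.maxchain (faces P) (below P) \<Psi>" by (simp add: flags_def)
    then have "\<exists>E. pred_on.maxchain L (\<subset>) E \<and> \<Psi> = c ` E"
      by (intro maxchain_image[OF c_bij]) (auto simp: c_below)
    then obtain q where q: "inj_on q {..<n}" "q ` {..<n} \<in> L" "\<Psi> = c ` prefix_chain n V q"
      using maxchain_enum by blast
    let ?E = "prefix_chain n V q"
    have qL: "q ` {..<j} \<in> L" "card (q ` {..<j}) = j" "q ` {..<j} \<noteq> V" if "j \<le> n" for j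
    proof -
      show c: "card (q ` {..<j}) = j" using inj_on_subset[OF q(1), of "{..<j}"] that by (simp add: card_image)
      show "q ` {..<j} \<noteq> V" using c that by (intro not_top) simp
      have "card (q ` {..<n}) \<le> n" using card_image_le[of "{..<n}" q] by simp
      then show "q ` {..<j} \<in> L" using down[OF q(2) not_top image_mono] that by simp
    qed
    have EL: "?E \<subseteq> L" using qL(1) top by (auto simp: prefix_chain_def)
    have E_rest: "{A \<in> ?E. \<not> (A \<noteq> V \<and> card A = Suc k)} = insert V ((\<lambda>j. q ` {..<j}) ` ({..n} - {Suc k}))"
      using k qL(2,3) by (auto simp: prefix_chain_def)
    have "c ` insert V ((\<lambda>j. q ` {..<j}) ` ({..n} - {Suc k})) = c ` insert V (S ` ({..n} - {Suc k}))"
      using \<Psi> unfolding q(3) filter[OF EL] filter[OF CL] C_rest E_rest by blast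
    moreover have "insert V ((\<lambda>j. q ` {..<j}) ` ({..n} - {Suc k})) \<subseteq> L" "insert V (S ` ({..n} - {Suc k})) \<subseteq> L"
      using qL(1) S_L top by auto
    ultimately have rest: "insert V ((\<lambda>j. q ` {..<j}) ` ({..n} - {Suc k})) = insert V (S ` ({..n} - {Suc k}))"
      by (simp only: inj_on_image_eq_iff[OF c_inj])
    have same: "q ` {..<j} = S j" if j: "j \<le> n" "j \<noteq> Suc k" for j
    proof -
      have "q ` {..<j} \<in> insert V (S ` ({..n} - {Suc k}))" unfolding rest[symmetric] using j by blast
      then obtain m where "m \<le> n" "q ` {..<j} = S m" using qL(3)[OF j(1)] by auto
      then show ?thesis using qL(2)[OF j(1)] card_S by metis
    qed
    define U where "U = q ` {..<Suc k}"
    have U: "U = insert (q k) (S k)" using same[of k] k by (simp add: U_def lessThan_Suc)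
    have E: "?E = insert V (insert U (S ` ({..n} - {Suc k})))"
    proof -
      have "{..n} = insert (Suc k) ({..n} - {Suc k})" using k by auto
      then have "?E = insert V ((\<lambda>j. q ` {..<j}) ` insert (Suc k) ({..n} - {Suc k}))" by (simp add: prefix_chain_def)
      also have "\<dots> = insert V (insert U (S ` ({..n} - {Suc k})))" unfolding image_insert U_def
        by (intro arg_cong[where f = "insert _"] image_cong refl same) auto
      finally show ?thesis .
    qed
    have C: "?C = insert V (insert (S (Suc k)) (S ` ({..n} - {Suc k})))"
    proof -
      have "{..n} = insert (Suc k) ({..n} - {Suc k})" using k by auto
      then show ?thesis by (metis image_insert prefix_chain_def)
    qed
    have U_ne: "U \<noteq> S (Suc k)" using \<Psi> q(3) E C by auto
    have qk: "q k \<notin> S k" using same[of k] inj_onD[OF q(1), of k] k by fastforce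
    have qk_ne: "q k \<noteq> p k" using U U_ne by (auto simp: lessThan_Suc)
    have "q k = s k (p k)"
    proof (cases "Suc k < n")
      case True
      then have "{k, Suc k} \<union> {..<k} = {..<Suc (Suc k)}" by auto
      then have S2: "S (Suc (Suc k)) = insert (p (Suc k)) (insert (p k) (S k))" by (simp add: lessThan_Suc)
      have "q k \<in> q ` {..<Suc (Suc k)}" by simp
      then have "q k \<in> S (Suc (Suc k))" using same[of "Suc (Suc k)"] True by auto
      then have "q k = p (Suc k)" using qk qk_ne S2 by auto
      moreover have "s k (p k) \<in> s k ` S (Suc (Suc k))" by (intro imageI) auto
      then have "s k (p k) \<in> S (Suc (Suc k))" using s_fix[OF k, of "Suc (Suc k)"] True by auto
      then have "s k (p k) = p (Suc k)" using s_pk[OF k] S2 by (auto simp: lessThan_Suc)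
      ultimately show ?thesis by simp
    next
      case False
      then have kn: "n - 1 = k" using k by simp
      have UL: "insert (q k) (S k) \<in> L" using qL(1)[of "Suc k"] U k by (simp add: U_def)
      then have "q k \<in> V" using sub by blast
      then show ?thesis using thin[of "q k"] qk qk_ne UL unfolding kn by blast
    qed
    then have "U = s k ` S (Suc k)" using U move_S[OF k] by simp
    then show "\<Psi> = c ` D" unfolding q(3) E D by simp
  qed
qed

lemma rho_eq: assumes i: "i < n" shows "rho P \<Phi> i = \<theta> (s (idx i))"
  unfolding rho_def adjacent[OF i]
proof (rule the_equality)
  show "\<theta> (s (idx i)) \<in> poset_aut P \<and> \<theta> (s (idx i)) ` \<Phi> = \<theta> (s (idx i)) ` \<Phi>"
    using \<theta>_aut[OF s_W[OF idx_less[OF i]]] by simp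
next
  fix f assume "f \<in> poset_aut P \<and> f ` \<Phi> = \<theta> (s (idx i)) ` \<Phi>"
  then show "f = \<theta> (s (idx i))"
    using aut_determined[OF _ \<theta>_aut[OF s_W[OF idx_less[OF i]]]] by blast
qed

lemma reflexible: "reflexible n P \<Phi>"
proof -
  interpret group "AutPoset P" by (rule group_AutPoset)
  show ?thesis unfolding reflexible_def
  proof
    fix i assume i: "i < n"
    note si = s_W[OF idx_less[OF i]]
    show "rho P \<Phi> i \<in> carrier (AutPoset P)" using \<theta>_aut[OF si] rho_eq[OF i] by (simp add: AutPoset_simps)
    have "s (idx i) \<circ> s (idx i) = id" using s_invol[OF idx_less[OF i]] by auto
    then show "rho P \<Phi> i \<otimes>\<^bsub>AutPoset P\<^esub> rho P \<Phi> i = \<one>\<^bsub>AutPoset P\<^esub>"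
      unfolding rho_eq[OF i] \<theta>_comp[OF si si] using \<theta>_id by simp
  qed
qed

lemma rho_word_\<theta>:
  "w \<in> lists {..<n} \<Longrightarrow> act (\<lambda>i. s (idx i)) w \<in> W \<and> rho_word P \<Phi> w = \<theta> (act (\<lambda>i. s (idx i)) w)"
proof (induction w rule: lists.induct)
  case Nil
  then show ?case unfolding act_Nil word_prod_Nil using id_W \<theta>_id by metis
next
  case (Cons i w)
  then have si: "s (idx i) \<in> W" and i: "i < n" using s_W idx_less by auto
  show ?case using Cons.IH comp_W[OF si] \<theta>_comp[OF si] by (simp add: word_prod_Cons rho_eq[OF i] del: comp_apply)
qed

lemma rho_word_cong:
  assumes u: "u \<in> lists {..<n}" and v: "v \<in> lists {..<n}"
  shows "rho_word P \<Phi> u = rho_word P \<Phi> v \<longleftrightarrow> act (\<lambda>i. s (idx i)) u = act (\<lambda>i. s (idx i)) v"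
proof
  assume eq: "rho_word P \<Phi> u = rho_word P \<Phi> v"
  have out: "act (\<lambda>i. s (idx i)) w x = x" if "w \<in> lists {..<n}" "x \<notin> V" for w x
    using s_outside[OF idx_less] that by (intro act_fixes[of "{..<n}"]) auto
  have "act (\<lambda>i. s (idx i)) u x = act (\<lambda>i. s (idx i)) v x" for x
  proof (cases "x \<in> V")
    case True
    then show ?thesis using rho_word_\<theta>[OF u] rho_word_\<theta>[OF v] eq by (intro \<theta>_inj) auto
  qed (simp add: out u v)
  then show "act (\<lambda>i. s (idx i)) u = act (\<lambda>i. s (idx i)) v" by blast
qed (use rho_word_\<theta>[OF u] rho_word_\<theta>[OF v] in simp)

end

section \<open>Two simplicial lattices\<close>

lemma invol_image_eq:
  assumes "\<And>x. f (f x) = x" "\<And>x. x \<in> A \<Longrightarrow> f x \<in> A" shows "f ` A = A"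
proof (intro equalityI subsetI)
  fix x assume "x \<in> A"
  then show "x \<in> f ` A" using assms by (intro image_eqI[of _ _ "f x"]) auto
qed (use assms in auto)

lemma pure_complex_Pow:
  assumes "1 \<le> n" "finite V" "card V = Suc n" shows "pure_complex n V (Pow V)"
proof
  fix A assume A: "A \<in> Pow V"
  show "card A \<le> n" if "A \<noteq> V"
  proof -
    have "A \<subset> V" using A that by blast
    then have "card A < card V" by (rule psubset_card_mono[OF assms(2)])
    then show ?thesis using assms(3) by simp
  qed
  show "\<exists>x\<in>V - A. insert x A \<in> Pow V" if "card A < n"
  proof -
    have "A \<noteq> V" using that assms by auto
    then show ?thesis using A by blast
  qed
qed (use assms in auto)

lemma simplicial_model_Pow:
  assumes n: "1 \<le> n" shows "simplicial_model n {..n} (Pow {..n}) agen id"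
proof -
  interpret pure_complex n "{..n}" "Pow {..n}" using n by (intro pure_complex_Pow) auto
  show ?thesis
  proof
    show "agen k (agen k x) = x" for k x by (simp add: agen_def)
    show "agen k x = x" if "k < n" "x \<notin> {..n}" for k x
      using that by (auto simp: agen_def Transposition.transpose_def)
    show "agen k ` A \<in> Pow {..n}" if "k < n" "A \<in> Pow {..n}" for k A
      using that by (auto simp: agen_def Transposition.transpose_def)
    show "agen k ` id ` {..<j} = id ` {..<j}" if "k < n" "j \<le> n" "j \<noteq> Suc k" for k j
      unfolding image_id by (rule invol_image_eq) (use that in \<open>auto simp: agen_def Transposition.transpose_def\<close>)
    show "agen k (id k) \<noteq> id k" for k by (simp add: agen_def)
    show "x = id (n - 1) \<or> x = agen (n - 1) (id (n - 1))"
      if "x \<in> {..n}" "x \<notin> id ` {..<n - 1}" for x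
      using that n by (auto simp: agen_def)
    fix w :: "nat \<Rightarrow> nat" and x assume w: "bij_betw w {..n} {..n}" "\<And>j. j < n \<Longrightarrow> w (id j) = id j" "x \<in> {..n}"
    show "w x = x"
    proof (cases "x = n")
      case True
      have "w n \<in> {..n}" using w(1) by (auto simp: bij_betw_def)
      moreover have "w n \<noteq> j" if "j < n" for j
        using w(2)[of j] that inj_onD[OF bij_betw_imp_inj_on[OF w(1)], of n j] by auto
      ultimately show ?thesis using True by (metis atMost_iff le_neq_implies_less)
    qed (use w in auto)
  qed auto
qed

definition antipodal_complex :: "'v set \<Rightarrow> ('v \<Rightarrow> 'v) \<Rightarrow> 'v set set" where
  "antipodal_complex V a = insert V {A. A \<subseteq> V \<and> (\<forall>x\<in>A. a x \<notin> A)}"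

lemma pure_complex_antipodal:
  assumes n: "1 \<le> n" and V: "finite V" "card V = 2 * n"
    and a: "\<And>x. x \<in> V \<Longrightarrow> a x \<in> V" "\<And>x. a (a x) = x" "\<And>x. x \<in> V \<Longrightarrow> a x \<noteq> x"
  shows "pure_complex n V (antipodal_complex V a)"
proof -
  have ne: "A \<noteq> V" if A: "\<forall>x\<in>A. a x \<notin> A" for A
  proof
    assume "A = V"
    moreover have "V \<noteq> {}" using V n by auto
    ultimately show False using A a(1) by blast
  qed
  have inj: "inj a" by (rule inj_on_inverseI[of _ a]) (rule a(2))
  have double: "card (A \<union> a ` A) = 2 * card A" if A: "A \<subseteq> V" "\<forall>x\<in>A. a x \<notin> A" for A
  proof -
    have "finite A" using A(1) V(1) by (rule finite_subset)
    moreover have "A \<inter> a ` A = {}" using A(2) a(2) by auto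
    moreover have "card (a ` A) = card A" using inj by (intro card_image) (rule inj_on_subset, auto)
    ultimately show ?thesis by (simp add: card_Un_disjoint)
  qed
  show ?thesis
  proof
    show "A \<subseteq> V" if "A \<in> antipodal_complex V a" for A using that by (auto simp: antipodal_complex_def)
    show "V \<in> antipodal_complex V a" by (simp add: antipodal_complex_def)
    show "B \<in> antipodal_complex V a" if "A \<in> antipodal_complex V a" "A \<noteq> V" "B \<subseteq> A" for A B
      using that unfolding antipodal_complex_def by blast
    show "{x} \<in> antipodal_complex V a" if "x \<in> V" for x using that a by (auto simp: antipodal_complex_def)
    show "card A \<le> n" if A: "A \<in> antipodal_complex V a" "A \<noteq> V" for A
    proof -
      have "A \<subseteq> V" "\<forall>x\<in>A. a x \<notin> A" using A by (auto simp: antipodal_complex_def)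
      moreover from this have "card (A \<union> a ` A) \<le> card V" using a(1) by (intro card_mono V) auto
      ultimately show ?thesis using double[of A] V(2) by simp
    qed
    show "n < card V" using n V by simp
    fix A assume A: "A \<in> antipodal_complex V a" "card A < n"
    then have "A \<noteq> V" using V n by auto
    then have A': "A \<subseteq> V" "\<forall>x\<in>A. a x \<notin> A" using A by (auto simp: antipodal_complex_def)
    have "A \<union> a ` A \<noteq> V" using double[OF A'] A(2) V(2) by auto
    moreover have "A \<union> a ` A \<subseteq> V" using A' a(1) by auto
    ultimately obtain x where x: "x \<in> V" "x \<notin> A" "x \<notin> a ` A" by blast
    have "a x \<notin> A" using x(3) a(2)[of x] by (metis imageI)
    moreover have "a y \<noteq> x" if "y \<in> A" for y using x(3) that by blast
    ultimately have "insert x A \<in> antipodal_complex V a"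
      using A' x a(3)[OF x(1)] by (auto simp: antipodal_complex_def)
    then show "\<exists>x\<in>V - A. insert x A \<in> antipodal_complex V a" using x by blast
  qed (use n V in auto)
qed

definition signed_points :: "nat \<Rightarrow> (nat \<times> bool) set" where
  "signed_points n = {..<n} \<times> UNIV"

abbreviation neg :: "nat \<times> bool \<Rightarrow> nat \<times> bool" where
  "neg \<equiv> map_prod id Not"

text \<open>For rigidity, let \<open>w\<close> fix all positive points. If it mapped the antipode of \<open>y\<close> to the antipode of
  \<open>z \<noteq> y\<close>, then the simplex consisting of the antipode of \<open>y\<close> and of \<open>z\<close> would have an antipodal pair as its
  image.\<close>

lemma simplicial_model_antipodal:
  assumes n: "2 \<le> n"
  shows "simplicial_model n (signed_points n) (antipodal_complex (signed_points n) neg)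
    (\<lambda>k. bgen (n - Suc k)) (\<lambda>k. (n - Suc k, True))"
proof -
  let ?V = "signed_points n" and ?L = "antipodal_complex (signed_points n) neg"
  let ?p = "\<lambda>k. (n - Suc k, True)"
  have V: "finite ?V" "card ?V = 2 * n" by (auto simp: signed_points_def card_cartesian_product)
  interpret pure_complex n ?V ?L
    using n V by (intro pure_complex_antipodal) (auto simp: signed_points_def)
  have invol: "bgen k (bgen k x) = x" for k x using fun_cong[OF bgen_invol[of k], of x] by simp
  have bgen_neg: "bgen k (neg x) = neg (bgen k x)" for k x
    by (cases k; cases x) (auto simp: bgen_0 bgen_Suc)
  have bgen_V: "bgen k x \<in> ?V \<longleftrightarrow> x \<in> ?V" if "k < n" for k x
    using that by (cases k; cases x) (auto simp: signed_points_def bgen_0 bgen_Suc agen_def Transposition.transpose_def)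
  have im: "?p ` {..<j} = {(x, b). b \<and> n - j \<le> x \<and> x < n}" if "j \<le> n" for j
  proof (intro equalityI subsetI)
    fix q assume "q \<in> {(x, b). b \<and> n - j \<le> x \<and> x < n}"
    then obtain x where "q = (x, True)" "n - j \<le> x" "x < n" by auto
    then show "q \<in> ?p ` {..<j}" using that by (intro image_eqI[of _ _ "n - Suc x"]) auto
  qed (use that in auto)
  show ?thesis
  proof
    show "inj_on ?p {..<n}" by (auto simp: inj_on_def)
    show "?p ` {..<n} \<in> ?L" by (auto simp: antipodal_complex_def signed_points_def)
    show "bgen (n - Suc k) (bgen (n - Suc k) x) = x" for k x by (rule invol)
    show "bgen (n - Suc k) x = x" if "k < n" "x \<notin> ?V" for k x
      using that by (cases "n - Suc k"; cases x)
        (auto simp: signed_points_def bgen_0 bgen_Suc agen_def Transposition.transpose_def)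
    show "bgen (n - Suc k) ` A \<in> ?L" if k: "k < n" and A: "A \<in> ?L" for k A
    proof (cases "A = ?V")
      case True
      have "bgen (n - Suc k) ` ?V = ?V" using k bgen_V[of "n - Suc k"] by (intro invol_image_eq invol) auto
      then show ?thesis using True top by simp
    next
      case False
      then have A': "A \<subseteq> ?V" "\<forall>x\<in>A. neg x \<notin> A" using A by (auto simp: antipodal_complex_def)
      have "neg y \<notin> bgen (n - Suc k) ` A" if y: "y \<in> bgen (n - Suc k) ` A" for y
      proof
        assume "neg y \<in> bgen (n - Suc k) ` A"
        then obtain z where z: "z \<in> A" "neg y = bgen (n - Suc k) z" by blast
        obtain x where x: "x \<in> A" "y = bgen (n - Suc k) x" using y by blast
        have "bgen (n - Suc k) (neg x) = bgen (n - Suc k) z" using x z by (simp add: bgen_neg)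
        then have "neg x = z" using invol by metis
        then show False using A'(2) x z by blast
      qed
      moreover have "bgen (n - Suc k) ` A \<subseteq> ?V" using A'(1) bgen_V[of "n - Suc k"] k by auto
      ultimately show ?thesis by (auto simp: antipodal_complex_def)
    qed
    show "bgen (n - Suc k) ` ?p ` {..<j} = ?p ` {..<j}" if k: "k < n" "j \<le> n" "j \<noteq> Suc k" for k j
      unfolding im[OF k(2)]
    proof (rule invol_image_eq[OF invol])
      fix q assume "q \<in> {(x, b). b \<and> n - j \<le> x \<and> x < n}"
      then obtain x where q: "q = (x, True)" "n - j \<le> x" "x < n" by auto
      have "n - j \<noteq> n - Suc k" using k by auto
      then show "bgen (n - Suc k) q \<in> {(x, b). b \<and> n - j \<le> x \<and> x < n}"
        using q k by (cases "n - Suc k") (auto simp: bgen_0 bgen_Suc agen_def Transposition.transpose_def)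
    qed
    show "bgen (n - Suc k) (?p k) \<noteq> ?p k" if "k < n" for k
      by (cases "n - Suc k") (auto simp: bgen_0 bgen_Suc agen_def)
    show "x = ?p (n - 1) \<or> x = bgen (n - Suc (n - 1)) (?p (n - 1))"
      if x: "x \<in> ?V" "x \<notin> ?p ` {..<n - 1}" "insert x (?p ` {..<n - 1}) \<in> ?L" for x
    proof -
      have p: "?p ` {..<n - 1} = {(x, b). b \<and> 1 \<le> x \<and> x < n}" using im[of "n - 1"] n by simp
      have "card (insert x (?p ` {..<n - 1})) \<le> Suc (card (?p ` {..<n - 1}))" by (simp add: card_insert_if)
      also have "\<dots> \<le> n" using card_image_le[of "{..<n - 1}" ?p] n by simp
      finally have "insert x (?p ` {..<n - 1}) \<noteq> ?V" using V(2) n by auto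
      then have c: "neg x \<notin> ?p ` {..<n - 1}" using x(3) unfolding antipodal_complex_def by blast
      obtain y b where y: "x = (y, b)" "y < n" using x(1) by (cases x) (auto simp: signed_points_def)
      have "y = 0" using x(2) c y unfolding p by (cases b) auto
      then show ?thesis using y n by (cases b) (auto simp: bgen_0)
    qed
    fix w x assume w: "bij_betw w ?V ?V" "\<And>A. A \<in> ?L \<Longrightarrow> w ` A \<in> ?L" "\<And>j. j < n \<Longrightarrow> w (?p j) = ?p j"
      and x: "x \<in> ?V"
    have wT: "w (y, True) = (y, True)" if "y < n" for y using w(3)[of "n - Suc y"] that by simp
    have "w (y, False) = (y, False)" if y: "y < n" for y
    proof -
      have "w (y, False) \<in> ?V" using w(1) y by (auto simp: bij_betw_def signed_points_def)
      then obtain z b where z: "w (y, False) = (z, b)" "z < n" by (auto simp: signed_points_def)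
      have "\<not> b"
      proof
        assume b
        then have "w (y, False) = w (z, True)" using wT z by simp
        then show False using inj_onD[OF bij_betw_imp_inj_on[OF w(1)], of "(y, False)" "(z, True)"] y z
          by (auto simp: signed_points_def)
      qed
      moreover have "z = y"
      proof (rule ccontr)
        assume zy: "z \<noteq> y"
        have "{(y, False), (z, True)} \<in> ?L" using y z zy by (auto simp: antipodal_complex_def signed_points_def)
        then have "w ` {(y, False), (z, True)} \<in> ?L" by (rule w(2))
        then have "{(z, False), (z, True)} \<in> ?L" using wT z \<open>\<not> b\<close> by simp
        moreover have "card {(z, False), (z, True)} \<noteq> card ?V" using V(2) n by simp
        ultimately show False unfolding antipodal_complex_def by auto
      qed
      ultimately show ?thesis using z by simp
    qed
    then show "w x = x" using wT x by (cases x; cases "snd x") (auto simp: signed_points_def)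
  qed
qed

lemma image_prefix_chain: "(`) e ` prefix_chain n V p = prefix_chain n (e ` V) (e \<circ> p)"
  by (simp add: prefix_chain_def image_image)

lemma prefix_chain_cong: "(\<And>i. i < n \<Longrightarrow> p i = q i) \<Longrightarrow> prefix_chain n V p = prefix_chain n V q"
  unfolding prefix_chain_def by (intro arg_cong[where f = "insert V"] image_cong refl) auto

lemma bij_betw_image_Pow:
  assumes e: "bij_betw e V V'" shows "bij_betw ((`) e) (Pow V) (Pow V')"
  using bij_betw_Pow[OF e] by simp

lemma rho_words_simplicial:
  fixes P :: "'f ranked_poset" and c :: "'v set \<Rightarrow> 'f"
  assumes n: "1 \<le> n" and V: "finite V" "card V = Suc n" and c: "bij_betw c (Pow V) (faces P)"
    and below: "\<And>A B. A \<subseteq> V \<Longrightarrow> B \<subseteq> V \<Longrightarrow> below P (c A) (c B) \<longleftrightarrow> A \<subset> B"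
    and rank: "\<And>A. A \<subseteq> V \<Longrightarrow> face_rank P (c A) = int (card A) - 1"
    and flag: "\<Phi> \<in> flags P"
  shows "reflexible n P \<Phi>"
    and "\<lbrakk>u \<in> lists {..<n}; v \<in> lists {..<n}\<rbrakk> \<Longrightarrow> rho_word P \<Phi> u = rho_word P \<Phi> v \<longleftrightarrow> actT u = actT v"
proof -
  interpret G: pure_complex n V "Pow V" by (rule pure_complex_Pow[OF n V])
  have "\<exists>C. pred_on.maxchain (Pow V) (\<subset>) C \<and> \<Phi> = c ` C"
    using flag by (intro maxchain_image[OF c]) (auto simp: flags_def below)
  then obtain q where q: "inj_on q {..<n}" "q ` {..<n} \<subseteq> V" "\<Phi> = c ` prefix_chain n V q"
    using G.maxchain_enum by blast
  have "card (q ` {..<n}) = n" using q(1) by (simp add: card_image)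
  then have "V - q ` {..<n} \<noteq> {}" using V card_mono[of "q ` {..<n}" V] by fastforce
  then obtain v0 where v0: "v0 \<in> V" "v0 \<notin> q ` {..<n}" by blast
  define e where "e i = (if i < n then q i else v0)" for i
  have e_inj: "inj_on e {..n}"
    using q(1) v0(2) by (auto simp: inj_on_def e_def image_iff)
  have "e ` {..n} \<subseteq> V" using q(2) v0(1) by (auto simp: e_def)
  then have e_im: "e ` {..n} = V" using V card_image[OF e_inj] by (intro card_subset_eq) auto
  have e: "bij_betw e {..n} V" using e_inj e_im by (simp add: bij_betw_def)
  have sub: "e ` A \<subseteq> V" if "A \<subseteq> {..n}" for A using that e_im by blast
  interpret M: simplicial_model n "{..n}" "Pow {..n}" agen id by (rule simplicial_model_Pow[OF n])
  have \<Phi>: "(\<lambda>A. c (e ` A)) ` prefix_chain n {..n} id = \<Phi>"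
  proof -
    have "(`) e ` prefix_chain n {..n} id = prefix_chain n V q"
      unfolding image_prefix_chain e_im by (rule prefix_chain_cong) (simp add: e_def)
    then show ?thesis unfolding q(3) by (metis image_image)
  qed
  interpret M: modelled_polytope n "{..n}" "Pow {..n}" agen id P "\<lambda>A. c (e ` A)" False
  proof
    show "bij_betw (\<lambda>A. c (e ` A)) (Pow {..n}) (faces P)"
      using bij_betw_trans[OF bij_betw_image_Pow[OF e] c] by (simp add: comp_def)
    fix A assume A: "A \<in> Pow {..n}"
    have card: "card (e ` A) = card A" using A e_inj by (intro card_image) (rule inj_on_subset, auto)
    then show "face_rank P (c (e ` A)) = (if False then if A = {..n} then - 1 else int n - int (card A)
        else if A = {..n} then int n else int (card A) - 1)"
      using rank[of "e ` A"] sub A by auto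
    fix B assume B: "B \<in> Pow {..n}"
    have "e ` A \<subset> e ` B \<longleftrightarrow> A \<subset> B"
      using A B inj_on_image_subset_iff[OF e_inj, of A B] inj_on_image_eq_iff[OF e_inj, of A B] by (auto simp: psubset_eq)
    then show "below P (c (e ` A)) (c (e ` B)) \<longleftrightarrow> (if False then B \<subset> A else A \<subset> B)"
      using below sub A B by simp
  qed (use \<Phi> flag in simp)
  have idx: "(\<lambda>i. agen (M.idx i)) = agen" by (simp add: M.idx_def)
  show "reflexible n P \<Phi>" using M.reflexible unfolding \<Phi> .
  show "rho_word P \<Phi> u = rho_word P \<Phi> v \<longleftrightarrow> actT u = actT v" if "u \<in> lists {..<n}" "v \<in> lists {..<n}"
    using M.rho_word_cong[OF that] unfolding \<Phi> idx .
qed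

text \<open>The flag enumerates \<open>n\<close> pairwise non-antipodal points \<open>q 0, q 1, \<dots>\<close>. Labelling \<open>q i\<close> by
  \<open>(n - 1 - i, True)\<close> and its antipode by \<open>(n - 1 - i, False)\<close> turns the given flag into the standard one.\<close>

lemma rho_words_antipodal:
  fixes P :: "'f ranked_poset" and c :: "'v set \<Rightarrow> 'f" and a :: "'v \<Rightarrow> 'v"
  assumes n: "2 \<le> n" and V: "finite V" "card V = 2 * n"
    and a: "\<And>x. x \<in> V \<Longrightarrow> a x \<in> V" "\<And>x. a (a x) = x" "\<And>x. x \<in> V \<Longrightarrow> a x \<noteq> x"
    and c: "bij_betw c (antipodal_complex V a) (faces P)"
    and below: "\<And>A B. A \<in> antipodal_complex V a \<Longrightarrow> B \<in> antipodal_complex V a \<Longrightarrow>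
      below P (c A) (c B) \<longleftrightarrow> (if dual then B \<subset> A else A \<subset> B)"
    and rank: "\<And>A. A \<in> antipodal_complex V a \<Longrightarrow> face_rank P (c A) =
      (if dual then (if A = V then -1 else int n - int (card A)) else (if A = V then int n else int (card A) - 1))"
    and flag: "\<Phi> \<in> flags P"
  shows "reflexible n P \<Phi>"
    and "\<lbrakk>u \<in> lists {..<n}; v \<in> lists {..<n}\<rbrakk> \<Longrightarrow> rho_word P \<Phi> u = rho_word P \<Phi> v \<longleftrightarrow>
      (if dual then actB u = actB v else actC n u = actC n v)"
proof -
  let ?V = "signed_points n" and ?L = "antipodal_complex (signed_points n) neg"
  let ?p = "\<lambda>k. (n - Suc k, True)"
  interpret G: pure_complex n V "antipodal_complex V a" using n by (intro pure_complex_antipodal V a) auto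
  have "\<exists>C. pred_on.maxchain (antipodal_complex V a) (\<subset>) C \<and> \<Phi> = c ` C"
    using flag by (intro maxchain_image[OF c]) (auto simp: flags_def below)
  then obtain q where q: "inj_on q {..<n}" "q ` {..<n} \<in> antipodal_complex V a" "\<Phi> = c ` prefix_chain n V q"
    using G.maxchain_enum by blast
  have "card (q ` {..<n}) = n" using q(1) by (simp add: card_image)
  then have "q ` {..<n} \<noteq> V" using V n by auto
  then have qV: "q ` {..<n} \<subseteq> V" and qa: "\<And>i j. i < n \<Longrightarrow> j < n \<Longrightarrow> a (q i) \<noteq> q j"
    using q(2) unfolding antipodal_complex_def by auto
  define e where "e z = (case z of (x, b) \<Rightarrow> if b then q (n - Suc x) else a (q (n - Suc x)))" for z
  have e_neg: "e (neg z) = a (e z)" for z using a(2) by (cases z) (auto simp: e_def)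
  have e_inj: "inj_on e ?V"
  proof (rule inj_onI)
    fix y z assume yz: "y \<in> ?V" "z \<in> ?V" "e y = e z"
    obtain i b j d where y: "y = (i, b)" and z: "z = (j, d)" by fastforce
    have ij: "i < n" "j < n" using yz y z by (auto simp: signed_points_def)
    have "n - Suc i < n" "n - Suc j < n" using n by auto
    then have "b = d" using yz(3) qa[of "n - Suc i" "n - Suc j"] qa[of "n - Suc j" "n - Suc i"]
      unfolding y z e_def by (cases b; cases d) auto
    moreover have "q (n - Suc i) = q (n - Suc j)" using yz(3) a(2) \<open>b = d\<close> unfolding y z e_def
      by (cases d) (auto, metis)
    then have "n - Suc i = n - Suc j" using inj_onD[OF q(1), of "n - Suc i" "n - Suc j"] n by auto
    then have "i = j" using ij by auto
    ultimately show "y = z" using y z by simp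
  qed
  have "n - Suc x < n" for x using n by simp
  then have qx: "q (n - Suc x) \<in> V" for x using qV by blast
  have "e z \<in> V" for z using qx a(1)[OF qx] by (cases z) (simp add: e_def)
  then have "e ` ?V \<subseteq> V" by blast
  moreover have "card (e ` ?V) = 2 * n" using card_image[OF e_inj] by (simp add: signed_points_def card_cartesian_product)
  ultimately have e_im: "e ` ?V = V" using V by (intro card_subset_eq) auto
  have e: "bij_betw e ?V V" using e_inj e_im by (simp add: bij_betw_def)
  have eL: "e ` A \<in> antipodal_complex V a \<longleftrightarrow> A \<in> ?L" if A: "A \<subseteq> ?V" for A
  proof -
    have "e ` A = V \<longleftrightarrow> A = ?V" using inj_on_image_eq_iff[OF e_inj A order_refl] e_im by simp
    moreover have "e ` A \<subseteq> V" using A e_im by blast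
    moreover have "a (e z) \<in> e ` A \<longleftrightarrow> neg z \<in> A" if "z \<in> A" for z
    proof -
      have "neg z \<in> ?V" using that A by (cases z) (auto simp: signed_points_def)
      then show ?thesis using inj_on_image_mem_iff[OF e_inj _ A] by (simp flip: e_neg)
    qed
    ultimately show ?thesis using A unfolding antipodal_complex_def by auto
  qed
  interpret M: simplicial_model n ?V ?L "\<lambda>k. bgen (n - Suc k)" ?p by (rule simplicial_model_antipodal[OF n])
  have im_L: "(`) e ` ?L = antipodal_complex V a"
  proof (intro equalityI subsetI)
    fix B assume B: "B \<in> antipodal_complex V a"
    then have "B \<subseteq> e ` ?V" using G.sub e_im by simp
    then obtain A where A: "A \<subseteq> ?V" "B = e ` A" by (metis subset_image_iff)
    then show "B \<in> (`) e ` ?L" using eL[OF A(1)] B by blast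
  qed (use eL M.sub in auto)
  have "inj_on ((`) e) ?L" using inj_on_image_eq_iff[OF e_inj M.sub M.sub] by (intro inj_onI) blast
  then have e_bij: "bij_betw ((`) e) ?L (antipodal_complex V a)" using im_L by (simp add: bij_betw_def)
  have \<Phi>: "(\<lambda>A. c (e ` A)) ` prefix_chain n ?V ?p = \<Phi>"
  proof -
    have "(`) e ` prefix_chain n ?V ?p = prefix_chain n V q"
      unfolding image_prefix_chain e_im by (rule prefix_chain_cong) (simp add: e_def Suc_diff_Suc)
    then show ?thesis unfolding q(3) by (metis image_image)
  qed
  interpret M: modelled_polytope n ?V ?L "\<lambda>k. bgen (n - Suc k)" ?p P "\<lambda>A. c (e ` A)" dual
  proof
    show "bij_betw (\<lambda>A. c (e ` A)) ?L (faces P)"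
      using bij_betw_trans[OF e_bij c] by (simp add: comp_def)
    fix A assume A: "A \<in> ?L"
    have "card (e ` A) = card A" using M.sub[OF A] e_inj by (intro card_image) (rule inj_on_subset)
    moreover have "e ` A = V \<longleftrightarrow> A = ?V" using inj_on_image_eq_iff[OF e_inj M.sub[OF A] order_refl] e_im by simp
    moreover have eA: "e ` A \<in> antipodal_complex V a" using eL[OF M.sub[OF A]] A by simp
    ultimately show "face_rank P (c (e ` A)) = (if dual then if A = ?V then - 1 else int n - int (card A)
        else if A = ?V then int n else int (card A) - 1)"
      using rank[OF eA] by simp
    fix B assume B: "B \<in> ?L"
    have eB: "e ` B \<in> antipodal_complex V a" using eL[OF M.sub[OF B]] B by simp
    have "e ` A \<subset> e ` B \<longleftrightarrow> A \<subset> B" "e ` B \<subset> e ` A \<longleftrightarrow> B \<subset> A"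
      using inj_on_image_subset_iff[OF e_inj M.sub[OF A] M.sub[OF B]] inj_on_image_eq_iff[OF e_inj M.sub[OF A] M.sub[OF B]]
        inj_on_image_subset_iff[OF e_inj M.sub[OF B] M.sub[OF A]] by (auto simp: psubset_eq)
    then show "below P (c (e ` A)) (c (e ` B)) \<longleftrightarrow> (if dual then B \<subset> A else A \<subset> B)"
      using below[OF eA eB] by simp
  qed (use \<Phi> flag in simp)
  show "reflexible n P \<Phi>" using M.reflexible unfolding \<Phi> .
  assume uv: "u \<in> lists {..<n}" "v \<in> lists {..<n}"
  have "act (\<lambda>i. bgen (n - Suc (M.idx i))) w = (if dual then actB w else actC n w)" if w: "w \<in> lists {..<n}" for w
  proof -
    have "act (\<lambda>i. bgen (n - Suc (n - Suc i))) w = actB w"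
      using w by (intro act_cong[of "{..<n}"]) auto
    then show ?thesis unfolding M.idx_def by (auto simp: actC_act)
  qed
  then show "rho_word P \<Phi> u = rho_word P \<Phi> v \<longleftrightarrow> (if dual then actB u = actB v else actC n u = actC n v)"
    using M.rho_word_cong[OF uv] uv unfolding \<Phi> by simp
qed

section \<open>Face lattices of simplex, cube and cross-polytope\<close>

lemma face_lattice_simps [simp]:
  "faces (face_lattice K) = {F. F face_of K}" "below (face_lattice K) = (\<subset>)" "face_rank (face_lattice K) = aff_dim"
  by (simp_all add: face_lattice_def)

text \<open>A point of \<open>A\<close> that lies in the hull of \<open>B\<close> is an extreme point of that hull, hence belongs to \<open>B\<close>.\<close>

lemma convex_hull_mono_iff:
  fixes V :: "'a::euclidean_space set"
  assumes ext: "\<And>v. v \<in> V \<Longrightarrow> v extreme_point_of (convex hull V)" and "A \<subseteq> V" "B \<subseteq> V"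
  shows "convex hull A \<subseteq> convex hull B \<longleftrightarrow> A \<subseteq> B"
proof
  assume le: "convex hull A \<subseteq> convex hull B"
  show "A \<subseteq> B"
  proof
    fix v assume v: "v \<in> A"
    then have "v \<in> convex hull B" using le hull_inc by fastforce
    moreover have "convex hull B \<subseteq> convex hull V" by (rule hull_mono) fact
    moreover have "v extreme_point_of (convex hull V)" using ext v assms(2) by blast
    ultimately have "v extreme_point_of (convex hull B)" unfolding extreme_point_of_def by blast
    then show "v \<in> B" by (rule extreme_point_of_convex_hull)
  qed
qed (rule hull_mono)

lemma convex_hull_psubset_iff:
  fixes V :: "'a::euclidean_space set"
  assumes "\<And>v. v \<in> V \<Longrightarrow> v extreme_point_of (convex hull V)" and "A \<subseteq> V" "B \<subseteq> V"
  shows "convex hull A \<subset> convex hull B \<longleftrightarrow> A \<subset> B"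
  using convex_hull_mono_iff[of V A B] convex_hull_mono_iff[of V B A] assms by blast

lemma inner_One: "b \<in> Basis \<Longrightarrow> One \<bullet> b = (1 :: real)"
  for b :: "'a::euclidean_space"
  by (simp add: inner_sum_left inner_Basis)

text \<open>The basis lies in the hyperplane of coordinate sum \<open>1\<close>, while the apex has coordinate sum
  \<open>1 + sqrt (1 + n)\<close>.\<close>

lemma simplex_vertices:
  fixes V :: "'a::euclidean_space set"
  defines "V \<equiv> insert simplex_apex Basis"
  shows "\<not> affine_dependent V" and "card V = Suc DIM('a)"
proof -
  define d where "d = real DIM('a)"
  have d: "d > 0" by (simp add: d_def)
  have "One \<bullet> (One :: 'a) = d" by (simp add: inner_sum_left inner_sum_right inner_Basis d_def)
  then have apex: "One \<bullet> (simplex_apex :: 'a) \<noteq> 1"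
    using d by (simp add: simplex_apex_def d_def)
  have "affine hull (Basis :: 'a set) \<subseteq> {x. One \<bullet> x = 1}"
    by (rule hull_minimal) (auto simp: inner_One affine_hyperplane)
  then have notin: "(simplex_apex :: 'a) \<notin> affine hull Basis" using apex by blast
  have "\<not> affine_dependent (Basis :: 'a set)"
    using independent_Basis affine_dependent_imp_dependent by blast
  then show "\<not> affine_dependent V"
    unfolding V_def using notin by (rule affine_independent_insert)
  have "(simplex_apex :: 'a) \<notin> Basis" using notin hull_inc by metis
  then show "card V = Suc DIM('a)" by (simp add: V_def)
qed

lemma rho_words_simplex:
  fixes \<Phi> :: "'a::euclidean_space set set"
  assumes n: "n = DIM('a)" and flag: "\<Phi> \<in> flags simplex_lattice"
  shows "reflexible n simplex_lattice \<Phi>"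
    and "\<lbrakk>u \<in> lists {..<n}; v \<in> lists {..<n}\<rbrakk> \<Longrightarrow>
      rho_word simplex_lattice \<Phi> u = rho_word simplex_lattice \<Phi> v \<longleftrightarrow> actT u = actT v"
proof -
  let ?V = "insert simplex_apex Basis :: 'a set"
  note ind = simplex_vertices(1)[where 'a = 'a]
  have sl: "simplex_lattice = face_lattice (convex hull ?V)" by (simp add: simplex_lattice_def)
  have ext: "v extreme_point_of (convex hull ?V)" if "v \<in> ?V" for v
    using that by (simp only: extreme_point_of_convex_hull_affine_independent[OF ind])
  have faces: "faces (face_lattice (convex hull ?V)) = (\<lambda>A. convex hull A) ` Pow ?V"
    unfolding face_lattice_simps face_of_convex_hull_affine_independent[OF ind] by blast
  have "inj_on (\<lambda>A. convex hull A) (Pow ?V)"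
  proof (rule inj_onI)
    fix A B assume AB: "A \<in> Pow ?V" "B \<in> Pow ?V" "convex hull A = convex hull B"
    then show "A = B" using convex_hull_mono_iff[OF ext, of A B] convex_hull_mono_iff[OF ext, of B A] by blast
  qed
  then have bij: "bij_betw (\<lambda>A. convex hull A) (Pow ?V) (faces (face_lattice (convex hull ?V)))"
    by (simp only: faces bij_betw_def simp_thms)
  have n1: "1 \<le> n" using n by (simp add: Suc_leI)
  have card: "card ?V = Suc n" using simplex_vertices(2)[where 'a = 'a] n by simp
  have below: "below (face_lattice (convex hull ?V)) (convex hull A) (convex hull B) \<longleftrightarrow> A \<subset> B"
    if "A \<subseteq> ?V" "B \<subseteq> ?V" for A B
    using convex_hull_psubset_iff[OF ext that] by simp
  have rank: "face_rank (face_lattice (convex hull ?V)) (convex hull A) = int (card A) - 1" if "A \<subseteq> ?V" for A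
    using aff_dim_affine_independent[OF affine_independent_subset[OF ind that]] by (simp add: aff_dim_convex_hull)
  have fin: "finite ?V" and fl: "\<Phi> \<in> flags (face_lattice (convex hull ?V))" using flag sl by simp_all
  show "reflexible n simplex_lattice \<Phi>"
    unfolding sl by (rule rho_words_simplicial(1)[OF n1 fin card bij _ _ fl]) (rule below rank; assumption)+
  show "rho_word simplex_lattice \<Phi> u = rho_word simplex_lattice \<Phi> v \<longleftrightarrow> actT u = actT v"
    if "u \<in> lists {..<n}" "v \<in> lists {..<n}"
    unfolding sl by (rule rho_words_simplicial(2)[OF n1 fin card bij _ _ fl that]) (rule below rank; assumption)+
qed

definition axis_points :: "'a::euclidean_space set" where
  "axis_points = Basis \<union> uminus ` Basis"

lemma uminus_notin_Basis: "b \<in> Basis \<Longrightarrow> - b \<notin> Basis" for b :: "'a::euclidean_space"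
proof
  assume b: "b \<in> Basis" "- b \<in> Basis"
  have "b \<bullet> (- b) = - 1" using b(1) by simp
  moreover have "b \<bullet> (- b) \<ge> 0" using inner_Basis[OF b] by simp
  ultimately show False by simp
qed

lemma finite_axis_points: "finite (axis_points :: 'a::euclidean_space set)"
  by (simp add: axis_points_def)

lemma card_axis_points: "card (axis_points :: 'a::euclidean_space set) = 2 * DIM('a)"
proof -
  have "card (uminus ` Basis :: 'a set) = DIM('a)" by (rule card_image) (simp add: inj_on_def)
  moreover have "Basis \<inter> uminus ` Basis = ({} :: 'a set)" using uminus_notin_Basis by auto
  ultimately show ?thesis unfolding axis_points_def by (subst card_Un_disjoint) auto
qed

lemma axis_points_uminus: "v \<in> axis_points \<Longrightarrow> - v \<in> axis_points"
  by (auto simp: axis_points_def)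

lemma inner_axis_points:
  fixes v w :: "'a::euclidean_space"
  assumes "v \<in> axis_points" "w \<in> axis_points"
  shows "v \<bullet> w = (if v = w then 1 else if v = - w then -1 else 0)"
  using assms uminus_notin_Basis[of v] uminus_notin_Basis[of w] unfolding axis_points_def
  by (elim UnE imageE) (auto simp: inner_Basis)

lemma uminus_neq: "v \<in> axis_points \<Longrightarrow> - v \<noteq> v" for v :: "'a::euclidean_space"
proof
  assume v: "v \<in> axis_points" "- v = v"
  have "v \<bullet> v = - (- v \<bullet> v)" by simp
  also have "\<dots> = - (v \<bullet> v)" by (simp only: v(2))
  finally show False using inner_axis_points[OF v(1) v(1)] by simp
qed

lemma inner_sum_axis_points:
  fixes S :: "'a::euclidean_space set"
  assumes S: "S \<subseteq> axis_points" "\<forall>x\<in>S. - x \<notin> S" and v: "v \<in> axis_points"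
  shows "\<Sum>S \<bullet> v = (if v \<in> S then 1 else if - v \<in> S then -1 else 0)"
proof -
  have fin: "finite S" using S(1) finite_axis_points by (rule finite_subset)
  have "\<Sum>S \<bullet> v = (\<Sum>s\<in>S. s \<bullet> v)" by (simp add: inner_sum_left)
  also have "\<dots> = (\<Sum>s\<in>S. (if s = v then 1 else 0) - (if s = - v then 1 else 0))"
    using S v uminus_neq[OF v] by (intro sum.cong refl) (auto simp: inner_axis_points subset_iff)
  also have "\<dots> = (if v \<in> S then 1 else 0) - (if - v \<in> S then 1 else 0)"
    using fin by (simp add: sum_subtractf)
  finally show ?thesis using S(2) by auto
qed

abbreviation axis_complex :: "'a::euclidean_space set set" where
  "axis_complex \<equiv> antipodal_complex axis_points uminus"

lemma pure_complex_axis: "pure_complex DIM('a) axis_points (axis_complex :: 'a::euclidean_space set set)"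
  by (intro pure_complex_antipodal finite_axis_points card_axis_points axis_points_uminus uminus_neq)
    (simp_all add: Suc_leI)

text \<open>The sum of \<open>S\<close> has inner product \<open>1\<close> with the points of \<open>S\<close> and at most \<open>0\<close> with all others, so it defines
  a supporting hyperplane that meets the vertices exactly in \<open>S\<close>.\<close>

lemma cross_face:
  fixes S :: "'a::euclidean_space set"
  assumes S: "S \<subseteq> axis_points" "\<forall>x\<in>S. - x \<notin> S"
  shows "(convex hull S) face_of (convex hull axis_points)"
proof -
  let ?K = "convex hull axis_points :: 'a set"
  let ?F = "?K \<inter> {x. \<Sum>S \<bullet> x = 1}"
  have "?K \<subseteq> {x. \<Sum>S \<bullet> x \<le> 1}"
    by (rule hull_minimal) (auto simp: inner_sum_axis_points[OF S] convex_halfspace_le)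
  then have face: "?F face_of ?K" by (intro face_of_Int_supporting_hyperplane_le) auto
  obtain T where T: "T \<subseteq> axis_points" "?F = convex hull T"
    using face_of_convex_hull_subset[OF finite_imp_compact[OF finite_axis_points] face] by blast
  have "T \<subseteq> S"
  proof
    fix v assume v: "v \<in> T"
    then have "v \<in> ?F" unfolding T(2) by (rule hull_inc)
    then have "\<Sum>S \<bullet> v = 1" by blast
    moreover have vp: "v \<in> axis_points" using v T(1) by blast
    ultimately show "v \<in> S" unfolding inner_sum_axis_points[OF S vp] by (simp split: if_splits)
  qed
  then have "?F \<subseteq> convex hull S" unfolding T(2) by (rule hull_mono)
  moreover have "convex hull S \<subseteq> ?F"
  proof (rule hull_minimal)
    show "S \<subseteq> ?F" using inner_sum_axis_points[OF S] S(1) by (auto intro: hull_inc)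
    show "convex ?F" using face by (rule face_of_imp_convex)
  qed
  ultimately have "?F = convex hull S" by (rule subset_antisym)
  then show ?thesis using face by simp
qed

text \<open>A face with an antipodal pair contains the origin, which is the midpoint of every antipodal pair, and hence
  contains all vertices.\<close>

lemma cross_faces:
  "{F. F face_of (convex hull axis_points)} = (\<lambda>A. convex hull A) ` (axis_complex :: 'a::euclidean_space set set)"
proof (intro equalityI subsetI)
  fix F :: "'a set" assume "F \<in> {F. F face_of (convex hull axis_points)}"
  then have F: "F face_of (convex hull axis_points)" by simp
  obtain S where S: "S \<subseteq> axis_points" "F = convex hull S"
    using face_of_convex_hull_subset[OF finite_imp_compact[OF finite_axis_points] F] by blast
  show "F \<in> (\<lambda>A. convex hull A) ` axis_complex"
  proof (cases "\<forall>x\<in>S. - x \<notin> S")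
    case True
    then show ?thesis using S by (auto simp: antipodal_complex_def)
  next
    case False
    then obtain x where x: "x \<in> S" "- x \<in> S" by blast
    have mid: "0 \<in> open_segment v (- v)" if "v \<in> axis_points" for v :: 'a
      using uminus_neq[OF that] by (auto simp: in_segment intro!: exI[of _ "1/2"])
    have "closed_segment x (- x) \<subseteq> F" unfolding S(2)
      using x by (intro closed_segment_subset convex_convex_hull) (auto intro: hull_inc)
    then have zero: "0 \<in> F" using mid[of x] x S(1) open_closed_segment by blast
    have "v \<in> F" if v: "v \<in> axis_points" for v
      using F zero mid[OF v] hull_inc[OF v] hull_inc[OF axis_points_uminus[OF v]] unfolding face_of_def by blast
    then have "convex hull axis_points \<subseteq> F" using face_of_imp_convex[OF F] by (intro hull_minimal) auto
    then have "F = convex hull axis_points" using face_of_imp_subset[OF F] by blast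
    then show ?thesis by (auto simp: antipodal_complex_def)
  qed
next
  fix F :: "'a set" assume "F \<in> (\<lambda>A. convex hull A) ` axis_complex"
  then obtain A where A: "A \<in> axis_complex" "F = convex hull A" by blast
  show "F \<in> {F. F face_of (convex hull axis_points)}"
  proof (cases "A = axis_points")
    case True
    then show ?thesis using A(2) face_of_refl[OF convex_convex_hull] by simp
  next
    case False
    then have "A \<subseteq> axis_points" "\<forall>x\<in>A. - x \<notin> A" using A(1) by (auto simp: antipodal_complex_def)
    then show ?thesis using A(2) cross_face[of A] by blast
  qed
qed

lemma aff_dim_axis_points: "aff_dim (axis_points :: 'a::euclidean_space set) = int DIM('a)"
proof -
  let ?K = "convex hull axis_points :: 'a set"
  obtain b :: 'a where b: "b \<in> Basis" using nonempty_Basis by blast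
  then have bb: "b \<in> axis_points" "- b \<in> axis_points" by (auto simp: axis_points_def)
  have "closed_segment b (- b) \<subseteq> ?K"
    using bb by (intro closed_segment_subset convex_convex_hull) (auto intro: hull_inc)
  moreover have "0 \<in> closed_segment b (- b)" by (auto simp: in_segment intro!: exI[of _ "1/2"])
  ultimately have "insert 0 Basis \<subseteq> ?K" by (auto simp: axis_points_def intro: hull_inc)
  then have "aff_dim (insert 0 (Basis :: 'a set)) \<le> aff_dim ?K" by (rule aff_dim_subset)
  moreover have "\<not> affine_dependent (insert 0 (Basis :: 'a set))"
    using affine_dependent_imp_dependent2 independent_Basis by blast
  then have "aff_dim (insert 0 (Basis :: 'a set)) = int DIM('a)"
    using aff_dim_affine_independent[of "insert 0 (Basis :: 'a set)"] by simp
  ultimately show ?thesis using aff_dim_le_DIM[of ?K] by (simp add: aff_dim_convex_hull)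
qed

lemma rho_words_cross_polytope:
  fixes \<Phi> :: "'a::euclidean_space set set"
  assumes n: "n = DIM('a)" "2 \<le> n" and flag: "\<Phi> \<in> flags cross_polytope_lattice"
  shows "reflexible n cross_polytope_lattice \<Phi>"
    and "\<lbrakk>u \<in> lists {..<n}; v \<in> lists {..<n}\<rbrakk> \<Longrightarrow>
      rho_word cross_polytope_lattice \<Phi> u = rho_word cross_polytope_lattice \<Phi> v \<longleftrightarrow> actC n u = actC n v"
proof -
  let ?V = "axis_points :: 'a set" and ?L = "axis_complex :: 'a set set"
  interpret C: pure_complex n ?V ?L using pure_complex_axis n(1) by simp
  have cl: "cross_polytope_lattice = face_lattice (convex hull ?V)"
    by (simp add: cross_polytope_lattice_def axis_points_def)
  have ext: "v extreme_point_of (convex hull ?V)" if v: "v \<in> ?V" for v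
    using cross_face[of "{v}"] v uminus_neq[OF v] by (auto simp: face_of_singleton)
  have faces: "faces (face_lattice (convex hull ?V)) = (\<lambda>A. convex hull A) ` ?L"
    unfolding face_lattice_simps by (rule cross_faces)
  have "inj_on (\<lambda>A. convex hull A) ?L"
  proof (rule inj_onI)
    fix A B assume AB: "A \<in> ?L" "B \<in> ?L" "convex hull A = convex hull B"
    then show "A = B" using convex_hull_mono_iff[OF ext C.sub C.sub, of A B]
        convex_hull_mono_iff[OF ext C.sub C.sub, of B A] by blast
  qed
  then have bij: "bij_betw (\<lambda>A. convex hull A) ?L (faces (face_lattice (convex hull ?V)))"
    by (simp only: faces bij_betw_def simp_thms)
  have below: "below (face_lattice (convex hull ?V)) (convex hull A) (convex hull B) \<longleftrightarrow>
      (if False then B \<subset> A else A \<subset> B)" if "A \<in> ?L" "B \<in> ?L" for A B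
    using convex_hull_psubset_iff[OF ext C.sub[OF that(1)] C.sub[OF that(2)]] by simp
  have rank: "face_rank (face_lattice (convex hull ?V)) (convex hull A) =
      (if False then (if A = ?V then -1 else int n - int (card A)) else (if A = ?V then int n else int (card A) - 1))"
    if A: "A \<in> ?L" for A
  proof (cases "A = ?V")
    case True
    then show ?thesis using n(1) by (simp add: aff_dim_convex_hull aff_dim_axis_points)
  next
    case False
    then have A': "A \<subseteq> ?V" "\<forall>x\<in>A. - x \<notin> A" using A by (auto simp: antipodal_complex_def)
    have "independent A"
    proof (rule pairwise_orthogonal_independent)
      show "pairwise orthogonal A"
        using A' by (auto simp: pairwise_def orthogonal_def inner_axis_points subset_iff)
      show "0 \<notin> A" using A' uminus_neq[of 0] by auto
    qed
    then have "\<not> affine_dependent A" using affine_dependent_imp_dependent by blast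
    then show ?thesis using aff_dim_affine_independent[of A] False by (simp add: aff_dim_convex_hull)
  qed
  have V: "card ?V = 2 * n" using card_axis_points n(1) by simp
  have fl: "\<Phi> \<in> flags (face_lattice (convex hull ?V))" using flag cl by simp
  show "reflexible n cross_polytope_lattice \<Phi>"
    unfolding cl by (rule rho_words_antipodal(1)[where dual = False and a = uminus, OF n(2) finite_axis_points V _ _ _ bij _ _ fl])
      (rule axis_points_uminus minus_minus uminus_neq below rank; assumption)+
  show "rho_word cross_polytope_lattice \<Phi> u = rho_word cross_polytope_lattice \<Phi> v \<longleftrightarrow> actC n u = actC n v"
    if "u \<in> lists {..<n}" "v \<in> lists {..<n}"
  proof -
    have "rho_word (face_lattice (convex hull ?V)) \<Phi> u = rho_word (face_lattice (convex hull ?V)) \<Phi> v \<longleftrightarrow>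
        (if False then actB u = actB v else actC n u = actC n v)"
      by (rule rho_words_antipodal(2)[where dual = False and a = uminus, OF n(2) finite_axis_points V _ _ _ bij _ _ fl that])
        (rule axis_points_uminus minus_minus uminus_neq below rank; assumption)+
    then show ?thesis unfolding cl by simp
  qed
qed

text \<open>The dual description: a face of the cube is given by the set of facets that contain it, and the facets
  correspond to the points \<open>\<plusminus>b\<close>.\<close>

definition cube_face :: "'a::euclidean_space set \<Rightarrow> 'a set" where
  "cube_face S = {x \<in> cbox (- One) One. \<forall>s\<in>S. x \<bullet> s = 1}"

lemma cube_inner_le: "x \<in> cbox (- One) One \<longleftrightarrow> (\<forall>v\<in>axis_points. x \<bullet> v \<le> 1)"
  for x :: "'a::euclidean_space"
proof -
  have "x \<in> cbox (- One) One \<longleftrightarrow> (\<forall>b\<in>Basis. - 1 \<le> x \<bullet> b \<and> x \<bullet> b \<le> 1)"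
    by (simp add: mem_box inner_One)
  also have "\<dots> \<longleftrightarrow> (\<forall>b\<in>Basis. x \<bullet> b \<le> 1 \<and> x \<bullet> (- b) \<le> 1)" by (intro ball_cong refl) auto
  also have "\<dots> \<longleftrightarrow> (\<forall>v\<in>axis_points. x \<bullet> v \<le> 1)" unfolding axis_points_def by blast
  finally show ?thesis .
qed

lemma cube_face_face_of:
  fixes S :: "'a::euclidean_space set"
  assumes S: "S \<subseteq> axis_points" shows "cube_face S face_of cbox (- One) One"
proof (cases "S = {}")
  case True
  then show ?thesis by (simp add: cube_face_def face_of_refl convex_box)
next
  case False
  have "cube_face S = \<Inter> ((\<lambda>s. cbox (- One) One \<inter> {x. s \<bullet> x = 1}) ` S)"
    using False by (auto simp: cube_face_def inner_commute)
  also have "\<dots> face_of cbox (- One) One"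
  proof (rule face_of_Inter)
    fix T assume "T \<in> (\<lambda>s. cbox (- One) One \<inter> {x. s \<bullet> x = 1}) ` S"
    then obtain s where s: "s \<in> S" "T = cbox (- One) One \<inter> {x. s \<bullet> x = 1}" by blast
    have "s \<bullet> x \<le> 1" if "x \<in> cbox (- One) One" for x
    proof -
      have "x \<bullet> s \<le> 1" using that s(1) S cube_inner_le by blast
      then show ?thesis by (simp add: inner_commute)
    qed
    then show "T face_of cbox (- One) One" unfolding s(2)
      by (intro face_of_Int_supporting_hyperplane_le convex_box)
  qed (use False in simp)
  finally show ?thesis .
qed

lemma cube_face_axis_points: "cube_face axis_points = ({} :: 'a::euclidean_space set)"
proof -
  obtain b :: 'a where b: "b \<in> Basis" using nonempty_Basis by blast
  have False if "x \<in> cube_face axis_points" for x :: 'a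
  proof -
    have "b \<in> axis_points" "- b \<in> axis_points" using b by (auto simp: axis_points_def)
    then have "x \<bullet> b = 1" "x \<bullet> (- b) = 1" using that unfolding cube_face_def by blast+
    then show False by simp
  qed
  then show ?thesis by blast
qed

lemma sum_in_cube_face:
  fixes S :: "'a::euclidean_space set"
  assumes S: "S \<subseteq> axis_points" "\<forall>x\<in>S. - x \<notin> S" shows "\<Sum>S \<in> cube_face S"
proof -
  have "\<Sum>S \<bullet> v \<le> 1" if "v \<in> axis_points" for v unfolding inner_sum_axis_points[OF S that] by simp
  then have "\<Sum>S \<in> cbox (- One) One" using cube_inner_le by blast
  moreover have "\<Sum>S \<bullet> v = 1" if v: "v \<in> S" for v
  proof -
    have "v \<in> axis_points" using v S(1) by blast
    from inner_sum_axis_points[OF S this] show ?thesis using v by simp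
  qed
  ultimately show ?thesis unfolding cube_face_def by blast
qed

lemma cube_face_mono_iff:
  fixes S :: "'a::euclidean_space set"
  assumes S: "S \<in> axis_complex" and T: "T \<in> axis_complex"
  shows "cube_face T \<subseteq> cube_face S \<longleftrightarrow> S \<subseteq> T"
proof
  interpret C: pure_complex "DIM('a)" axis_points "axis_complex :: 'a set set" by (rule pure_complex_axis)
  assume le: "cube_face T \<subseteq> cube_face S"
  show "S \<subseteq> T"
  proof (cases "T = axis_points")
    case True
    then show ?thesis using C.sub[OF S] by simp
  next
    case False
    then have T': "T \<subseteq> axis_points" "\<forall>x\<in>T. - x \<notin> T" using T by (auto simp: antipodal_complex_def)
    show ?thesis
    proof
      fix s assume s: "s \<in> S"
      then have sp: "s \<in> axis_points" using C.sub[OF S] by blast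
      have "\<Sum>T \<in> cube_face S" using sum_in_cube_face[OF T'] le by blast
      then have "\<Sum>T \<bullet> s = 1" using s unfolding cube_face_def by blast
      then show "s \<in> T" unfolding inner_sum_axis_points[OF T' sp] by (simp split: if_splits)
    qed
  qed
next
  assume "S \<subseteq> T"
  then show "cube_face T \<subseteq> cube_face S" unfolding cube_face_def by blast
qed

text \<open>Let \<open>z\<close> be a relative interior point of the face \<open>F\<close> and \<open>S\<close> the set of facets through \<open>z\<close>. A point
  \<open>y\<close> on all these facets can be reached from \<open>z\<close> inside the cube, and the segment can be prolonged
  slightly beyond \<open>z\<close> because the remaining inequalities are strict at \<open>z\<close>. So \<open>z\<close> is an inner point of a segment
  ending at \<open>y\<close>, and \<open>y\<close> belongs to \<open>F\<close>.\<close>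

lemma cube_faces:
  "{F. F face_of cbox (- One) One} = cube_face ` (axis_complex :: 'a::euclidean_space set set)"
proof (intro equalityI subsetI)
  fix F :: "'a set" assume "F \<in> {F. F face_of cbox (- One) One}"
  then have F: "F face_of cbox (- One) One" by simp
  show "F \<in> cube_face ` axis_complex"
  proof (cases "F = {}")
    case True
    then show ?thesis using cube_face_axis_points by (auto simp: antipodal_complex_def)
  next
    case False
    have Fc: "F \<subseteq> cbox (- One) One" using F by (rule face_of_imp_subset)
    have "rel_interior F \<noteq> {}" using rel_interior_eq_empty[OF face_of_imp_convex[OF F]] False by simp
    then obtain z where z: "z \<in> rel_interior F" by blast
    then have zF: "z \<in> F" using rel_interior_subset by blast
    then have zc: "z \<in> cbox (- One) One" using Fc by blast
    define S where "S = {s \<in> axis_points. z \<bullet> s = 1}"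
    have S: "S \<subseteq> axis_points" "\<forall>x\<in>S. - x \<notin> S" by (auto simp: S_def)
    have "F \<subseteq> cube_face S"
    proof -
      have "z \<in> cube_face S" using zc by (simp add: cube_face_def S_def)
      then show ?thesis using subset_of_face_of[OF cube_face_face_of[OF S(1)] Fc] z by blast
    qed
    moreover have "cube_face S \<subseteq> F"
    proof
      fix y assume y: "y \<in> cube_face S"
      then have yc: "y \<in> cbox (- One) One" by (simp add: cube_face_def)
      define e where "e = Min (insert 1 ((\<lambda>t. (1 - z \<bullet> t) / 2) ` (axis_points - S)))"
      have fin: "finite (insert 1 ((\<lambda>t. (1 - z \<bullet> t) / 2) ` (axis_points - S)))"
        using finite_axis_points by blast
      have "0 < (1 - z \<bullet> t) / 2" if "t \<in> axis_points - S" for t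
        using zc that unfolding cube_inner_le S_def by fastforce
      then have e: "0 < e" unfolding e_def using fin by (subst Min_gr_iff) auto
      have e_le: "e \<le> (1 - z \<bullet> t) / 2" if "t \<in> axis_points - S" for t
        unfolding e_def using fin that by (intro Min_le) auto
      define y' where "y' = z + e *\<^sub>R (z - y)"
      have "y' \<bullet> t \<le> 1" if t: "t \<in> axis_points" for t
      proof (cases "t \<in> S")
        case True
        then have "z \<bullet> t = 1" "y \<bullet> t = 1" using y by (auto simp: S_def cube_face_def)
        then show ?thesis by (simp add: y'_def inner_simps)
      next
        case False
        have "z \<bullet> t \<le> 1" "y \<bullet> (- t) \<le> 1" using zc yc t axis_points_uminus[OF t] cube_inner_le by blast+
        then have "(z - y) \<bullet> t \<le> 2" by (simp add: inner_simps)
        then have "e * ((z - y) \<bullet> t) \<le> e * 2" using e by (intro mult_left_mono) auto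
        also have "\<dots> \<le> 1 - z \<bullet> t" using e_le[of t] t False by simp
        finally show ?thesis by (simp add: y'_def inner_simps)
      qed
      then have y'c: "y' \<in> cbox (- One) One" using cube_inner_le by blast
      show "y \<in> F"
      proof (cases "y = z")
        case True
        then show ?thesis using zF by simp
      next
        case False
        define u where "u = 1 / (1 + e)"
        have u: "0 < u" "u < 1" using e by (auto simp: u_def)
        have ue: "u * (1 + e) = 1" using e by (simp add: u_def)
        have "(1 - u) *\<^sub>R y + u *\<^sub>R y' = (u * (1 + e)) *\<^sub>R z + (1 - u * (1 + e)) *\<^sub>R y"
          by (simp add: y'_def algebra_simps)
        then have eq: "z = (1 - u) *\<^sub>R y + u *\<^sub>R y'" by (simp add: ue)
        have "y \<noteq> y'"
        proof
          assume "y = y'"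
          then have "(1 + e) *\<^sub>R (z - y) = 0" by (simp add: y'_def algebra_simps)
          then show False using False e by simp
        qed
        then have "z \<in> open_segment y y'" using eq u unfolding in_segment by blast
        then show ?thesis using F zF yc y'c unfolding face_of_def by blast
      qed
    qed
    ultimately have "F = cube_face S" by (rule subset_antisym)
    then show ?thesis using S by (auto simp: antipodal_complex_def)
  qed
next
  interpret C: pure_complex "DIM('a)" axis_points "axis_complex :: 'a set set" by (rule pure_complex_axis)
  fix F :: "'a set" assume "F \<in> cube_face ` axis_complex"
  then show "F \<in> {F. F face_of cbox (- One) One}" using cube_face_face_of C.sub by blast
qed

lemma cube_face_aff_dim_less:
  fixes S :: "'a::euclidean_space set"
  assumes S: "S \<in> axis_complex" and T: "T \<in> axis_complex" and ST: "S \<subset> T"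
  shows "aff_dim (cube_face T) < aff_dim (cube_face S)"
proof -
  interpret C: pure_complex "DIM('a)" axis_points "axis_complex :: 'a set set" by (rule pure_complex_axis)
  have le: "cube_face T \<subseteq> cube_face S" "\<not> cube_face S \<subseteq> cube_face T"
    using cube_face_mono_iff[OF S T] cube_face_mono_iff[OF T S] ST by blast+
  have faceS: "cube_face S face_of cbox (- One) One" by (rule cube_face_face_of[OF C.sub[OF S]])
  have "cube_face T face_of cube_face S"
    by (rule face_of_subset[OF cube_face_face_of[OF C.sub[OF T]] le(1) face_of_imp_subset[OF faceS]])
  moreover have "cube_face T \<noteq> cube_face S" using le by blast
  ultimately show ?thesis by (rule face_of_aff_dim_lt[OF face_of_imp_convex[OF faceS]])
qed

text \<open>Dimension drops strictly along proper inclusions of faces. From the whole cube down to a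
  vertex there are \<open>n\<close> steps, which leaves no choice.\<close>

lemma aff_dim_cube_face:
  fixes S :: "'a::euclidean_space set"
  assumes S: "S \<in> axis_complex" "S \<noteq> axis_points"
  shows "aff_dim (cube_face S) = int DIM('a) - int (card S)"
proof (rule antisym)
  interpret C: pure_complex "DIM('a)" axis_points "axis_complex :: 'a set set" by (rule pure_complex_axis)
  have finS: "finite S" by (rule C.fin_L[OF S(1)])
  have sub: "A \<in> axis_complex" if "A \<subseteq> S" for A by (rule C.down[OF S that])
  have "aff_dim (cube_face A) \<le> int DIM('a) - int (card A)" if "A \<subseteq> S" for A
    using finite_subset[OF that finS] that
  proof (induction A rule: finite_induct)
    case empty
    then show ?case using aff_dim_le_DIM by simp
  next
    case (insert x A)
    have "aff_dim (cube_face (insert x A)) < aff_dim (cube_face A)"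
      using insert sub by (intro cube_face_aff_dim_less) auto
    then show ?case using insert by simp
  qed
  then show "aff_dim (cube_face S) \<le> int DIM('a) - int (card S)" by blast
  have "int DIM('a) - int (card A) \<le> aff_dim (cube_face A)"
    if "A \<in> axis_complex" "A \<noteq> axis_points" for A :: "'a set"
    using that
  proof (induction "DIM('a) - card A" arbitrary: A)
    case 0
    then have A: "A \<subseteq> axis_points" "\<forall>x\<in>A. - x \<notin> A" by (auto simp: antipodal_complex_def)
    have "cube_face A \<noteq> {}" using sum_in_cube_face[OF A] by blast
    then have "aff_dim (cube_face A) \<ge> 0" using aff_dim_geq[of "cube_face A"] aff_dim_empty[of "cube_face A"] by linarith
    then show ?case using 0 by simp
  next
    case (Suc m)
    then have "card A < DIM('a)" by simp
    then obtain x where x: "x \<in> axis_points - A" "insert x A \<in> axis_complex" using C.ext[OF Suc.prems(1)] by blast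
    have c: "card (insert x A) = Suc (card A)" using x C.fin_L[OF Suc.prems(1)] by simp
    then have "insert x A \<noteq> axis_points" using \<open>card A < DIM('a)\<close> by (intro C.not_top) simp
    then have "int DIM('a) - int (card (insert x A)) \<le> aff_dim (cube_face (insert x A))"
      using Suc.hyps(1)[of "insert x A"] Suc.hyps(2) x(2) c by simp
    moreover have "aff_dim (cube_face (insert x A)) < aff_dim (cube_face A)"
      using x Suc.prems by (intro cube_face_aff_dim_less) auto
    ultimately show ?case using c by simp
  qed
  from this[OF S] show "int DIM('a) - int (card S) \<le> aff_dim (cube_face S)" .
qed

lemma rho_words_cube:
  fixes \<Phi> :: "'a::euclidean_space set set"
  assumes n: "n = DIM('a)" "2 \<le> n" and flag: "\<Phi> \<in> flags cube_lattice"
  shows "reflexible n cube_lattice \<Phi>"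
    and "\<lbrakk>u \<in> lists {..<n}; v \<in> lists {..<n}\<rbrakk> \<Longrightarrow>
      rho_word cube_lattice \<Phi> u = rho_word cube_lattice \<Phi> v \<longleftrightarrow> actB u = actB v"
proof -
  let ?V = "axis_points :: 'a set" and ?L = "axis_complex :: 'a set set"
  let ?P = "face_lattice (cbox (- One) (One :: 'a))"
  have cl: "cube_lattice = ?P" by (simp add: cube_lattice_def)
  have faces: "faces ?P = cube_face ` ?L"
    unfolding face_lattice_simps by (rule cube_faces)
  have "inj_on cube_face ?L"
  proof (rule inj_onI)
    fix A B assume AB: "A \<in> ?L" "B \<in> ?L" "cube_face A = cube_face B"
    then show "A = B" using cube_face_mono_iff[OF AB(1,2)] cube_face_mono_iff[OF AB(2,1)] by blast
  qed
  then have bij: "bij_betw cube_face ?L (faces ?P)"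
    by (simp only: faces bij_betw_def simp_thms)
  have below: "below ?P (cube_face A) (cube_face B) \<longleftrightarrow> (if True then B \<subset> A else A \<subset> B)" if "A \<in> ?L" "B \<in> ?L" for A B
    using cube_face_mono_iff[OF that] cube_face_mono_iff[OF that(2,1)] by (simp add: less_le_not_le)
  have rank: "face_rank ?P (cube_face A) =
      (if True then (if A = ?V then -1 else int n - int (card A)) else (if A = ?V then int n else int (card A) - 1))"
    if A: "A \<in> ?L" for A
    using aff_dim_cube_face[OF A] n(1) by (simp add: cube_face_axis_points)
  have V: "card ?V = 2 * n" using card_axis_points n(1) by simp
  have fl: "\<Phi> \<in> flags ?P" using flag cl by simp
  show "reflexible n cube_lattice \<Phi>"
    unfolding cl by (rule rho_words_antipodal(1)[where dual = True and a = uminus, OF n(2) finite_axis_points V _ _ _ bij _ _ fl])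
      (rule axis_points_uminus minus_minus uminus_neq below rank; assumption)+
  show "rho_word cube_lattice \<Phi> u = rho_word cube_lattice \<Phi> v \<longleftrightarrow> actB u = actB v"
    if "u \<in> lists {..<n}" "v \<in> lists {..<n}"
  proof -
    have "rho_word ?P \<Phi> u = rho_word ?P \<Phi> v \<longleftrightarrow> (if True then actB u = actB v else actC n u = actC n v)"
      by (rule rho_words_antipodal(2)[where dual = True and a = uminus, OF n(2) finite_axis_points V _ _ _ bij _ _ fl that])
        (rule axis_points_uminus minus_minus uminus_neq below rank; assumption)+
    then show ?thesis unfolding cl by simp
  qed
qed

section \<open>Counting\<close>

lemma mix_word_eq_iff:
  "mix_word Ps u = mix_word Ps v \<longleftrightarrow>
    (\<forall>r<length Ps. rho_word (fst (Ps ! r)) (snd (Ps ! r)) u = rho_word (fst (Ps ! r)) (snd (Ps ! r)) v)"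
  unfolding mix_word_eq by (auto simp: fun_eq_iff restrict_def)

lemma mix_counts:
  fixes E :: "nat list \<Rightarrow> 'e"
  assumes n: "3 \<le> n" and refl: "\<forall>r<length Ps. reflexible n (fst (Ps ! r)) (snd (Ps ! r))"
    and E: "string_words n E" and pos: "0 < card (E ` lists {..<n})"
    and kernel: "\<forall>u\<in>lists {..<n}. \<forall>v\<in>lists {..<n}. mix_word Ps u = mix_word Ps v \<longleftrightarrow> E u = E v"
  shows "card (flags (mix n Ps)) = card (E ` lists {..<n})"
    and "k < n \<Longrightarrow> card (k_faces (mix n Ps) (int k)) * (card (E ` lists {..<k}) * card (E ` lists {k<..<n}))
      = card (E ` lists {..<n})"
proof -
  have eq: "card (mix_word Ps ` lists I) = card (E ` lists I)" if "I \<subseteq> {..<n}" for I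
    using lists_mono[OF that] by (intro card_image_cong_kernel kernel[rule_format]) auto
  interpret reflexible_mix n Ps using refl by unfold_locales blast
  have "0 < card (mix_word Ps ` lists {..<n})" using pos eq[OF order_refl] by simp
  then have fin: "finite (mix_word Ps ` lists {..<n})" by (rule card_ge_0_finite)
  have "string_words n (mix_word Ps)"
    by (rule string_words_cong_kernel[OF E]) (rule kernel[rule_format])
  then interpret string_mix n Ps
    using n fin by (intro string_mix.intro string_mix_axioms.intro reflexible_mix_axioms)
  show "card (flags (mix n Ps)) = card (E ` lists {..<n})"
    using card_flags_mix eq[OF order_refl] by simp
  show "card (k_faces (mix n Ps) (int k)) * (card (E ` lists {..<k}) * card (E ` lists {k<..<n})) = card (E ` lists {..<n})"
    if k: "k < n"
  proof -
    have "{..<k} \<subseteq> {..<n}" "{k<..<n} \<subseteq> {..<n}" using k by auto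
    then show ?thesis using card_faces_mix[OF k] eq by simp
  qed
qed

lemma two_power_pred: "0 < n \<Longrightarrow> 2 * 2 ^ (n - 1) = (2 :: nat) ^ n"
  by (cases n) auto

text \<open>The following lemmas solve \<open>f\<^sub>k \<cdot> |lower part| \<cdot> |upper part| = |\<Gamma>|\<close> for \<open>f\<^sub>k\<close>, according to which parts are
  mixes of a symmetric with a hyperoctahedral group.\<close>

lemma face_count_lower_mix:
  fixes F L U g n k :: nat
  assumes k: "k < n" and F: "F * (L * U) = g" and L: "2 * L = fact (Suc k) * (2 ^ k * fact k)"
    and U: "U = fact (n - k)" and g: "2 * g = fact (Suc n) * (2 ^ n * fact n)"
  shows "F = 2 ^ (n - k) * fact (n - k) * ((n + 1) choose (k + 1)) * (n choose k)"
proof -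
  let ?X = "fact (Suc k) * (2 ^ k * fact k) * fact (n - k) :: nat"
  have "F * ?X = 2 * g" unfolding L[symmetric] U[symmetric] F[symmetric] by simp
  also have "\<dots> = (2 ^ (n - k) * 2 ^ k) * (fact (Suc k) * fact (n - k) * (Suc n choose Suc k))
      * (fact k * fact (n - k) * (n choose k))"
  proof -
    have "(2 :: nat) ^ (n - k) * 2 ^ k = 2 ^ n" using k by (simp flip: power_add)
    moreover have "fact (Suc k) * fact (n - k) * (Suc n choose Suc k) = fact (Suc n)"
      using binomial_fact_lemma[of "Suc k" "Suc n"] k by (simp only: diff_Suc_Suc Suc_le_mono less_imp_le Suc_leD Suc_leI)
    moreover have "fact k * fact (n - k) * (n choose k) = fact n" using k by (intro binomial_fact_lemma) simp
    ultimately show ?thesis unfolding g by (simp only: ac_simps)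
  qed
  also have "\<dots> = (2 ^ (n - k) * fact (n - k) * ((n + 1) choose (k + 1)) * (n choose k)) * ?X"
    by (simp only: Suc_eq_plus1 ac_simps)
  finally show ?thesis by (simp only: mult_cancel2) simp
qed

lemma face_count_upper_mix:
  fixes F L U g n k :: nat
  assumes k: "Suc k < n" and F: "F * (L * U) = g" and L: "L = fact (Suc k)"
    and U: "2 * U = fact (n - k) * (2 ^ (n - Suc k) * fact (n - Suc k))" and g: "2 * g = fact (Suc n) * (2 ^ n * fact n)"
  shows "F = 2 ^ (k + 1) * fact (k + 1) * ((n + 1) choose (k + 1)) * (n choose (k + 1))"
proof -
  let ?X = "fact (Suc k) * (fact (n - k) * (2 ^ (n - Suc k) * fact (n - Suc k))) :: nat"
  have "F * ?X = 2 * g" unfolding L[symmetric] U[symmetric] F[symmetric] by simp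
  also have "\<dots> = (2 ^ Suc k * 2 ^ (n - Suc k)) * (fact (Suc k) * fact (n - k) * (Suc n choose Suc k))
      * (fact (Suc k) * fact (n - Suc k) * (n choose Suc k))"
  proof -
    have "(2 :: nat) ^ Suc k * 2 ^ (n - Suc k) = 2 ^ n" using k by (simp flip: power_add del: power_Suc)
    moreover have "fact (Suc k) * fact (n - k) * (Suc n choose Suc k) = fact (Suc n)"
      using binomial_fact_lemma[of "Suc k" "Suc n"] k by (simp only: diff_Suc_Suc Suc_le_mono less_imp_le Suc_leD Suc_leI)
    moreover have "fact (Suc k) * fact (n - Suc k) * (n choose Suc k) = fact n"
      using k by (intro binomial_fact_lemma) simp
    ultimately show ?thesis unfolding g by (simp only: ac_simps)
  qed
  also have "\<dots> = (2 ^ (k + 1) * fact (k + 1) * ((n + 1) choose (k + 1)) * (n choose (k + 1))) * ?X"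
    by (simp only: Suc_eq_plus1 ac_simps)
  finally show ?thesis by (simp only: mult_cancel2) simp
qed

lemma face_count_two_mixes:
  fixes F L U g c n k :: nat
  assumes k: "Suc k < n" and F: "F * (L * U) = g" and L: "2 * L = fact (Suc k) * (2 ^ k * fact k)"
    and U: "2 * U = fact (n - k) * (2 ^ (n - Suc k) * fact (n - Suc k))"
    and g: "4 * g = c * 2 ^ (n - 1) * fact n * fact n"
  shows "F = c * (n choose k) * (n choose (k + 1))"
proof -
  let ?X = "(fact (Suc k) * (2 ^ k * fact k)) * (fact (n - k) * (2 ^ (n - Suc k) * fact (n - Suc k))) :: nat"
  have "F * ?X = 4 * g" unfolding L[symmetric] U[symmetric] F[symmetric] by simp
  also have "\<dots> = c * (2 ^ k * 2 ^ (n - Suc k)) * (fact k * fact (n - k) * (n choose k))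
      * (fact (Suc k) * fact (n - Suc k) * (n choose Suc k))"
    using k unfolding g by (subst (1 2) binomial_fact_lemma) (simp_all flip: power_add)
  also have "\<dots> = (c * (n choose k) * (n choose (k + 1))) * ?X"
    by (simp only: Suc_eq_plus1 ac_simps)
  finally show ?thesis by (simp only: mult_cancel2) simp
qed

text \<open>For a vertex or a facet one of the two parts is empty.\<close>

lemma face_count_end:
  fixes F U g c n :: nat
  assumes n: "0 < n" and F: "F * U = g" and U: "2 * U = fact n * (2 ^ (n - 1) * fact (n - 1))"
    and g: "2 * g = c * 2 ^ (n - 1) * fact n * fact n"
  shows "F = c * n"
proof -
  let ?X = "fact n * (2 ^ (n - 1) * fact (n - 1)) :: nat"
  have "F * ?X = 2 * g" unfolding U[symmetric] F[symmetric] by simp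
  also have "\<dots> = c * 2 ^ (n - 1) * fact n * (n * fact (n - 1))"
    unfolding g using fact_reduce[OF n, where 'a = nat] by simp
  also have "\<dots> = (c * n) * ?X" by (simp only: ac_simps)
  finally show ?thesis by (simp only: mult_cancel2) simp
qed

lemma flag_count_one_mix:
  fixes g n :: nat
  assumes "0 < n" and g: "2 * g = fact (Suc n) * (2 ^ n * fact n)"
  shows "g = 2 ^ (n - 1) * fact n * fact (n + 1)"
proof -
  have "2 * g = 2 * (2 ^ (n - 1) * fact n * fact (n + 1))"
    unfolding g two_power_pred[OF assms(1), symmetric] by (simp only: Suc_eq_plus1 ac_simps)
  then show ?thesis by linarith
qed

lemma binomial_ends: "0 < n \<Longrightarrow> (Suc n choose n) * (n choose (n - 1)) = Suc n * n"
  using binomial_symmetric[of n "Suc n"] binomial_symmetric[of "n - 1" n] by simp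

lemma counts_TB:
  fixes \<Phi>T \<Phi>B :: "'a::euclidean_space set set"
  assumes n: "n = DIM('a)" "3 \<le> n" and T: "\<Phi>T \<in> flags simplex_lattice" and B: "\<Phi>B \<in> flags cube_lattice"
  defines "M \<equiv> mix n [(simplex_lattice, \<Phi>T), (cube_lattice, \<Phi>B)]"
  shows "card (flags M) = 2 ^ (n - 1) * fact n * fact (n + 1)"
    and "card (k_faces M (int 0)) = 2 ^ (n - 1) * fact (n + 1)"
    and "card (k_faces M (int (n - 1))) = 2 * n * (n + 1)"
    and "\<lbrakk>1 \<le> k; k \<le> n - 1\<rbrakk> \<Longrightarrow> card (k_faces M (int k)) =
      2 ^ (n - k) * fact (n - k) * ((n + 1) choose (k + 1)) * (n choose k)"
proof -
  let ?Ps = "[(simplex_lattice, \<Phi>T), (cube_lattice, \<Phi>B)]"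
  let ?E = "\<lambda>w. (actT w, actB w)"
  have n2: "2 \<le> n" using n by simp
  have g: "2 * card (?E ` lists {..<n}) = fact (Suc n) * (2 ^ n * fact n)"
    using n by (intro card_TB_lower) simp
  have pos: "0 < card (?E ` lists {..<n})" by (rule ccontr) (use g in simp)
  have refl: "\<forall>r<length ?Ps. reflexible n (fst (?Ps ! r)) (snd (?Ps ! r))"
    using rho_words_simplex(1)[OF n(1) T] rho_words_cube(1)[OF n(1) n2 B] by (auto simp: less_Suc_eq)
  have "mix_word ?Ps u = mix_word ?Ps v \<longleftrightarrow> ?E u = ?E v" if "u \<in> lists {..<n}" "v \<in> lists {..<n}" for u v
    using rho_words_simplex(2)[OF n(1) T that] rho_words_cube(2)[OF n(1) n2 B that]
    unfolding mix_word_eq_iff by (auto simp: All_less_Suc)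
  then have kernel: "\<forall>u\<in>lists {..<n}. \<forall>v\<in>lists {..<n}. mix_word ?Ps u = mix_word ?Ps v \<longleftrightarrow> ?E u = ?E v" by blast
  note counts = mix_counts[OF n(2) refl string_words_pair[OF string_words_agen string_words_bgen] pos kernel, folded M_def]
  have g': "card (?E ` lists {..<n}) = 2 ^ (n - 1) * fact n * fact (n + 1)"
    using g n(2) by (intro flag_count_one_mix) simp_all
  show "card (flags M) = 2 ^ (n - 1) * fact n * fact (n + 1)" using counts(1) g' by simp
  have "card (k_faces M (int 0)) * fact n = (2 ^ (n - 1) * fact (n + 1)) * fact n"
    using counts(2)[of 0] card_TB_upper[of 0 n] n(2) g' by (simp add: ac_simps)
  then show "card (k_faces M (int 0)) = 2 ^ (n - 1) * fact (n + 1)" by (simp only: mult_cancel2) simp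
  have mid: "card (k_faces M (int k)) = 2 ^ (n - k) * fact (n - k) * ((n + 1) choose (k + 1)) * (n choose k)"
    if k: "1 \<le> k" "k \<le> n - 1" for k
  proof -
    have "k < n" "0 < k" using k n(2) by auto
    then show ?thesis by (intro face_count_lower_mix[OF _ counts(2) card_TB_lower card_TB_upper g])
  qed
  then show "\<lbrakk>1 \<le> k; k \<le> n - 1\<rbrakk> \<Longrightarrow> card (k_faces M (int k)) =
      2 ^ (n - k) * fact (n - k) * ((n + 1) choose (k + 1)) * (n choose k)" .
  show "card (k_faces M (int (n - 1))) = 2 * n * (n + 1)"
    using mid[of "n - 1"] binomial_ends[of n] n(2) by simp
qed

lemma counts_TC:
  fixes \<Phi>T \<Phi>C :: "'a::euclidean_space set set"
  assumes n: "n = DIM('a)" "3 \<le> n" and T: "\<Phi>T \<in> flags simplex_lattice" and C: "\<Phi>C \<in> flags cross_polytope_lattice"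
  defines "M \<equiv> mix n [(simplex_lattice, \<Phi>T), (cross_polytope_lattice, \<Phi>C)]"
  shows "card (flags M) = 2 ^ (n - 1) * fact n * fact (n + 1)"
    and "card (k_faces M (int 0)) = 2 * n * (n + 1)"
    and "card (k_faces M (int (n - 1))) = 2 ^ (n - 1) * fact (n + 1)"
    and "k \<le> n - 2 \<Longrightarrow> card (k_faces M (int k)) =
      2 ^ (k + 1) * fact (k + 1) * ((n + 1) choose (k + 1)) * (n choose (k + 1))"
proof -
  let ?Ps = "[(simplex_lattice, \<Phi>T), (cross_polytope_lattice, \<Phi>C)]"
  let ?E = "\<lambda>w. (actT w, actC n w)"
  have n2: "2 \<le> n" using n by simp
  have g: "2 * card (?E ` lists {..<n}) = fact (Suc n) * (2 ^ n * fact n)"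
    using n by (intro card_TC_full) simp
  have pos: "0 < card (?E ` lists {..<n})" by (rule ccontr) (use g in simp)
  have refl: "\<forall>r<length ?Ps. reflexible n (fst (?Ps ! r)) (snd (?Ps ! r))"
    using rho_words_simplex(1)[OF n(1) T] rho_words_cross_polytope(1)[OF n(1) n2 C] by (auto simp: less_Suc_eq)
  have "mix_word ?Ps u = mix_word ?Ps v \<longleftrightarrow> ?E u = ?E v" if "u \<in> lists {..<n}" "v \<in> lists {..<n}" for u v
    using rho_words_simplex(2)[OF n(1) T that] rho_words_cross_polytope(2)[OF n(1) n2 C that]
    unfolding mix_word_eq_iff by (auto simp: All_less_Suc)
  then have kernel: "\<forall>u\<in>lists {..<n}. \<forall>v\<in>lists {..<n}. mix_word ?Ps u = mix_word ?Ps v \<longleftrightarrow> ?E u = ?E v" by blast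
  note counts = mix_counts[OF n(2) refl string_words_pair[OF string_words_agen string_words_actC] pos kernel, folded M_def]
  have g': "card (?E ` lists {..<n}) = 2 ^ (n - 1) * fact n * fact (n + 1)"
    using g n(2) by (intro flag_count_one_mix) simp_all
  show "card (flags M) = 2 ^ (n - 1) * fact n * fact (n + 1)" using counts(1) g' by simp
  have "{n - 1<..<n} = {}" by auto
  then have "card (k_faces M (int (n - 1))) * fact n = (2 ^ (n - 1) * fact (n + 1)) * fact n"
    using counts(2)[of "n - 1"] card_TC_lower[of "n - 1" n] n(2) g' by (simp add: ac_simps del: fact_Suc)
  then show "card (k_faces M (int (n - 1))) = 2 ^ (n - 1) * fact (n + 1)" by (simp only: mult_cancel2) simp
  have mid: "card (k_faces M (int k)) = 2 ^ (k + 1) * fact (k + 1) * ((n + 1) choose (k + 1)) * (n choose (k + 1))"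
    if k: "k \<le> n - 2" for k
  proof -
    have "Suc k < n" "k < n" using k n(2) by auto
    then show ?thesis by (intro face_count_upper_mix[OF _ counts(2) card_TC_lower card_TC_upper g])
  qed
  then show "k \<le> n - 2 \<Longrightarrow> card (k_faces M (int k)) =
      2 ^ (k + 1) * fact (k + 1) * ((n + 1) choose (k + 1)) * (n choose (k + 1))" .
  show "card (k_faces M (int 0)) = 2 * n * (n + 1)" using mid[of 0] by simp
qed

lemma counts_BC:
  fixes \<Phi>B \<Phi>C :: "'a::euclidean_space set set"
  assumes n: "n = DIM('a)" "3 \<le> n" and B: "\<Phi>B \<in> flags cube_lattice" and C: "\<Phi>C \<in> flags cross_polytope_lattice"
  defines "M \<equiv> mix n [(cube_lattice, \<Phi>B), (cross_polytope_lattice, \<Phi>C)]"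
  shows "card (flags M) = 2 ^ (2 * n - 1) * (fact n)\<^sup>2"
    and "card (k_faces M (int 0)) = 2 ^ (n + 1) * n"
    and "card (k_faces M (int (n - 1))) = 2 ^ (n + 1) * n"
    and "\<lbrakk>1 \<le> k; k \<le> n - 2\<rbrakk> \<Longrightarrow> card (k_faces M (int k)) = 2 ^ (n + 2) * (n choose k) * (n choose (k + 1))"
proof -
  let ?Ps = "[(cube_lattice, \<Phi>B), (cross_polytope_lattice, \<Phi>C)]"
  let ?E = "\<lambda>w. (actC n w, actB w)"
  have n2: "2 \<le> n" using n by simp
  have g: "2 * card (?E ` lists {..<n}) = (2 ^ n * fact n) * (2 ^ n * fact n)"
    using n by (intro card_CB_full)
  have pos: "0 < card (?E ` lists {..<n})" by (rule ccontr) (use g in simp)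
  have refl: "\<forall>r<length ?Ps. reflexible n (fst (?Ps ! r)) (snd (?Ps ! r))"
    using rho_words_cube(1)[OF n(1) n2 B] rho_words_cross_polytope(1)[OF n(1) n2 C] by (auto simp: less_Suc_eq)
  have "mix_word ?Ps u = mix_word ?Ps v \<longleftrightarrow> ?E u = ?E v" if "u \<in> lists {..<n}" "v \<in> lists {..<n}" for u v
    using rho_words_cube(2)[OF n(1) n2 B that] rho_words_cross_polytope(2)[OF n(1) n2 C that]
    unfolding mix_word_eq_iff by (auto simp: All_less_Suc)
  then have kernel: "\<forall>u\<in>lists {..<n}. \<forall>v\<in>lists {..<n}. mix_word ?Ps u = mix_word ?Ps v \<longleftrightarrow> ?E u = ?E v" by blast
  note counts = mix_counts[OF n(2) refl string_words_pair[OF string_words_actC string_words_bgen] pos kernel, folded M_def]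
  obtain m where m: "n = Suc m" using n(2) by (cases n) auto
  have g2: "2 * card (?E ` lists {..<n}) = 2 ^ (n + 1) * 2 ^ (n - 1) * fact n * fact n"
    unfolding g by (simp add: m ac_simps del: fact_Suc)
  have "2 * card (?E ` lists {..<n}) = 2 * (2 ^ (2 * n - 1) * (fact n)\<^sup>2)"
  proof -
    have "2 * n - 1 = m + n" using m by simp
    then have "(2 :: nat) ^ (2 * n - 1) = 2 ^ m * 2 ^ n" by (simp only: power_add)
    then show ?thesis unfolding g2 by (simp add: m power2_eq_square ac_simps del: fact_Suc)
  qed
  then show "card (flags M) = 2 ^ (2 * n - 1) * (fact n)\<^sup>2" using counts(1) by simp
  show "card (k_faces M (int 0)) = 2 ^ (n + 1) * n"
  proof (rule face_count_end[OF _ _ _ g2])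
    show "card (k_faces M (int 0)) * card (?E ` lists {0<..<n}) = card (?E ` lists {..<n})"
      using counts(2)[of 0] n(2) by simp
    show "2 * card (?E ` lists {0<..<n}) = fact n * (2 ^ (n - 1) * fact (n - 1))"
      using card_TC_upper[of 0 n] n(2) by (simp add: card_CB_upper)
  qed (use n in simp)
  show "card (k_faces M (int (n - 1))) = 2 ^ (n + 1) * n"
  proof (rule face_count_end[OF _ _ _ g2])
    have "{n - 1<..<n} = {}" by auto
    then show "card (k_faces M (int (n - 1))) * card (?E ` lists {..<n - 1}) = card (?E ` lists {..<n})"
      using counts(2)[of "n - 1"] n(2) by simp
    show "2 * card (?E ` lists {..<n - 1}) = fact n * (2 ^ (n - 1) * fact (n - 1))"
      using card_TB_lower[of "n - 1"] n(2) by (simp add: card_CB_lower del: fact_Suc)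
  qed (use n in simp)
  show "card (k_faces M (int k)) = 2 ^ (n + 2) * (n choose k) * (n choose (k + 1))" if k: "1 \<le> k" "k \<le> n - 2"
  proof -
    have k': "Suc k < n" "k < n" "0 < k" using k n(2) by auto
    have "4 * card (?E ` lists {..<n}) = 2 ^ (n + 2) * 2 ^ (n - 1) * fact n * fact n" using g2 by simp
    then show ?thesis
      using card_TB_lower[OF k'(3)] card_TC_upper[OF k'(1)]
      by (intro face_count_two_mixes[OF k'(1) counts(2)[OF k'(2)]]) (simp_all only: card_CB_lower[OF k'(2)] card_CB_upper)
  qed
qed

lemma counts_TBC:
  fixes \<Phi>T \<Phi>B \<Phi>C :: "'a::euclidean_space set set"
  assumes n: "n = DIM('a)" "3 \<le> n" and T: "\<Phi>T \<in> flags simplex_lattice" and B: "\<Phi>B \<in> flags cube_lattice"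
    and C: "\<Phi>C \<in> flags cross_polytope_lattice"
  defines "M \<equiv> mix n [(simplex_lattice, \<Phi>T), (cube_lattice, \<Phi>B), (cross_polytope_lattice, \<Phi>C)]"
  shows "card (flags M) = 2 ^ (2 * n - 2) * (fact n)\<^sup>2 * fact (n + 1)"
    and "card (k_faces M (int 0)) = 2 ^ n * n * fact (n + 1)"
    and "card (k_faces M (int (n - 1))) = 2 ^ n * n * fact (n + 1)"
    and "\<lbrakk>1 \<le> k; k \<le> n - 2\<rbrakk> \<Longrightarrow> card (k_faces M (int k)) =
      2 ^ (n + 1) * fact (n + 1) * (n choose k) * (n choose (k + 1))"
proof -
  let ?Ps = "[(simplex_lattice, \<Phi>T), (cube_lattice, \<Phi>B), (cross_polytope_lattice, \<Phi>C)]"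
  let ?E = "\<lambda>w. ((actT w, actC n w), actB w)"
  have n2: "2 \<le> n" using n by simp
  have g: "4 * card (?E ` lists {..<n}) = fact (Suc n) * (2 ^ n * fact n) * (2 ^ n * fact n)"
    using n by (intro card_TCB_full)
  have pos: "0 < card (?E ` lists {..<n})" by (rule ccontr) (use g in simp)
  have refl: "\<forall>r<length ?Ps. reflexible n (fst (?Ps ! r)) (snd (?Ps ! r))"
    using rho_words_simplex(1)[OF n(1) T] rho_words_cube(1)[OF n(1) n2 B]
      rho_words_cross_polytope(1)[OF n(1) n2 C] by (auto simp: less_Suc_eq)
  have "mix_word ?Ps u = mix_word ?Ps v \<longleftrightarrow> ?E u = ?E v" if "u \<in> lists {..<n}" "v \<in> lists {..<n}" for u v
    using rho_words_simplex(2)[OF n(1) T that] rho_words_cube(2)[OF n(1) n2 B that]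
      rho_words_cross_polytope(2)[OF n(1) n2 C that]
    unfolding mix_word_eq_iff by (auto simp: All_less_Suc)
  then have kernel: "\<forall>u\<in>lists {..<n}. \<forall>v\<in>lists {..<n}. mix_word ?Ps u = mix_word ?Ps v \<longleftrightarrow> ?E u = ?E v" by blast
  note counts = mix_counts[OF n(2) refl string_words_pair[OF string_words_pair[OF string_words_agen string_words_actC]
      string_words_bgen] pos kernel, folded M_def]
  obtain m where m: "n = Suc m" using n(2) by (cases n) auto
  have g4: "4 * card (?E ` lists {..<n}) = (2 ^ (n + 1) * fact (n + 1)) * 2 ^ (n - 1) * fact n * fact n"
    unfolding g by (simp add: m ac_simps del: fact_Suc)
  have "4 * card (?E ` lists {..<n}) = 2 * ((2 ^ n * fact (n + 1)) * 2 ^ (n - 1) * fact n * fact n)"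
    unfolding g4 by simp
  then have g2: "2 * card (?E ` lists {..<n}) = (2 ^ n * fact (n + 1)) * 2 ^ (n - 1) * fact n * fact n" by linarith
  have "4 * card (?E ` lists {..<n}) = 4 * (2 ^ (2 * n - 2) * (fact n)\<^sup>2 * fact (n + 1))"
  proof -
    have "2 * n - 2 = m + m" using m by simp
    then have "(2 :: nat) ^ (2 * n - 2) = 2 ^ m * 2 ^ m" by (simp only: power_add)
    then show ?thesis unfolding g4 by (simp add: m power2_eq_square ac_simps del: fact_Suc)
  qed
  then show "card (flags M) = 2 ^ (2 * n - 2) * (fact n)\<^sup>2 * fact (n + 1)" using counts(1) by simp
  have "card (k_faces M (int 0)) = (2 ^ n * fact (n + 1)) * n"
  proof (rule face_count_end[OF _ _ _ g2])
    show "card (k_faces M (int 0)) * card (?E ` lists {0<..<n}) = card (?E ` lists {..<n})"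
      using counts(2)[of 0] n(2) by simp
    show "2 * card (?E ` lists {0<..<n}) = fact n * (2 ^ (n - 1) * fact (n - 1))"
      using card_TC_upper[of 0 n] n(2) by (simp add: card_TCB_upper)
  qed (use n in simp)
  then show "card (k_faces M (int 0)) = 2 ^ n * n * fact (n + 1)" by (simp only: ac_simps)
  have "card (k_faces M (int (n - 1))) = (2 ^ n * fact (n + 1)) * n"
  proof (rule face_count_end[OF _ _ _ g2])
    have "{n - 1<..<n} = {}" by auto
    then show "card (k_faces M (int (n - 1))) * card (?E ` lists {..<n - 1}) = card (?E ` lists {..<n})"
      using counts(2)[of "n - 1"] n(2) by simp
    show "2 * card (?E ` lists {..<n - 1}) = fact n * (2 ^ (n - 1) * fact (n - 1))"
      using card_TB_lower[of "n - 1"] n(2) by (simp add: card_TCB_lower del: fact_Suc)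
  qed (use n in simp)
  then show "card (k_faces M (int (n - 1))) = 2 ^ n * n * fact (n + 1)" by (simp only: ac_simps)
  show "card (k_faces M (int k)) = 2 ^ (n + 1) * fact (n + 1) * (n choose k) * (n choose (k + 1))"
    if k: "1 \<le> k" "k \<le> n - 2"
  proof -
    have k': "Suc k < n" "k < n" "0 < k" using k n(2) by auto
    show ?thesis
      using card_TB_lower[OF k'(3)] card_TC_upper[OF k'(1)] g4
      by (intro face_count_two_mixes[OF k'(1) counts(2)[OF k'(2)]]) (simp_all only: card_TCB_lower[OF k'(2)] card_TCB_upper)
  qed
qed

theorem mainTheorem4:
  fixes n :: nat and \<Phi>T \<Phi>B \<Phi>C :: "'a::euclidean_space set set"
  assumes "n = DIM('a)" and "n \<ge> 5"
    and "\<Phi>T \<in> flags simplex_lattice"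
    and "\<Phi>B \<in> flags cube_lattice"
    and "\<Phi>C \<in> flags cross_polytope_lattice"
  shows "
    (let M = mix n [(simplex_lattice, \<Phi>T), (cube_lattice, \<Phi>B)];
         g = card (flags M); f = (\<lambda>k::nat. card (k_faces M (int k)))
     in g = 2 ^ (n - 1) * fact n * fact (n + 1) \<and>
        f 0 = 2 ^ (n - 1) * fact (n + 1) \<and>
        f (n - 1) = 2 * n * (n + 1) \<and>
        (\<forall>k. 1 \<le> k \<and> k \<le> n - 1 \<longrightarrow>
          f k = 2 ^ (n - k) * fact (n - k) * ((n + 1) choose (k + 1)) * (n choose k))) \<and>
    (let M = mix n [(simplex_lattice, \<Phi>T), (cross_polytope_lattice, \<Phi>C)];
         g = card (flags M); f = (\<lambda>k::nat. card (k_faces M (int k)))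
     in g = 2 ^ (n - 1) * fact n * fact (n + 1) \<and>
        f 0 = 2 * n * (n + 1) \<and>
        f (n - 1) = 2 ^ (n - 1) * fact (n + 1) \<and>
        (\<forall>k \<le> n - 2.
          f k = 2 ^ (k + 1) * fact (k + 1) * ((n + 1) choose (k + 1)) * (n choose (k + 1)))) \<and>
    (let M = mix n [(cube_lattice, \<Phi>B), (cross_polytope_lattice, \<Phi>C)];
         g = card (flags M); f = (\<lambda>k::nat. card (k_faces M (int k)))
     in g = 2 ^ (2 * n - 1) * (fact n)\<^sup>2 \<and>
        f 0 = 2 ^ (n + 1) * n \<and>
        f (n - 1) = 2 ^ (n + 1) * n \<and>
        (\<forall>k. 1 \<le> k \<and> k \<le> n - 2 \<longrightarrow>
          f k = 2 ^ (n + 2) * (n choose k) * (n choose (k + 1)))) \<and>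
    (let M = mix n [(simplex_lattice, \<Phi>T), (cube_lattice, \<Phi>B), (cross_polytope_lattice, \<Phi>C)];
         g = card (flags M); f = (\<lambda>k::nat. card (k_faces M (int k)))
     in g = 2 ^ (2 * n - 2) * (fact n)\<^sup>2 * fact (n + 1) \<and>
        f 0 = 2 ^ n * n * fact (n + 1) \<and>
        f (n - 1) = 2 ^ n * n * fact (n + 1) \<and>
        (\<forall>k. 1 \<le> k \<and> k \<le> n - 2 \<longrightarrow>
          f k = 2 ^ (n + 1) * fact (n + 1) * (n choose k) * (n choose (k + 1))))"
proof -
  have n3: "3 \<le> n" using assms(2) by simp
  note TB = counts_TB[OF assms(1) n3 assms(3,4)] and TC = counts_TC[OF assms(1) n3 assms(3,5)]
    and BC = counts_BC[OF assms(1) n3 assms(4,5)] and TBC = counts_TBC[OF assms(1) n3 assms(3,4,5)]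
  show ?thesis
    unfolding Let_def by (intro conjI allI impI TB TC BC TBC) auto
qed

end
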